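(* Let $S=K[x_1,\dots,x_n]$ be the polynomial ring over a field $K$, let $\mathfrak{m}=(x_1,\dots,x_n)$, let $I\subset S$ be a vertex splittable monomial ideal such that $I\subseteq\mathfrak{m}^2$, and let $x_i$ be a splitting vertex of $I$. Then the following conditions are equivalent: (a) $I$ is Cohen--Macaulay. (b) $(I:x_i)$ and $(I,x_i)$ are Cohen--Macaulay, and $\operatorname{depth} S/(I:x_i)=\operatorname{depth} S/(I,x_i)$.
   Context: $S$ has the standard grading, $\deg x_j=1$. For a monomial ideal $I$, $\mathcal{G}(I)$ denotes its unique minimal set of monomial generators. A graded ideal $I\subset S$ is called Cohen--Macaulay if $S/I$ is a Cohen--Macaulay $S$-module, i.e. $\operatorname{depth} S/I=\dim S/I$. Vertex splittable ideals are defined recursively (over polynomial rings over $K$ in finitely many variables): (i) if $u$ is a monomial and $I=(u)$, or $I=0$, or $I=S$, then $I$ is vertex splittable; (ii) if there exist a variable $x_i$ and vertex splittable ideals $I_1\subset S$ and $I_2\subset K[x_1,\dots,x_{i-1},x_{i+1},\dots,x_n]$ such that $I=x_iI_1+I_2$ (where $I_2$ is identified with its extension $I_2S$), $I_2\subseteq I_1$, and $\mathcal{G}(I)$ is the union of $\mathcal{G}(x_iI_1)$ and $\mathcal{G}(I_2)$, then $I$ is vertex splittable. In case (ii), $I=x_iI_1+I_2$ is called a vertex splitting of $I$ and $x_i$ is called a splitting vertex of $I$.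
   Formalization: The ideal I is additionally assumed to be nonzero; for I = 0 = x_i·0 + 0 every x_i is a splitting vertex, (a) holds, but depth S/(0:x_i) = n differs from depth S/(x_i) = n−1, so (b) fails. *)

theory Defs
  imports
    "HOL-Algebra.QuotRing"
    "HOL-Algebra.Ideal_Product"
    "HOL-Algebra.Module"
    "HOL-Library.Poly_Mapping"
    "HOL-Library.Extended_Nat"
begin

section \<open>Depth, dimension and the Cohen--Macaulay property\<close>

text \<open>The submodule \<open>(f\<^sub>1, \<dots>, f\<^sub>r) M\<close> of \<open>M\<close>.\<close>

fun seq_submodule :: "('a, 'c) ring_scheme \<Rightarrow> ('a, 'b, 'd) module_scheme \<Rightarrow> 'a list \<Rightarrow> 'b set" where
  "seq_submodule R M [] = {\<zero>\<^bsub>M\<^esub>}"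
| "seq_submodule R M (f # fs) = {f \<odot>\<^bsub>M\<^esub> x \<oplus>\<^bsub>M\<^esub> y | x y. x \<in> carrier M \<and> y \<in> seq_submodule R M fs}"

text \<open>
  The second conjunct says that \<open>f\<^sub>k\<^sub>+\<^sub>1\<close> is a nonzerodivisor on \<open>M / (f\<^sub>1, \<dots>, f\<^sub>k) M\<close>,
  and the last one that \<open>M / (f\<^sub>1, \<dots>, f\<^sub>r) M\<close> is not zero.
\<close>

definition regular_seq :: "('a, 'c) ring_scheme \<Rightarrow> ('a, 'b, 'd) module_scheme \<Rightarrow> 'a list \<Rightarrow> bool" where
  "regular_seq R M fs \<longleftrightarrow>
     set fs \<subseteq> carrier R \<and>
     (\<forall>k < length fs. \<forall>x \<in> carrier M.
        (fs ! k) \<odot>\<^bsub>M\<^esub> x \<in> seq_submodule R M (take k fs) \<longrightarrow> x \<in> seq_submodule R M (take k fs)) \<and>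
     seq_submodule R M fs \<noteq> carrier M"

text \<open>
  Depth is taken with respect to an ideal \<open>J\<close>, which is the graded maximal ideal in the
  application. The supremum over the empty set, which occurs exactly for \<open>M = 0\<close>, is 0.
\<close>

definition module_depth :: "('a, 'c) ring_scheme \<Rightarrow> 'a set \<Rightarrow> ('a, 'b, 'd) module_scheme \<Rightarrow> enat" where
  "module_depth R J M = Sup {enat (length fs) | fs. set fs \<subseteq> J \<and> regular_seq R M fs}"

definition krull_dim :: "('a, 'c) ring_scheme \<Rightarrow> enat" where
  "krull_dim R = Sup {enat r | r. \<exists>P :: nat \<Rightarrow> 'a set.
     (\<forall>i \<le> r. primeideal (P i) R) \<and> (\<forall>i < r. P i \<subset> P (Suc i))}"

definition annihilator :: "('a, 'c) ring_scheme \<Rightarrow> ('a, 'b, 'd) module_scheme \<Rightarrow> 'a set" where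
  "annihilator R M = {f \<in> carrier R. \<forall>x \<in> carrier M. f \<odot>\<^bsub>M\<^esub> x = \<zero>\<^bsub>M\<^esub>}"

definition module_dim :: "('a, 'c) ring_scheme \<Rightarrow> ('a, 'b, 'd) module_scheme \<Rightarrow> enat" where
  "module_dim R M = krull_dim (R Quot annihilator R M)"

definition cohen_macaulay_module ::
    "('a, 'c) ring_scheme \<Rightarrow> 'a set \<Rightarrow> ('a, 'b, 'd) module_scheme \<Rightarrow> bool" where
  "cohen_macaulay_module R J M \<longleftrightarrow> module_depth R J M = module_dim R M"

text \<open>The quotient \<open>R/I\<close>, regarded as an \<open>R\<close>-module.\<close>

definition quot_module :: "('a, 'c) ring_scheme \<Rightarrow> 'a set \<Rightarrow> ('a, 'a set) module" where
  "quot_module R I =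
     \<lparr>carrier = carrier (R Quot I), mult = mult (R Quot I), one = one (R Quot I),
      zero = zero (R Quot I), add = add (R Quot I),
      smult = (\<lambda>f X. (I +>\<^bsub>R\<^esub> f) \<otimes>\<^bsub>R Quot I\<^esub> X)\<rparr>"

text \<open>The colon ideal \<open>(I : f)\<close>.\<close>

definition colon :: "('a, 'c) ring_scheme \<Rightarrow> 'a set \<Rightarrow> 'a \<Rightarrow> 'a set" where
  "colon R I f = {g \<in> carrier R. g \<otimes>\<^bsub>R\<^esub> f \<in> I}"


section \<open>Polynomial rings and monomial ideals\<close>

text \<open>
  All polynomials live in one type, with variables indexed by natural numbers: a polynomial
  maps exponent vectors to coefficients. The polynomial ring in the variables \<open>x\<^sub>j\<close>, \<open>j \<in> V\<close>,
  is the subring of those polynomials that involve no other variable, so that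
  \<open>K[x\<^sub>j : j \<in> V - {i}]\<close> is literally a subring of \<open>K[x\<^sub>j : j \<in> V]\<close>.
\<close>

type_synonym 'k mpoly = "(nat \<Rightarrow>\<^sub>0 nat) \<Rightarrow>\<^sub>0 'k"

definition poly_ring :: "nat set \<Rightarrow> 'k::field mpoly ring" where
  "poly_ring V =
     \<lparr>carrier = {p. \<forall>m \<in> Poly_Mapping.keys p. Poly_Mapping.keys m \<subseteq> V},
      mult = (*), one = 1, zero = 0, add = (+)\<rparr>"

definition monom_poly :: "(nat \<Rightarrow>\<^sub>0 nat) \<Rightarrow> 'k::field mpoly" where
  "monom_poly m = Poly_Mapping.single m 1"

definition var :: "nat \<Rightarrow> 'k::field mpoly" where
  "var i = monom_poly (Poly_Mapping.single i 1)"

definition monomials :: "nat set \<Rightarrow> 'k::field mpoly set" where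
  "monomials V = monom_poly ` {m. Poly_Mapping.keys m \<subseteq> V}"

definition graded_max_ideal :: "nat set \<Rightarrow> 'k::field mpoly set" where
  "graded_max_ideal V = Idl\<^bsub>poly_ring V\<^esub> (var ` V)"

definition monomial_ideal :: "nat set \<Rightarrow> 'k::field mpoly set \<Rightarrow> bool" where
  "monomial_ideal V I \<longleftrightarrow> (\<exists>A \<subseteq> monomials V. I = Idl\<^bsub>poly_ring V\<^esub> A)"

text \<open>The unique minimal set of monomial generators; meaningful only for monomial ideals.\<close>

definition min_gens :: "nat set \<Rightarrow> 'k::field mpoly set \<Rightarrow> 'k mpoly set" where
  "min_gens V I = (THE G. G \<subseteq> monomials V \<and> Idl\<^bsub>poly_ring V\<^esub> G = I \<and>
     (\<forall>H. H \<subset> G \<longrightarrow> Idl\<^bsub>poly_ring V\<^esub> H \<noteq> I))"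

abbreviation depth_quot :: "nat set \<Rightarrow> 'k::field mpoly set \<Rightarrow> enat" where
  "depth_quot V I \<equiv> module_depth (poly_ring V) (graded_max_ideal V) (quot_module (poly_ring V) I)"

definition cohen_macaulay_ideal :: "nat set \<Rightarrow> 'k::field mpoly set \<Rightarrow> bool" where
  "cohen_macaulay_ideal V I \<longleftrightarrow>
     cohen_macaulay_module (poly_ring V) (graded_max_ideal V) (quot_module (poly_ring V) I)"


section \<open>Vertex splittable ideals\<close>

text \<open>
  \<open>I = x\<^sub>i I\<^sub>1 + I\<^sub>2\<close>, where \<open>I\<^sub>2\<close> is an ideal of \<open>K[x\<^sub>j : j \<in> V - {i}]\<close> and
  \<open>Idl\<^bsub>poly_ring V\<^esub> I\<^sub>2\<close> is its extension to \<open>K[x\<^sub>j : j \<in> V]\<close>.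
\<close>

definition vertex_decomp ::
    "nat set \<Rightarrow> nat \<Rightarrow> 'k::field mpoly set \<Rightarrow> 'k mpoly set \<Rightarrow> 'k mpoly set \<Rightarrow> bool" where
  "vertex_decomp V i I I1 I2 \<longleftrightarrow>
     i \<in> V \<and>
     I = (*) (var i) ` I1 <+>\<^bsub>poly_ring V\<^esub> Idl\<^bsub>poly_ring V\<^esub> I2 \<and>
     Idl\<^bsub>poly_ring V\<^esub> I2 \<subseteq> I1 \<and>
     min_gens V I = min_gens V ((*) (var i) ` I1) \<union> min_gens (V - {i}) I2"

inductive vertex_splittable :: "nat set \<Rightarrow> 'k::field mpoly set \<Rightarrow> bool" where
  principal: "u \<in> monomials V \<Longrightarrow> vertex_splittable V (Idl\<^bsub>poly_ring V\<^esub> {u})"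
| zero: "vertex_splittable V {0}"
| whole: "vertex_splittable V (carrier (poly_ring V))"
| split: "\<lbrakk>vertex_splittable V I1; vertex_splittable (V - {i}) I2; vertex_decomp V i I I1 I2\<rbrakk>
    \<Longrightarrow> vertex_splittable V I"

definition splitting_vertex :: "nat set \<Rightarrow> 'k::field mpoly set \<Rightarrow> nat \<Rightarrow> bool" where
  "splitting_vertex V I i \<longleftrightarrow>
     (\<exists>I1 I2. vertex_splittable V I1 \<and> vertex_splittable (V - {i}) I2 \<and> vertex_decomp V i I I1 I2)"


section \<open>Basic facts\<close>

lemma poly_ring_cring: "cring (poly_ring V :: 'k::field mpoly ring)"
proof (rule cringI)
  have uminus: "\<exists>y \<in> carrier (poly_ring V). y + x = 0"
    if "x \<in> carrier (poly_ring V)" for x :: "'k mpoly"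
    using that by (intro bexI[of _ "- x"]) (auto simp: poly_ring_def keys_minus)
  have plus: "x + y \<in> carrier (poly_ring V)"
    if "x \<in> carrier (poly_ring V)" "y \<in> carrier (poly_ring V)" for x y :: "'k mpoly"
    using that Poly_Mapping.keys_add[of x y] by (auto simp: poly_ring_def)
  have times: "x * y \<in> carrier (poly_ring V)"
    if xy: "x \<in> carrier (poly_ring V)" "y \<in> carrier (poly_ring V)" for x y :: "'k mpoly"
  proof -
    have "Poly_Mapping.keys m \<subseteq> V" if m: "m \<in> Poly_Mapping.keys (x * y)" for m
    proof -
      obtain a b where "m = a + b" "a \<in> Poly_Mapping.keys x" "b \<in> Poly_Mapping.keys y"
        using m keys_mult[of x y] by blast
      moreover from this xy have "Poly_Mapping.keys a \<subseteq> V" "Poly_Mapping.keys b \<subseteq> V"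
        by (simp_all add: poly_ring_def)
      ultimately show ?thesis
        using Poly_Mapping.keys_add[of a b] by blast
    qed
    then show ?thesis by (auto simp: poly_ring_def)
  qed
  have simps: "x \<oplus>\<^bsub>poly_ring V\<^esub> y = x + y" "x \<otimes>\<^bsub>poly_ring V\<^esub> y = x * y"
    "\<zero>\<^bsub>poly_ring V\<^esub> = (0 :: 'k mpoly)" "\<one>\<^bsub>poly_ring V\<^esub> = (1 :: 'k mpoly)" for x y :: "'k mpoly"
    by (simp_all add: poly_ring_def)
  have "(0 :: 'k mpoly) \<in> carrier (poly_ring V)" "(1 :: 'k mpoly) \<in> carrier (poly_ring V)"
    by (simp_all add: poly_ring_def)
  note closed = this plus times
  show "abelian_group (poly_ring V :: 'k mpoly ring)"
    by (rule abelian_groupI) (simp_all only: simps closed uminus add.assoc add_0, rule add.commute)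
  show "Group.comm_monoid (poly_ring V :: 'k mpoly ring)"
    by (rule Group.comm_monoidI) (simp_all only: simps closed mult.assoc mult_1, rule mult.commute)
qed (simp add: poly_ring_def distrib_right)

lemma quot_module_is_module:
  assumes "cring R" and "ideal I R"
  shows "Module.module R (quot_module R I)"
proof -
  interpret cring R by fact
  interpret I: ideal I R by fact
  interpret Q: cring "R Quot I" using I.quotient_is_cring[OF \<open>cring R\<close>] .
  have hom: "(+>\<^bsub>R\<^esub>) I \<in> ring_hom R (R Quot I)" by (rule I.rcos_ring_hom)
  show ?thesis
  proof (rule Module.moduleI)
    show "abelian_group (quot_module R I)"
    proof (rule abelian_groupI)
      show "\<exists>y \<in> carrier (quot_module R I). y \<oplus>\<^bsub>quot_module R I\<^esub> x = \<zero>\<^bsub>quot_module R I\<^esub>"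
        if "x \<in> carrier (quot_module R I)" for x
        using that Q.l_neg[of x] Q.a_inv_closed[of x] by (auto simp: quot_module_def)
      show "x \<oplus>\<^bsub>quot_module R I\<^esub> y = y \<oplus>\<^bsub>quot_module R I\<^esub> x"
        if "x \<in> carrier (quot_module R I)" "y \<in> carrier (quot_module R I)" for x y
        using Q.a_comm[of x y] that by (simp add: quot_module_def)
      show "(x \<oplus>\<^bsub>quot_module R I\<^esub> y) \<oplus>\<^bsub>quot_module R I\<^esub> z =
          x \<oplus>\<^bsub>quot_module R I\<^esub> (y \<oplus>\<^bsub>quot_module R I\<^esub> z)"
        if "x \<in> carrier (quot_module R I)" "y \<in> carrier (quot_module R I)"
          "z \<in> carrier (quot_module R I)" for x y z
        using Q.a_assoc[of x y z] that by (simp add: quot_module_def)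
    qed (simp_all add: quot_module_def)
  next
    fix a x y
    assume "a \<in> carrier R" "x \<in> carrier (quot_module R I)" "y \<in> carrier (quot_module R I)"
    then show "a \<odot>\<^bsub>quot_module R I\<^esub> (x \<oplus>\<^bsub>quot_module R I\<^esub> y) =
      a \<odot>\<^bsub>quot_module R I\<^esub> x \<oplus>\<^bsub>quot_module R I\<^esub> a \<odot>\<^bsub>quot_module R I\<^esub> y"
      using ring_hom_closed[OF hom] by (simp add: quot_module_def Q.r_distr)
  next
    fix a b x
    assume *: "a \<in> carrier R" "b \<in> carrier R" "x \<in> carrier (quot_module R I)"
    then show "(a \<oplus>\<^bsub>R\<^esub> b) \<odot>\<^bsub>quot_module R I\<^esub> x =
      a \<odot>\<^bsub>quot_module R I\<^esub> x \<oplus>\<^bsub>quot_module R I\<^esub> b \<odot>\<^bsub>quot_module R I\<^esub> x"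
      using ring_hom_closed[OF hom] by (simp add: quot_module_def ring_hom_add[OF hom] Q.l_distr)
    from * show "(a \<otimes>\<^bsub>R\<^esub> b) \<odot>\<^bsub>quot_module R I\<^esub> x =
      a \<odot>\<^bsub>quot_module R I\<^esub> (b \<odot>\<^bsub>quot_module R I\<^esub> x)"
      using ring_hom_closed[OF hom] by (simp add: quot_module_def ring_hom_mult[OF hom] Q.m_assoc)
  next
    fix a x
    assume "x \<in> carrier (quot_module R I)"
    then show "\<one>\<^bsub>R\<^esub> \<odot>\<^bsub>quot_module R I\<^esub> x = x"
      by (simp add: quot_module_def ring_hom_one[OF hom])
    assume "a \<in> carrier R"
    with \<open>x \<in> _\<close> show "a \<odot>\<^bsub>quot_module R I\<^esub> x \<in> carrier (quot_module R I)"
      using ring_hom_closed[OF hom] by (simp add: quot_module_def)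
  qed (fact \<open>cring R\<close>)
qed

end

theory Submission
  imports Defs "HOL-Library.Function_Algebras"
begin

text \<open>
  Let \<open>x = x\<^sub>i\<close>, \<open>W = V - {i}\<close>, and let \<open>I = x I\<^sub>1 + I\<^sub>2\<close> be the vertex splitting. Then
  \<open>(I : x) = I\<^sub>1\<close>, and \<open>K[V]/(I, x)\<close> is \<open>K[W]/I\<^sub>2\<close>. The theorem is a formal consequence of

  \<^item> \<open>dim K[V]/I = max (dim K[V]/(I : x)) (dim K[V]/(I, x))\<close>,
  \<^item> \<open>depth K[V]/I = min (depth K[V]/(I : x)) (depth K[V]/(I, x))\<close>,
  \<^item> \<open>depth \<le> dim\<close> for the two modules on the right,

  since a minimum of depths can reach a maximum of dimensions only if all four numbers agree.

  The first formula holds because a prime ideal over \<open>I\<close> contains \<open>(I, x)\<close> or \<open>(I : x)\<close>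
  (\<open>dim_quot_split\<close>). For the second one, depth is tested in two ways at once. A regular sequence
  of length \<open>r\<close> forces the Koszul homology of \<open>K[V]/J\<close> to vanish in degrees above \<open>|V| - r\<close>
  (\<open>acyclic_at_of_weakly_regular\<close>); for a vertex splittable ideal \<open>J\<close> this vanishing implies in
  turn that the elementary symmetric polynomials \<open>e\<^sub>1, \<dots>, e\<^sub>r\<close> are regular
  (\<open>tame_of_vertex_splittable\<close>, \<open>depth_quot_ge_iff\<close>).

  The elementary symmetric polynomials make it easy to go up along
  \<open>0 \<rightarrow> K[V]/(I : x) \<rightarrow> K[V]/I \<rightarrow> K[V]/(I, x) \<rightarrow> 0\<close>: the same sequence is available on both
  sides, because \<open>x \<mapsto> 0\<close> turns the polynomials for \<open>V\<close> into those for \<open>W\<close>, and a sequence that is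
  regular on both ends is regular in the middle (\<open>weakly_regular_middle\<close>).

  Koszul homology makes it possible to go down: its long exact sequence falls apart into short
  ones, because the homology of \<open>K[W]/I\<^sub>2\<close> maps to that of \<open>K[V]/I\<^sub>1\<close> by zero in positive degrees
  (\<open>comparison_zero\<close>). In degree \<open>1\<close> the reason is \<open>I\<^sub>2 \<subseteq> \<mm> I\<^sub>1\<close>, which is what the condition on the
  minimal generators amounts to (\<open>vertex_decomp_subset_times_max\<close>). Higher degrees reduce to it,
  since for vertex splittable ideals a nonzero class in degree at least \<open>2\<close> has a nonzero
  contraction in the degree below (\<open>contractions_detect_I\<close>).

  Finally, depth is at most dimension because \<open>e\<^sub>r\<close> is nilpotent modulo a monomial ideal of
  dimension less than \<open>r\<close> (\<open>prime_chain_of_weakly_regular_esyms\<close>).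
\<close>

section \<open>The polynomial rings inside the ring of all polynomials\<close>

abbreviation polys :: "nat set \<Rightarrow> 'k::field mpoly set" where
  "polys V \<equiv> carrier (poly_ring V)"

abbreviation exps :: "'k::field mpoly \<Rightarrow> (nat \<Rightarrow>\<^sub>0 nat) set" where
  "exps p \<equiv> Poly_Mapping.keys p"

abbreviation vars :: "(nat \<Rightarrow>\<^sub>0 nat) \<Rightarrow> nat set" where
  "vars m \<equiv> Poly_Mapping.keys m"

abbreviation coef :: "'k::field mpoly \<Rightarrow> (nat \<Rightarrow>\<^sub>0 nat) \<Rightarrow> 'k" where
  "coef p m \<equiv> Poly_Mapping.lookup p m"

lemma poly_ring_simps [simp]:
  "x \<oplus>\<^bsub>poly_ring V\<^esub> y = x + y" "x \<otimes>\<^bsub>poly_ring V\<^esub> y = x * y"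
  "\<zero>\<^bsub>poly_ring V\<^esub> = 0" "\<one>\<^bsub>poly_ring V\<^esub> = 1"
  by (simp_all add: poly_ring_def)

lemma mem_polys: "p \<in> polys V \<longleftrightarrow> (\<forall>m \<in> exps p. vars m \<subseteq> V)"
  by (simp add: poly_ring_def)

lemma vars_add: "vars (a + b) = vars a \<union> vars b"
  by (auto simp: in_keys_iff lookup_add)

lemma vars_minus: "vars (a - b) \<subseteq> vars a"
  by (auto simp: in_keys_iff lookup_minus)

lemma polys_closed [simp, intro]:
  fixes p q :: "'k::field mpoly"
  shows "(0 :: 'k mpoly) \<in> polys V" "(1 :: 'k mpoly) \<in> polys V"
  "p \<in> polys V \<Longrightarrow> q \<in> polys V \<Longrightarrow> p + q \<in> polys V"
  "p \<in> polys V \<Longrightarrow> q \<in> polys V \<Longrightarrow> p * q \<in> polys V"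
  "p \<in> polys V \<Longrightarrow> - p \<in> polys V"
  "p \<in> polys V \<Longrightarrow> q \<in> polys V \<Longrightarrow> p - q \<in> polys V"
proof -
  interpret cring "poly_ring V :: 'k mpoly ring" by (rule poly_ring_cring)
  have uminus: "- p \<in> polys V" if "p \<in> polys V" for p :: "'k mpoly"
    using that by (simp add: mem_polys)
  show "(0 :: 'k mpoly) \<in> polys V" "(1 :: 'k mpoly) \<in> polys V"
    "p \<in> polys V \<Longrightarrow> q \<in> polys V \<Longrightarrow> p + q \<in> polys V"
    "p \<in> polys V \<Longrightarrow> q \<in> polys V \<Longrightarrow> p * q \<in> polys V"
    "p \<in> polys V \<Longrightarrow> - p \<in> polys V"
    using zero_closed one_closed a_closed m_closed uminus by simp_all
  then show "p \<in> polys V \<Longrightarrow> q \<in> polys V \<Longrightarrow> p - q \<in> polys V"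
    using a_closed[of p "- q"] uminus[of q] by simp
qed

lemma polys_sum [intro]: "(\<And>x. x \<in> A \<Longrightarrow> f x \<in> polys V) \<Longrightarrow> sum f A \<in> polys V"
  by (induction A rule: infinite_finite_induct) auto

lemma polys_prod [intro]: "(\<And>x. x \<in> A \<Longrightarrow> f x \<in> polys V) \<Longrightarrow> prod f A \<in> polys V"
  by (induction A rule: infinite_finite_induct) auto

lemma polys_power [simp, intro]: "p \<in> polys V \<Longrightarrow> p ^ k \<in> polys V"
  by (induction k) auto

lemma polys_mono: "V \<subseteq> W \<Longrightarrow> polys V \<subseteq> polys W"
  unfolding subset_iff[of "polys V"] mem_polys by blast

lemma exps_monom_poly [simp]: "exps (monom_poly m) = {m}"
  by (simp add: monom_poly_def)

lemma monom_poly_in_polys [simp]: "monom_poly m \<in> polys V \<longleftrightarrow> vars m \<subseteq> V"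
  by (simp add: mem_polys)

lemma var_in_polys [simp]: "var i \<in> polys V \<longleftrightarrow> i \<in> V"
  by (simp add: var_def)

lemma monom_poly_add: "monom_poly (a + b) = monom_poly a * monom_poly b"
  by (simp add: monom_poly_def mult_single)

lemma monom_poly_zero [simp]: "monom_poly 0 = 1"
  by (simp add: monom_poly_def)

lemma monom_poly_inject [simp]: "monom_poly a = monom_poly b \<longleftrightarrow> a = b"
  by (metis exps_monom_poly singleton_inject)

lemma monom_poly_nonzero [simp]: "monom_poly m \<noteq> 0"
  by (metis exps_monom_poly insert_not_empty keys_zero)

lemma var_nonzero [simp]: "var i \<noteq> 0"
  by (simp add: var_def)

lemma poly_as_sum: "p = (\<Sum>m \<in> exps p. Poly_Mapping.single 0 (coef p m) * monom_poly m)"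
proof (rule poly_mapping_eqI)
  fix a
  have "(\<Sum>m \<in> exps p. coef (Poly_Mapping.single m (coef p m)) a) =
      (\<Sum>m \<in> exps p. if m = a then coef p m else 0)"
    by (intro sum.cong refl) (simp add: lookup_single when_def)
  also have "\<dots> = coef p a"
    by (simp add: in_keys_iff)
  finally show "coef p a = coef (\<Sum>m \<in> exps p. Poly_Mapping.single 0 (coef p m) * monom_poly m) a"
    by (simp add: lookup_sum monom_poly_def mult_single)
qed

lemma constant_in_polys [simp]: "Poly_Mapping.single 0 c \<in> polys V"
  by (simp add: mem_polys)

lemma coef_monom_poly_mult:
  "coef (monom_poly t * g) m = (if \<exists>u. m = t + u then coef g (m - t) else 0)"
proof -
  have "coef (monom_poly t * g) m =
      (\<Sum>l. (\<Sum>q. coef g q when m = t + q) when l = t)"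
    unfolding lookup_mult monom_poly_def
    by (rule Sum_any.cong) (auto simp: lookup_single when_def)
  also have "\<dots> = (\<Sum>q. coef g q when m = t + q)"
    by simp
  also have "\<dots> = (\<Sum>q. (if \<exists>u. m = t + u then coef g q else 0) when q = m - t)"
    by (rule Sum_any.cong) (auto simp: when_def)
  finally show ?thesis by simp
qed

text \<open>
  Ideals of \<open>K[V]\<close>, with closure conditions in the type class operations, so that arithmetic
  with polynomials does not have to pass through the record \<^term>\<open>poly_ring V\<close>.
\<close>

definition pideal :: "nat set \<Rightarrow> 'k::field mpoly set \<Rightarrow> bool" where
  "pideal V J \<longleftrightarrow> J \<subseteq> polys V \<and> 0 \<in> J \<and> (\<forall>x \<in> J. \<forall>y \<in> J. x + y \<in> J) \<and>
     (\<forall>x \<in> polys V. \<forall>y \<in> J. x * y \<in> J)"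

lemma pidealD:
  assumes "pideal V J"
  shows "J \<subseteq> polys V" "0 \<in> J" "x \<in> J \<Longrightarrow> y \<in> J \<Longrightarrow> x + y \<in> J"
    "x \<in> polys V \<Longrightarrow> y \<in> J \<Longrightarrow> x * y \<in> J" "x \<in> polys V \<Longrightarrow> y \<in> J \<Longrightarrow> y * x \<in> J"
    "x \<in> J \<Longrightarrow> - x \<in> J" "x \<in> J \<Longrightarrow> y \<in> J \<Longrightarrow> x - y \<in> J" "x \<in> J \<Longrightarrow> x \<in> polys V"
proof -
  have *: "x \<in> polys V \<Longrightarrow> y \<in> J \<Longrightarrow> x * y \<in> J" for x y
    using assms by (auto simp: pideal_def)
  have neg: "- x \<in> J" if "x \<in> J" for x
    using *[of "- 1" x] that by auto
  show "J \<subseteq> polys V" "0 \<in> J" "x \<in> J \<Longrightarrow> y \<in> J \<Longrightarrow> x + y \<in> J" "x \<in> J \<Longrightarrow> x \<in> polys V"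
    using assms by (auto simp: pideal_def)
  show "x \<in> polys V \<Longrightarrow> y \<in> J \<Longrightarrow> x * y \<in> J" "x \<in> polys V \<Longrightarrow> y \<in> J \<Longrightarrow> y * x \<in> J"
    using * by (auto simp: mult.commute)
  show "x \<in> J \<Longrightarrow> - x \<in> J" by (rule neg)
  show "x \<in> J \<Longrightarrow> y \<in> J \<Longrightarrow> x - y \<in> J"
    using assms neg[of y] by (metis pideal_def diff_conv_add_uminus)
qed

lemma pideal_sum: "pideal V J \<Longrightarrow> (\<And>x. x \<in> A \<Longrightarrow> f x \<in> J) \<Longrightarrow> sum f A \<in> J"
  by (induction A rule: infinite_finite_induct) (auto simp: pideal_def)

lemma pideal_iff_ideal: "pideal V J \<longleftrightarrow> ideal J (poly_ring V)"
proof
  interpret R: cring "poly_ring V :: 'a mpoly ring" by (rule poly_ring_cring)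
  assume J: "pideal V J"
  note * = pidealD[OF J]
  have inv: "\<ominus>\<^bsub>poly_ring V\<^esub> x = - x" if "x \<in> polys V" for x :: "'a mpoly"
    using R.minus_equality[of "- x" x] that by simp
  show "ideal J (poly_ring V)"
  proof (rule idealI)
    show "ring (poly_ring V :: 'a mpoly ring)" by (rule R.ring_axioms)
    show "subgroup J (add_monoid (poly_ring V))"
    proof (rule R.add.subgroupI)
      show "J \<subseteq> polys V" "J \<noteq> {}" using * by auto
      show "\<ominus>\<^bsub>poly_ring V\<^esub> a \<in> J" if "a \<in> J" for a
        using * that inv[of a] by auto
      show "a \<oplus>\<^bsub>poly_ring V\<^esub> b \<in> J" if "a \<in> J" "b \<in> J" for a b
        using * that by auto
    qed
  qed (use * in auto)
next
  assume "ideal J (poly_ring V)"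
  then interpret ideal J "poly_ring V" .
  show "pideal V J"
    unfolding pideal_def
    using a_subset additive_subgroup.zero_closed[OF additive_subgroup_axioms]
      additive_subgroup.a_closed[OF additive_subgroup_axioms] I_l_closed by simp
qed

lemma pideal_polys: "pideal V (polys V)"
  by (auto simp: pideal_def)

lemma pideal_zero: "pideal V {0}"
  by (auto simp: pideal_def)

lemma pideal_Idl: "A \<subseteq> polys V \<Longrightarrow> pideal V (Idl\<^bsub>poly_ring V\<^esub> A)"
proof -
  interpret R: cring "poly_ring V :: 'a mpoly ring" by (rule poly_ring_cring)
  show "A \<subseteq> polys V \<Longrightarrow> pideal V (Idl\<^bsub>poly_ring V\<^esub> A)"
    unfolding pideal_iff_ideal by (rule R.genideal_ideal)
qed

lemma Idl_subset: "pideal V J \<Longrightarrow> A \<subseteq> J \<Longrightarrow> Idl\<^bsub>poly_ring V\<^esub> A \<subseteq> J"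
proof -
  interpret R: cring "poly_ring V :: 'a mpoly ring" by (rule poly_ring_cring)
  show "pideal V J \<Longrightarrow> A \<subseteq> J \<Longrightarrow> Idl\<^bsub>poly_ring V\<^esub> A \<subseteq> J"
    unfolding pideal_iff_ideal by (rule R.genideal_minimal)
qed

lemma subset_Idl: "A \<subseteq> polys V \<Longrightarrow> A \<subseteq> Idl\<^bsub>poly_ring V\<^esub> A"
proof -
  interpret R: cring "poly_ring V :: 'a mpoly ring" by (rule poly_ring_cring)
  show "A \<subseteq> polys V \<Longrightarrow> A \<subseteq> Idl\<^bsub>poly_ring V\<^esub> A"
    by (rule R.genideal_self)
qed

lemma pideal_eq_polys: "pideal V J \<Longrightarrow> J = polys V \<longleftrightarrow> 1 \<in> J"
  using pidealD(4)[of V J _ 1] pidealD(1)[of V J] by auto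

lemma mem_graded_max_ideal: "p \<in> graded_max_ideal V \<longleftrightarrow> p \<in> polys V \<and> 0 \<notin> exps p"
proof
  have "pideal V {p :: 'a mpoly. p \<in> polys V \<and> 0 \<notin> exps p}"
  proof -
    have "0 \<notin> exps (x * y)" if "0 \<notin> exps y" for x y :: "'a mpoly"
    proof
      assume "0 \<in> exps (x * y)"
      then obtain a b where "0 = a + b" "b \<in> exps y" using keys_mult[of x y] by blast
      then have "b = 0" by (metis sup_eq_bot_iff vars_add keys_eq_empty keys_zero)
      with that \<open>b \<in> exps y\<close> show False by simp
    qed
    moreover have "0 \<notin> exps (x + y)" if "0 \<notin> exps x" "0 \<notin> exps y" for x y :: "'a mpoly"
      using Poly_Mapping.keys_add[of x y] that by blast
    ultimately show ?thesis by (auto simp: pideal_def)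
  qed
  then have "graded_max_ideal V \<subseteq> {p :: 'a mpoly. p \<in> polys V \<and> 0 \<notin> exps p}"
    unfolding graded_max_ideal_def
    by (rule Idl_subset) (auto simp: var_def dest!: arg_cong[of _ 0 vars])
  then show "p \<in> graded_max_ideal V \<Longrightarrow> p \<in> polys V \<and> 0 \<notin> exps p" by auto
next
  assume p: "p \<in> polys V \<and> 0 \<notin> exps p"
  have I: "pideal V (graded_max_ideal V :: 'a mpoly set)"
    unfolding graded_max_ideal_def by (rule pideal_Idl) auto
  have sub: "var ` V \<subseteq> (graded_max_ideal V :: 'a mpoly set)"
    unfolding graded_max_ideal_def by (rule subset_Idl) auto
  have "Poly_Mapping.single 0 (coef p m) * monom_poly m \<in> graded_max_ideal V" if m: "m \<in> exps p" for m
  proof -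
    have "m \<noteq> 0" using p m by auto
    then obtain j where j: "j \<in> vars m" by (metis keys_eq_empty ex_in_conv)
    then have "m = (m - Poly_Mapping.single j 1) + Poly_Mapping.single j 1"
      by (intro poly_mapping_eqI) (auto simp: lookup_add lookup_minus lookup_single when_def in_keys_iff)
    then have eq: "(monom_poly m :: 'a mpoly) = monom_poly (m - Poly_Mapping.single j 1) * var j"
      by (metis monom_poly_add var_def)
    have "j \<in> V" using p m j by (auto simp: mem_polys)
    then have "var j \<in> (graded_max_ideal V :: 'a mpoly set)" using sub by auto
    moreover have "vars (m - Poly_Mapping.single j 1) \<subseteq> V"
      using p m vars_minus by (fastforce simp: mem_polys)
    ultimately show ?thesis
      unfolding eq by (intro pidealD(4)[OF I] constant_in_polys) (simp_all add: monom_poly_in_polys)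
  qed
  then show "p \<in> graded_max_ideal V"
    by (subst poly_as_sum) (rule pideal_sum[OF I])
qed

subsection \<open>Splitting off a set of exponents\<close>

definition restr :: "(nat \<Rightarrow>\<^sub>0 nat) set \<Rightarrow> 'k::field mpoly \<Rightarrow> 'k mpoly" where
  "restr A p = Abs_poly_mapping (\<lambda>m. if m \<in> A then coef p m else 0)"

lemma coef_restr: "coef (restr A p) m = (if m \<in> A then coef p m else 0)"
proof -
  have "finite {m. (if m \<in> A then coef p m else 0) \<noteq> 0}"
    by (rule finite_subset[OF _ finite_lookup[of p]]) auto
  then show ?thesis by (simp add: restr_def)
qed

lemma exps_restr [simp]: "exps (restr A p) = exps p \<inter> A"
  by (auto simp: in_keys_iff coef_restr split: if_splits)

lemma restr_add: "restr A (p + q) = restr A p + restr A q"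
  by (rule poly_mapping_eqI) (simp add: coef_restr lookup_add)

lemma restr_minus: "restr A (p - q) = restr A p - restr A q"
  by (rule poly_mapping_eqI) (simp add: coef_restr lookup_minus)

lemma restr_zero [simp]: "restr A 0 = 0"
  by (rule poly_mapping_eqI) (simp add: coef_restr)

lemma restr_id: "exps p \<subseteq> A \<Longrightarrow> restr A p = p"
  by (rule poly_mapping_eqI) (auto simp: coef_restr in_keys_iff)

lemma restr_eq_0: "exps p \<inter> A = {} \<Longrightarrow> restr A p = 0"
  by (metis exps_restr keys_eq_empty)

lemma restr_split: "restr A p + restr (- A) p = p"
  by (rule poly_mapping_eqI) (simp add: coef_restr lookup_add)

lemma restr_polys [intro]: "p \<in> polys V \<Longrightarrow> restr A p \<in> polys V"
  by (simp add: mem_polys)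

text \<open>
  If multiplication by \<open>p\<close> cannot move an exponent across the boundary of \<open>A\<close>,
  then cutting off outside \<open>A\<close> commutes with it.
\<close>

lemma restr_mult_shift:
  assumes "\<And>a b. a \<in> exps p \<Longrightarrow> a + b \<in> A \<longleftrightarrow> b \<in> B"
  shows "restr A (p * q) = p * restr B q"
proof -
  have "exps (p * restr B q) \<subseteq> A" "exps (p * restr (- B) q) \<inter> A = {}"
    using keys_mult[of p "restr B q"] keys_mult[of p "restr (- B) q"] assms by auto
  then have "restr A (p * restr B q + p * restr (- B) q) = p * restr B q"
    by (simp add: restr_add restr_id restr_eq_0)
  then show ?thesis by (metis distrib_left restr_split)
qed

lemma restr_mult_face:
  assumes "\<And>a b. a + b \<in> A \<longleftrightarrow> a \<in> A \<and> b \<in> A"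
  shows "restr A (p * q) = restr A p * restr A q"
proof -
  have "restr A (restr A p * q) = restr A p * restr A q"
    by (rule restr_mult_shift) (use assms in auto)
  moreover have "restr A (restr (- A) p * q) = 0"
    by (rule restr_eq_0) (use keys_mult[of "restr (- A) p" q] assms in auto)
  ultimately show ?thesis
    by (metis restr_split distrib_right restr_add add.right_neutral)
qed

subsection \<open>Setting a variable to zero\<close>

text \<open>
  The two parts of the unique decomposition \<open>p = p\<^sub>0 + x\<^sub>i p\<^sub>1\<close> in which \<open>p\<^sub>0\<close> does not involve \<open>x\<^sub>i\<close>.
\<close>

definition at0 :: "nat \<Rightarrow> 'k::field mpoly \<Rightarrow> 'k mpoly" where
  "at0 i p = restr {m. i \<notin> vars m} p"

definition quo :: "nat \<Rightarrow> 'k::field mpoly \<Rightarrow> 'k mpoly" where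
  "quo i p = Poly_Mapping.map_key ((+) (Poly_Mapping.single i 1)) p"

lemma coef_quo: "coef (quo i p) m = coef p (Poly_Mapping.single i 1 + m)"
  unfolding quo_def by (subst Poly_Mapping.map_key.rep_eq) auto

lemma coef_at0: "coef (at0 i p) m = (if i \<in> vars m then 0 else coef p m)"
  by (simp add: at0_def coef_restr)

lemma exp_divisible: "i \<in> vars m \<longleftrightarrow> (\<exists>u. m = Poly_Mapping.single i 1 + u)"
proof
  assume "i \<in> vars m"
  then have "m = Poly_Mapping.single i 1 + (m - Poly_Mapping.single i 1)"
    by (intro poly_mapping_eqI) (auto simp: lookup_add lookup_minus lookup_single when_def in_keys_iff)
  then show "\<exists>u. m = Poly_Mapping.single i 1 + u" ..
qed (auto simp: vars_add)

lemma coef_var_mult: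
  "coef (var i * g) m = (if i \<in> vars m then coef g (m - Poly_Mapping.single i 1) else 0)"
  by (simp only: var_def coef_monom_poly_mult exp_divisible)

lemma at0_plus_quo: "at0 i p + var i * quo i p = p"
  by (rule poly_mapping_eqI)
    (auto simp: lookup_add coef_at0 coef_var_mult coef_quo exp_divisible)

lemma at0_add [simp]: "at0 i (p + q) = at0 i p + at0 i q"
  by (simp add: at0_def restr_add)

lemma at0_minus [simp]: "at0 i (p - q) = at0 i p - at0 i q"
  by (simp add: at0_def restr_minus)

lemma at0_zero [simp]: "at0 i 0 = 0"
  by (simp add: at0_def)

lemma at0_uminus [simp]: "at0 i (- p) = - at0 i p"
  using at0_minus[of i 0 p] by simp

lemma at0_sum: "at0 i (sum f A) = (\<Sum>a\<in>A. at0 i (f a))"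
  by (induction A rule: infinite_finite_induct) auto

lemma at0_mult [simp]: "at0 i (p * q) = at0 i p * at0 i q"
  unfolding at0_def by (rule restr_mult_face) (simp add: vars_add)

lemma at0_free [simp]: "p \<in> polys V \<Longrightarrow> i \<notin> V \<Longrightarrow> at0 i p = p"
  unfolding at0_def by (rule restr_id) (auto simp: mem_polys)

lemma at0_one [simp]: "at0 i 1 = 1"
  by (rule at0_free[of _ "{}"]) auto

lemma at0_var [simp]: "at0 i (var j) = (if i = j then 0 else var j)"
proof (cases "i = j")
  case True
  then show ?thesis by (auto simp: at0_def var_def intro: restr_eq_0)
next
  case False
  then show ?thesis by (simp add: at0_free[of _ "{j}"])
qed

lemma at0_polys [intro, simp]: "p \<in> polys V \<Longrightarrow> at0 i p \<in> polys V"
  unfolding at0_def by (rule restr_polys)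

lemma at0_polys_free [intro, simp]: "p \<in> polys V \<Longrightarrow> at0 i p \<in> polys (V - {i})"
  by (auto simp: at0_def mem_polys)

lemma quo_add [simp]: "quo i (p + q) = quo i p + quo i q"
  by (rule poly_mapping_eqI) (simp add: lookup_add coef_quo)

lemma quo_minus [simp]: "quo i (p - q) = quo i p - quo i q"
  by (rule poly_mapping_eqI) (simp add: lookup_minus coef_quo)

lemma quo_zero [simp]: "quo i 0 = 0"
  by (rule poly_mapping_eqI) (simp add: coef_quo)

lemma quo_polys [intro, simp]: "p \<in> polys V \<Longrightarrow> quo i p \<in> polys V"
  by (auto simp: mem_polys in_keys_iff[of _ "quo i p"] coef_quo)
     (metis UnCI in_keys_iff subset_iff vars_add)

lemma var_mult_cancel: "var i * p = var i * q \<longleftrightarrow> p = (q :: 'k::field mpoly)"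
  by simp

lemma quo_eqI: "p = a + var i * b \<Longrightarrow> at0 i a = a \<Longrightarrow> quo i p = b"
proof -
  assume p: "p = a + var i * b" and a: "at0 i a = a"
  then have "at0 i p = a" by simp
  with p at0_plus_quo[of i p] show "quo i p = b" by (metis add_left_cancel var_mult_cancel)
qed

lemma quo_free: "at0 i p = p \<Longrightarrow> quo i p = 0"
  by (rule quo_eqI[of _ p]) auto

lemma quo_var_mult [simp]: "quo i (var i * p) = p"
  by (rule quo_eqI[of _ 0]) auto

lemma at0_at0 [simp]: "at0 i (at0 i p) = at0 i p"
  by (simp add: at0_def restr_id)

lemma quo_mult: "quo i (p * q) = at0 i p * quo i q + quo i p * at0 i q + var i * quo i p * quo i q"
proof (rule quo_eqI)
  have "p * q = (at0 i p + var i * quo i p) * (at0 i q + var i * quo i q)"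
    by (simp add: at0_plus_quo)
  also have "\<dots> = at0 i p * at0 i q +
      var i * (at0 i p * quo i q + quo i p * at0 i q + var i * quo i p * quo i q)"
    by (simp add: algebra_simps)
  finally show "p * q = \<dots>" .
qed simp

section \<open>The Koszul complex of the variables\<close>

text \<open>The sign in \<open>e\<^sub>j \<and> e\<^sub>G = sign j G * e\<^bsub>insert j G\<^esub>\<close> for \<open>j \<notin> G\<close>.\<close>

definition sign :: "nat \<Rightarrow> nat set \<Rightarrow> 'k::field mpoly" where
  "sign j G = (- 1) ^ card {g \<in> G. g < j}"

text \<open>
  A chain assigns to each set \<open>F\<close> of \<open>q\<close> variables the coefficient of the basis element
  \<open>e\<^sub>F\<close> of the \<open>q\<close>-th exterior power. The differential is \<open>\<Sum> x\<^sub>j \<iota>\<^sub>j\<close>, where \<open>\<iota>\<^sub>j\<close> is the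
  contraction by the \<open>j\<close>-th basis vector of the dual. The contractions themselves act on Koszul
  homology, which is what makes an induction over the homological degree possible below.
\<close>

definition koszul_chains :: "nat set \<Rightarrow> nat \<Rightarrow> (nat set \<Rightarrow> 'k::field mpoly) set" where
  "koszul_chains V q = {c. \<forall>F. if F \<subseteq> V \<and> card F = q then c F \<in> polys V else c F = 0}"

definition contract :: "nat \<Rightarrow> (nat set \<Rightarrow> 'k::field mpoly) \<Rightarrow> nat set \<Rightarrow> 'k mpoly" where
  "contract j c = (\<lambda>G. if j \<in> G then 0 else sign j G * c (insert j G))"

definition wedge :: "nat \<Rightarrow> (nat set \<Rightarrow> 'k::field mpoly) \<Rightarrow> nat set \<Rightarrow> 'k mpoly" where
  "wedge j c = (\<lambda>F. if j \<in> F then sign j F * c (F - {j}) else 0)"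

definition smul :: "'k::field mpoly \<Rightarrow> (nat set \<Rightarrow> 'k mpoly) \<Rightarrow> nat set \<Rightarrow> 'k mpoly" where
  "smul p c = (\<lambda>F. p * c F)"

definition koszul :: "nat set \<Rightarrow> (nat set \<Rightarrow> 'k::field mpoly) \<Rightarrow> nat set \<Rightarrow> 'k mpoly" where
  "koszul V c = (\<Sum>j\<in>V. smul (var j) (contract j c))"

definition coefs_in :: "'k::field mpoly set \<Rightarrow> (nat set \<Rightarrow> 'k mpoly) set" where
  "coefs_in J = {c. \<forall>F. c F \<in> J}"

text \<open>
  The Koszul homology of \<open>K[V]/J\<close> is treated through representatives: \<open>z\<close> is a cycle if
  \<^term>\<open>koszul V z\<close> has coefficients in \<open>J\<close>, and it is a boundary in the following sense.
\<close>

definition boundary :: "nat set \<Rightarrow> 'k::field mpoly set \<Rightarrow> nat \<Rightarrow> (nat set \<Rightarrow> 'k mpoly) \<Rightarrow> bool" where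
  "boundary V J q z \<longleftrightarrow> (\<exists>w \<in> koszul_chains V (Suc q). z - koszul V w \<in> coefs_in J)"

definition acyclic_at :: "nat set \<Rightarrow> 'k::field mpoly set \<Rightarrow> nat \<Rightarrow> bool" where
  "acyclic_at V J q \<longleftrightarrow> (\<forall>z \<in> koszul_chains V q. koszul V z \<in> coefs_in J \<longrightarrow> boundary V J q z)"

lemma sum_fun_apply: "(\<Sum>j\<in>A. f j) x = (\<Sum>j\<in>A. f j x)"
  by (induction A rule: infinite_finite_induct) auto

lemma koszul_apply: "koszul V c G = (\<Sum>j\<in>V. var j * contract j c G)"
  by (simp add: koszul_def sum_fun_apply smul_def)

subsection \<open>Signs\<close>

lemma sign_square [simp]: "sign j G * sign j G = 1"
  by (simp add: sign_def flip: power_add mult_2)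

lemma sign_square' [simp]: "sign j G * (sign j G * x) = x"
  by (simp flip: mult.assoc)

lemma sign_in_polys [simp]: "sign j G \<in> polys V"
  by (simp add: sign_def)

lemma sign_insert:
  assumes "k \<notin> G"
  shows "sign j (insert k G) = (if k < j then - sign j G else sign j G)"
proof (cases "k < j")
  case True
  then have "{g \<in> insert k G. g < j} = insert k {g \<in> G. g < j}" by auto
  moreover have "finite {g \<in> G. g < j}" by (rule finite_subset[of _ "{..<j}"]) auto
  ultimately show ?thesis using True assms by (simp add: sign_def)
next
  case False
  then have "{g \<in> insert k G. g < j} = {g \<in> G. g < j}" by auto
  then show ?thesis using False by (simp add: sign_def)
qed

lemma contract_anticommute: "contract j (contract k c) = - contract k (contract j c)"
proof
  fix G
  show "contract j (contract k c) G = (- contract k (contract j c)) G"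
  proof (cases "j = k \<or> j \<in> G \<or> k \<in> G")
    case True
    then show ?thesis by (auto simp: contract_def)
  next
    case False
    then show ?thesis
      by (cases "j < k") (auto simp: contract_def sign_insert insert_commute mult.commute mult.left_commute)
  qed
qed

lemma contract_contract_same [simp]: "contract j (contract j c) = 0"
  by (rule ext) (simp add: contract_def)

lemma contract_wedge:
  fixes c :: "nat set \<Rightarrow> 'k::field mpoly"
  shows "contract j (wedge k c) + wedge k (contract j c) = (if j = k then c else 0)"
proof
  fix G
  show "(contract j (wedge k c) + wedge k (contract j c)) G = (if j = k then c else 0) G"
  proof (cases "j = k")
    case True
    moreover have "sign k (G - {k}) = (sign k G :: 'k mpoly)" if "k \<in> G"
      by (subst (2) insert_Diff[OF that, symmetric], subst sign_insert) auto
    ultimately show ?thesis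
      by (cases "k \<in> G") (auto simp: contract_def wedge_def sign_insert[of k G k] insert_absorb)
  next
    case jk: False
    show ?thesis
    proof (cases "j \<in> G \<or> k \<notin> G")
      case True
      then show ?thesis using jk by (auto simp: contract_def wedge_def)
    next
      case False
      then obtain H where H: "G = insert k H" "k \<notin> H" "j \<notin> H" by (metis mk_disjoint_insert insertCI)
      then have "insert j (insert k H) - {k} = insert j H" using jk by auto
      then show ?thesis using jk H
        by (cases "j < k") (auto simp: contract_def wedge_def sign_insert mult.commute mult.left_commute insert_commute)
    qed
  qed
qed

subsection \<open>Linearity\<close>

lemma contract_linear [simp]:
  "contract j (a + b) = contract j a + contract j b"
  "contract j (a - b) = contract j a - contract j b"
  "contract j (- a) = - contract j a"
  "contract j 0 = 0"
  "contract j (smul p a) = smul p (contract j a)"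
  by (auto simp: contract_def fun_eq_iff smul_def algebra_simps)

lemma wedge_linear [simp]:
  "wedge j (a + b) = wedge j a + wedge j b"
  "wedge j (a - b) = wedge j a - wedge j b"
  "wedge j (- a) = - wedge j a"
  "wedge j 0 = 0"
  "wedge j (smul p a) = smul p (wedge j a)"
  by (auto simp: wedge_def fun_eq_iff smul_def algebra_simps)

lemma smul_linear [simp]:
  "smul p (a + b) = smul p a + smul p b"
  "smul p (a - b) = smul p a - smul p b"
  "smul p (- a) = - smul p a"
  "smul p 0 = 0"
  "smul 0 a = 0"
  "smul 1 a = a"
  by (auto simp: fun_eq_iff smul_def algebra_simps)

lemma smul_smul: "smul p (smul q a) = smul (p * q) a"
  by (simp add: smul_def mult.assoc)

lemma smul_sum: "smul p (sum f A) = (\<Sum>a\<in>A. smul p (f a))"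
  by (simp add: fun_eq_iff smul_def sum_fun_apply sum_distrib_left)

lemma sum_smul: "smul (sum f A) a = (\<Sum>x\<in>A. smul (f x) a)"
by (simp add: fun_eq_iff smul_def sum_fun_apply sum_distrib_right)

lemma contract_sum: "contract j (sum f A) = (\<Sum>a\<in>A. contract j (f a))"
  by (simp add: fun_eq_iff contract_def sum_fun_apply sum_distrib_left)

lemma wedge_sum: "wedge j (sum f A) = (\<Sum>a\<in>A. wedge j (f a))"
  by (simp add: fun_eq_iff wedge_def sum_fun_apply sum_distrib_left)

lemma koszul_linear [simp]:
  "koszul V (a + b) = koszul V a + koszul V b"
  "koszul V (a - b) = koszul V a - koszul V b"
  "koszul V (- a) = - koszul V a"
  "koszul V 0 = 0"
  "koszul V (smul p a) = smul p (koszul V a)"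
  by (simp_all add: koszul_def sum.distrib sum_subtractf sum_negf smul_sum smul_smul mult.commute)

lemma koszul_sum: "koszul V (sum f A) = (\<Sum>a\<in>A. koszul V (f a))"
  unfolding koszul_def by (simp add: contract_sum smul_sum) (rule sum.swap)

lemma contract_koszul: "contract k (koszul V c) = - koszul V (contract k c)"
  by (simp add: koszul_def contract_sum contract_anticommute[of k] sum_negf)

lemma koszul_wedge:
  assumes "finite V" "k \<in> V"
  shows "koszul V (wedge k c) = smul (var k) c - wedge k (koszul V c)"
proof -
  have "koszul V (wedge k c) =
      (\<Sum>j\<in>V. (if j = k then smul (var k) c else 0) - wedge k (smul (var j) (contract j c)))"
    unfolding koszul_def
  proof (rule sum.cong[OF refl])
    fix j
    have *: "contract j (wedge k c) = (if j = k then c else 0) - wedge k (contract j c)"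
      by (simp only: contract_wedge[symmetric] add_diff_cancel_right')
    show "smul (var j) (contract j (wedge k c)) =
        (if j = k then smul (var k) c else 0) - wedge k (smul (var j) (contract j c))"
      unfolding wedge_linear(5) * smul_linear(2) by simp
  qed
  also have "\<dots> = (\<Sum>j\<in>V. if j = k then smul (var k) c else 0) -
      (\<Sum>j\<in>V. wedge k (smul (var j) (contract j c)))"
    by (rule sum_subtractf)
  also have "(\<Sum>j\<in>V. if j = k then smul (var k) c else 0) = smul (var k) c"
    using assms by simp
  also have "(\<Sum>j\<in>V. wedge k (smul (var j) (contract j c))) = wedge k (koszul V c)"
    by (simp only: koszul_def wedge_sum)
  finally show ?thesis .
qed

text \<open>
  The vanishing of the diagonal is a separate hypothesis because of characteristic \<open>2\<close>.
\<close>

lemma sum_antisymmetric: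
  fixes a :: "'i \<Rightarrow> 'i \<Rightarrow> 'c::ab_group_add"
  assumes antisym: "\<And>j k. a j k = - a k j" and diag: "\<And>j. a j j = 0" and "finite A"
  shows "(\<Sum>j\<in>A. \<Sum>k\<in>A. a j k) = 0"
  using assms(3)
proof (induction A)
  case (insert x A)
  have "(\<Sum>k\<in>A. a x k) = (\<Sum>j\<in>A. - a j x)"
    by (rule sum.cong[OF refl antisym])
  then have *: "(\<Sum>k\<in>A. a x k) = - (\<Sum>j\<in>A. a j x)"
    by (simp only: sum_negf)
  have "(\<Sum>j\<in>insert x A. \<Sum>k\<in>insert x A. a j k) =
      a x x + (\<Sum>k\<in>A. a x k) + ((\<Sum>j\<in>A. a j x) + (\<Sum>j\<in>A. \<Sum>k\<in>A. a j k))"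
    by (simp only: insert.hyps sum.distrib sum.insert simp_thms add_ac)
  then show ?case by (simp only: * insert.IH diag) (simp add: ac_simps)
qed simp

lemma koszul_koszul [simp]:
  assumes "finite V"
  shows "koszul V (koszul V c) = 0"
proof -
  have "koszul V (koszul V c) =
      (\<Sum>j\<in>V. \<Sum>k\<in>V. smul (var j * var k) (contract j (contract k c)))"
    unfolding koszul_def by (simp add: contract_sum smul_sum smul_smul)
  also have "\<dots> = 0"
  proof (rule sum_antisymmetric)
    show "smul (var j * var k) (contract j (contract k c)) =
        - smul (var k * var j) (contract k (contract j c))" for j k
      by (subst contract_anticommute) (simp add: mult.commute)
  qed (use assms in auto)
  finally show ?thesis .
qed

subsection \<open>Chains and coefficients\<close>

lemma chainsI:
  assumes "\<And>F. F \<subseteq> V \<Longrightarrow> card F = q \<Longrightarrow> c F \<in> polys V"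
    and "\<And>F. \<not> F \<subseteq> V \<Longrightarrow> c F = 0" and "\<And>F. F \<subseteq> V \<Longrightarrow> card F \<noteq> q \<Longrightarrow> c F = 0"
  shows "c \<in> koszul_chains V q"
  unfolding koszul_chains_def using assms by simp metis

lemma chains_coef [simp]: "c \<in> koszul_chains V q \<Longrightarrow> c F \<in> polys V"
  unfolding koszul_chains_def by (metis (mono_tags, lifting) mem_Collect_eq polys_closed(1))

lemma chains_eq_0: "c \<in> koszul_chains V q \<Longrightarrow> \<not> (F \<subseteq> V \<and> card F = q) \<Longrightarrow> c F = 0"
  unfolding koszul_chains_def by (metis (mono_tags, lifting) mem_Collect_eq)

lemma chains_closed [simp, intro]:
  "0 \<in> koszul_chains V q"
  "a \<in> koszul_chains V q \<Longrightarrow> b \<in> koszul_chains V q \<Longrightarrow> a + b \<in> koszul_chains V q"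
  "a \<in> koszul_chains V q \<Longrightarrow> b \<in> koszul_chains V q \<Longrightarrow> a - b \<in> koszul_chains V q"
  "a \<in> koszul_chains V q \<Longrightarrow> - a \<in> koszul_chains V q"
  "p \<in> polys V \<Longrightarrow> a \<in> koszul_chains V q \<Longrightarrow> smul p a \<in> koszul_chains V q"
  by (auto simp: koszul_chains_def smul_def)

lemma chains_sum: "(\<And>x. x \<in> A \<Longrightarrow> f x \<in> koszul_chains V q) \<Longrightarrow> sum f A \<in> koszul_chains V q"
  by (induction A rule: infinite_finite_induct) auto

lemma chains_contract [simp, intro]:
  assumes "finite V" "c \<in> koszul_chains V (Suc q)"
  shows "contract j c \<in> koszul_chains V q"
proof (rule chainsI)
  fix F
  show "contract j c F \<in> polys V" using assms by (simp add: contract_def)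
  show "contract j c F = 0" if "\<not> F \<subseteq> V"
    using assms that by (auto simp: contract_def intro: chains_eq_0)
  show "contract j c F = 0" if "F \<subseteq> V" "card F \<noteq> q"
    using assms that finite_subset[OF that(1)] by (auto simp: contract_def chains_eq_0)
qed

lemma contract_chain_0:
  assumes "finite V" "c \<in> koszul_chains V 0"
  shows "contract j c = 0"
proof
  fix F
  have "card (insert j F) \<noteq> 0" if "insert j F \<subseteq> V"
    using finite_subset[OF that assms(1)] by simp
  then have "c (insert j F) = 0" by (intro chains_eq_0[OF assms(2)]) auto
  then show "contract j c F = 0 F" by (simp add: contract_def)
qed

lemma chains_wedge [simp, intro]:
  assumes "finite V" "j \<in> V" "c \<in> koszul_chains V q"
  shows "wedge j c \<in> koszul_chains V (Suc q)"
proof (rule chainsI)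
  fix F
  show "wedge j c F \<in> polys V" using assms by (simp add: wedge_def)
  show "wedge j c F = 0" if "\<not> F \<subseteq> V"
    using assms that by (auto simp: wedge_def intro!: chains_eq_0)
  show "wedge j c F = 0" if "F \<subseteq> V" "card F \<noteq> Suc q"
  proof (cases "j \<in> F")
    case True
    then have "card (F - {j}) \<noteq> q"
      using that finite_subset[OF that(1) assms(1)] card_Suc_Diff1[of F j] by auto
    then have "c (F - {j}) = 0" by (intro chains_eq_0[OF assms(3)]) auto
    then show ?thesis by (simp add: wedge_def)
  qed (simp add: wedge_def)
qed

lemma chains_koszul [simp, intro]:
  assumes "finite V" "c \<in> koszul_chains V (Suc q)"
  shows "koszul V c \<in> koszul_chains V q"
  unfolding koszul_def using assms by (intro chains_sum) auto

lemma chains_above: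
  assumes "finite V" "c \<in> koszul_chains V q" "card V < q"
  shows "c = 0"
proof
  fix F show "c F = 0 F"
    using assms card_mono[OF assms(1), of F] by (auto intro!: chains_eq_0[OF assms(2)])
qed

lemma chains_coefs_in: "c \<in> koszul_chains V q \<Longrightarrow> c \<in> coefs_in (polys V)"
  by (simp add: coefs_in_def)

lemma coefs_in_mono: "J \<subseteq> J' \<Longrightarrow> coefs_in J \<subseteq> coefs_in J'"
  by (auto simp: coefs_in_def)

context
  fixes V :: "nat set" and J :: "'k::field mpoly set"
  assumes J: "pideal V J"
begin

lemma coefs_in_closed:
  "0 \<in> coefs_in J"
  "a \<in> coefs_in J \<Longrightarrow> b \<in> coefs_in J \<Longrightarrow> a + b \<in> coefs_in J"
  "a \<in> coefs_in J \<Longrightarrow> b \<in> coefs_in J \<Longrightarrow> a - b \<in> coefs_in J"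
  "a \<in> coefs_in J \<Longrightarrow> - a \<in> coefs_in J"
  "p \<in> polys V \<Longrightarrow> a \<in> coefs_in J \<Longrightarrow> smul p a \<in> coefs_in J"
  "a \<in> coefs_in J \<Longrightarrow> contract j a \<in> coefs_in J"
  "a \<in> coefs_in J \<Longrightarrow> wedge j a \<in> coefs_in J"
  using pidealD[OF J] by (auto simp: coefs_in_def smul_def contract_def wedge_def)

lemma coefs_in_sum: "(\<And>x. x \<in> A \<Longrightarrow> f x \<in> coefs_in J) \<Longrightarrow> sum f A \<in> coefs_in J"
  by (induction A rule: infinite_finite_induct) (auto intro: coefs_in_closed)

lemma coefs_in_koszul: "a \<in> coefs_in J \<Longrightarrow> koszul V a \<in> coefs_in J"
  unfolding koszul_def by (intro coefs_in_sum coefs_in_closed) auto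

lemma boundary_cong:
  "a - b \<in> coefs_in J \<Longrightarrow> boundary V J q b \<Longrightarrow> boundary V J q a"
  unfolding boundary_def using coefs_in_closed(2)[of "a - b"] by fastforce

lemma boundary_of_coefs_in: "a \<in> coefs_in J \<Longrightarrow> boundary V J q a"
  unfolding boundary_def by (rule bexI[of _ 0]) auto

lemma boundary_add: "boundary V J q a \<Longrightarrow> boundary V J q b \<Longrightarrow> boundary V J q (a + b)"
proof -
  assume "boundary V J q a" "boundary V J q b"
  then obtain v w where "v \<in> koszul_chains V (Suc q)" "w \<in> koszul_chains V (Suc q)"
    "a - koszul V v \<in> coefs_in J" "b - koszul V w \<in> coefs_in J" by (auto simp: boundary_def)
  then show "boundary V J q (a + b)"
    unfolding boundary_def using coefs_in_closed(2)[of "a - koszul V v" "b - koszul V w"]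
    by (intro bexI[of _ "v + w"]) (auto simp: algebra_simps)
qed

end

lemma boundary_koszul: "pideal V J \<Longrightarrow> w \<in> koszul_chains V (Suc q) \<Longrightarrow> boundary V J q (koszul V w)"
  unfolding boundary_def by (rule bexI[of _ w]) (auto intro: coefs_in_closed)

lemma boundary_mono: "J \<subseteq> J' \<Longrightarrow> boundary V J q z \<Longrightarrow> boundary V J' q z"
  unfolding boundary_def using coefs_in_mono by blast

section \<open>Weakly regular sequences\<close>

definition adjoin :: "nat set \<Rightarrow> 'k::field mpoly set \<Rightarrow> 'k mpoly \<Rightarrow> 'k mpoly set" where
  "adjoin V J f = {f * x + y | x y. x \<in> polys V \<and> y \<in> J}"

definition nonzerodivisor :: "nat set \<Rightarrow> 'k::field mpoly set \<Rightarrow> 'k mpoly \<Rightarrow> bool" where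
  "nonzerodivisor V J f \<longleftrightarrow> (\<forall>x \<in> polys V. f * x \<in> J \<longrightarrow> x \<in> J)"

fun adjoin_list :: "nat set \<Rightarrow> 'k::field mpoly set \<Rightarrow> 'k mpoly list \<Rightarrow> 'k mpoly set" where
  "adjoin_list V J [] = J"
| "adjoin_list V J (f # fs) = adjoin_list V (adjoin V J f) fs"

text \<open>
  Without the condition that the last quotient is not zero, the notion behaves well in exact
  sequences; the condition is automatic for sequences in \<open>\<mm>\<close> over an ideal \<open>J \<subseteq> \<mm>\<close>.
\<close>

fun weakly_regular :: "nat set \<Rightarrow> 'k::field mpoly set \<Rightarrow> 'k mpoly list \<Rightarrow> bool" where
  "weakly_regular V J [] \<longleftrightarrow> True"
| "weakly_regular V J (f # fs) \<longleftrightarrow> nonzerodivisor V J f \<and> weakly_regular V (adjoin V J f) fs"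

lemma adjoinI: "a \<in> polys V \<Longrightarrow> b \<in> J \<Longrightarrow> p = f * a + b \<Longrightarrow> p \<in> adjoin V J f"
  by (auto simp: adjoin_def)

lemma pideal_adjoin:
  assumes "pideal V J" "f \<in> polys V"
  shows "pideal V (adjoin V J f)"
  unfolding pideal_def
proof (intro conjI ballI)
  note * = pidealD[OF assms(1)]
  show "adjoin V J f \<subseteq> polys V" using * assms(2) by (auto simp: adjoin_def)
  show "0 \<in> adjoin V J f" by (rule adjoinI[of 0 _ 0]) (use * in auto)
  show "x + y \<in> adjoin V J f" if xy: "x \<in> adjoin V J f" "y \<in> adjoin V J f" for x y
  proof -
    obtain a b c d where "x = f * a + b" "y = f * c + d" "a \<in> polys V" "c \<in> polys V" "b \<in> J" "d \<in> J"
      using xy by (auto simp: adjoin_def)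
    then show ?thesis by (intro adjoinI[of "a + c" _ "b + d"]) (auto intro: * simp: algebra_simps)
  qed
  show "x * y \<in> adjoin V J f" if xy: "x \<in> polys V" "y \<in> adjoin V J f" for x y
  proof -
    obtain c d where "y = f * c + d" "c \<in> polys V" "d \<in> J"
      using xy by (auto simp: adjoin_def)
    then show ?thesis using xy by (intro adjoinI[of "x * c" _ "x * d"]) (auto intro: * simp: algebra_simps)
  qed
qed

lemma subset_adjoin: "J \<subseteq> adjoin V J f"
  unfolding adjoin_def by (force intro: exI[of _ 0])

lemma mult_in_adjoin: "0 \<in> J \<Longrightarrow> x \<in> polys V \<Longrightarrow> f * x \<in> adjoin V J f"
  unfolding adjoin_def by force

lemma self_in_adjoin: "0 \<in> J \<Longrightarrow> f \<in> adjoin V J f"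
  using mult_in_adjoin[of J 1] by simp

lemma adjoin_minimal:
  "pideal V K \<Longrightarrow> J \<subseteq> K \<Longrightarrow> f \<in> K \<Longrightarrow> adjoin V J f \<subseteq> K"
  unfolding adjoin_def using pidealD(3,5) by blast

lemma adjoin_mono: "J \<subseteq> J' \<Longrightarrow> adjoin V J f \<subseteq> adjoin V J' f"
  unfolding adjoin_def by blast

lemma adjoin_commute:
  assumes "pideal V J" "f \<in> polys V" "g \<in> polys V"
  shows "adjoin V (adjoin V J f) g = adjoin V (adjoin V J g) f"
proof -
  have "adjoin V (adjoin V J f) g \<subseteq> adjoin V (adjoin V J g) f"
    if "f \<in> polys V" "g \<in> polys V" for f g
  proof (rule adjoin_minimal)
    show "pideal V (adjoin V (adjoin V J g) f)" using assms(1) that by (intro pideal_adjoin)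
    show "adjoin V J f \<subseteq> adjoin V (adjoin V J g) f" by (intro adjoin_mono subset_adjoin)
    show "g \<in> adjoin V (adjoin V J g) f"
      using self_in_adjoin pidealD(2)[OF assms(1)] subset_adjoin by blast
  qed
  then show ?thesis using assms by (intro equalityI) simp_all
qed

lemma adjoin_member:
  assumes "pideal V J" "f \<in> J"
  shows "adjoin V J f = J"
  using adjoin_minimal[OF assms(1) order_refl assms(2)] subset_adjoin[of J V f] by simp

lemma pideal_adjoin_list: "pideal V J \<Longrightarrow> set fs \<subseteq> polys V \<Longrightarrow> pideal V (adjoin_list V J fs)"
  by (induction fs arbitrary: J) (auto intro: pideal_adjoin)

lemma adjoin_list_minimal:
  "pideal V K \<Longrightarrow> J \<subseteq> K \<Longrightarrow> set fs \<subseteq> K \<Longrightarrow> adjoin_list V J fs \<subseteq> K"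
  by (induction fs arbitrary: J) (auto simp: adjoin_minimal)

lemma subset_adjoin_list: "J \<subseteq> adjoin_list V J fs"
  by (induction fs arbitrary: J) (use subset_adjoin in fastforce)+

lemma weakly_regular_append:
  "weakly_regular V J (fs @ gs) \<longleftrightarrow> weakly_regular V J fs \<and> weakly_regular V (adjoin_list V J fs) gs"
  by (induction fs arbitrary: J) auto

lemma weakly_regular_polys:
  "set fs \<subseteq> polys V \<Longrightarrow> weakly_regular V (polys V) fs"
proof (induction fs)
  case (Cons f fs)
  then have "adjoin V (polys V) f = polys V" by (intro adjoin_member pideal_polys) auto
  with Cons show ?case by (simp add: nonzerodivisor_def)
qed simp

lemma nonzerodivisor_prod:
  assumes "\<And>a. a \<in> A \<Longrightarrow> nonzerodivisor V J (f a)" "\<And>a. a \<in> A \<Longrightarrow> f a \<in> polys V"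
  shows "nonzerodivisor V J (prod f A)"
  using assms
proof (induction A rule: infinite_finite_induct)
  case (insert a A)
  have "prod f A \<in> polys V" by (intro polys_prod insert.prems) simp
  moreover have "nonzerodivisor V J (f a)" "f a \<in> polys V" using insert.prems by simp_all
  moreover have "nonzerodivisor V J (prod f A)" by (intro insert.IH insert.prems) simp_all
  ultimately show ?case
    unfolding nonzerodivisor_def prod.insert[OF insert.hyps] mult.assoc
    by (meson polys_closed(4))
qed (simp_all add: nonzerodivisor_def)

subsection \<open>Regular sequences kill Koszul homology from above\<close>

text \<open>The product \<open>\<mm> J\<close>.\<close>

definition times_max :: "nat set \<Rightarrow> 'k::field mpoly set \<Rightarrow> 'k mpoly set" where
  "times_max V J = {\<Sum>j\<in>V. var j * y j | y. \<forall>j\<in>V. y j \<in> J}"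

lemma pideal_times_max:
  assumes "pideal V J"
  shows "pideal V (times_max V J)"
  unfolding pideal_def
proof (intro conjI ballI)
  note * = pidealD[OF assms(1)]
  show "times_max V J \<subseteq> polys V"
    using * by (fastforce simp: times_max_def intro!: polys_sum)
  show "0 \<in> times_max V J"
    unfolding times_max_def using *(2) by (force intro!: exI[of _ "\<lambda>_. 0"])
  show "a + b \<in> times_max V J" if ab: "a \<in> times_max V J" "b \<in> times_max V J" for a b
  proof -
    obtain y z where "a = (\<Sum>j\<in>V. var j * y j)" "b = (\<Sum>j\<in>V. var j * z j)"
      "\<forall>j\<in>V. y j \<in> J" "\<forall>j\<in>V. z j \<in> J" using ab by (auto simp: times_max_def)
    then show ?thesis unfolding times_max_def using *(3)
      by (intro CollectI exI[of _ "\<lambda>j. y j + z j"]) (auto simp: algebra_simps sum.distrib)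
  qed
  show "a * b \<in> times_max V J" if ab: "a \<in> polys V" "b \<in> times_max V J" for a b
  proof -
    obtain z where "b = (\<Sum>j\<in>V. var j * z j)" "\<forall>j\<in>V. z j \<in> J" using ab by (auto simp: times_max_def)
    then show ?thesis unfolding times_max_def using *(4) ab(1)
      by (intro CollectI exI[of _ "\<lambda>j. a * z j"]) (auto simp: algebra_simps sum_distrib_left)
  qed
qed

lemma var_mult_in_times_max:
  assumes "finite V" "j \<in> V" "p \<in> J" "0 \<in> J"
  shows "var j * p \<in> times_max V J"
proof -
  have "(\<Sum>k\<in>V. var k * (if k = j then p else 0)) = var j * p"
    using assms by (simp add: if_distrib[of "(*) _"] cong: if_cong)
  then show ?thesis unfolding times_max_def using assms
    by (intro CollectI exI[of _ "\<lambda>k. if k = j then p else 0"]) auto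
qed

lemma times_max_mono: "J \<subseteq> J' \<Longrightarrow> times_max V J \<subseteq> times_max V J'"
  unfolding times_max_def by blast

lemma graded_max_ideal_subset_times_max:
  "finite V \<Longrightarrow> graded_max_ideal V \<subseteq> times_max V (polys V)"
  unfolding graded_max_ideal_def
  using var_mult_in_times_max[of V _ 1 "polys V"]
  by (intro Idl_subset pideal_times_max pideal_polys) auto

text \<open>
  A polynomial \<open>f = \<Sum> x\<^sub>j g\<^sub>j\<close> annihilates Koszul homology, the homotopy being
  \<open>\<Sum> g\<^sub>j e\<^sub>j \<and> _\<close>. Hence a cycle \<open>z\<close> in degree \<open>q\<close> gives the cycle \<open>h z = \<Sum> g\<^sub>j e\<^sub>j \<and> z\<close> in degree
  \<open>q + 1\<close> modulo \<open>f\<close>. If \<open>h z - \<partial>w = f y\<close> modulo \<open>J\<close>, then \<open>f (z - \<partial>y) \<in> J\<close>, and \<open>f\<close> can be cancelled.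
\<close>

lemma acyclic_at_of_nonzerodivisor:
  assumes V: "finite V" and J: "pideal V J" and f: "f \<in> graded_max_ideal V"
    and nzd: "nonzerodivisor V J f" and acyc: "acyclic_at V (adjoin V J f) (Suc q)"
  shows "acyclic_at V J q"
  unfolding acyclic_at_def
proof (intro ballI impI)
  fix z assume z: "z \<in> koszul_chains V q" and cycle: "koszul V z \<in> coefs_in J"
  have "f \<in> times_max V (polys V)" using graded_max_ideal_subset_times_max[OF V] f by blast
  then obtain g where g: "f = (\<Sum>j\<in>V. var j * g j)" "\<And>j. j \<in> V \<Longrightarrow> g j \<in> polys V"
    by (auto simp: times_max_def)
  have fp: "f \<in> polys V" using f by (simp add: mem_graded_max_ideal)
  have J': "pideal V (adjoin V J f)" by (rule pideal_adjoin[OF J fp])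
  define h where "h c = (\<Sum>j\<in>V. smul (g j) (wedge j c))" for c :: "nat set \<Rightarrow> 'a mpoly"
  have homotopy: "koszul V (h z) = smul f z - h (koszul V z)"
  proof -
    have "koszul V (h z) = (\<Sum>j\<in>V. smul (g j) (koszul V (wedge j z)))"
      unfolding h_def by (simp only: koszul_sum koszul_linear)
    also have "\<dots> = (\<Sum>j\<in>V. smul (var j * g j) z - smul (g j) (wedge j (koszul V z)))"
      by (rule sum.cong[OF refl]) (simp only: koszul_wedge[OF V] smul_linear smul_smul mult.commute)
    also have "\<dots> = smul f z - h (koszul V z)"
      unfolding h_def g(1) sum_smul by (rule sum_subtractf)
    finally show ?thesis .
  qed
  have hz: "h z \<in> koszul_chains V (Suc q)"
    unfolding h_def using V g(2) z by (intro chains_sum) auto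
  have hk: "h (koszul V z) \<in> coefs_in J"
    unfolding h_def using g(2) cycle by (intro coefs_in_sum[OF J] coefs_in_closed[OF J])
  have "koszul V (h z) \<in> coefs_in (adjoin V J f)"
    unfolding homotopy
  proof (rule coefs_in_closed(3)[OF J'])
    show "smul f z \<in> coefs_in (adjoin V J f)"
      using mult_in_adjoin[OF pidealD(2)[OF J]] chains_coef[OF z] by (simp add: coefs_in_def smul_def)
    show "h (koszul V z) \<in> coefs_in (adjoin V J f)" using hk coefs_in_mono[OF subset_adjoin] by blast
  qed
  with acyc hz obtain w where w: "w \<in> koszul_chains V (Suc (Suc q))"
    "h z - koszul V w \<in> coefs_in (adjoin V J f)"
    unfolding acyclic_at_def boundary_def by blast
  define c where "c = h z - koszul V w"
  have c: "c \<in> koszul_chains V (Suc q)" unfolding c_def using hz chains_koszul[OF V w(1)] by (rule chains_closed)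
  \<comment> \<open>the coefficients are divided by \<open>f\<close> in such a way that the result is again a chain\<close>
  have "\<exists>a. a \<in> polys V \<and> c F - f * a \<in> J \<and> (\<not> (F \<subseteq> V \<and> card F = Suc q) \<longrightarrow> a = 0)" for F
  proof (cases "F \<subseteq> V \<and> card F = Suc q")
    case True
    have "c F \<in> adjoin V J f" using w(2) by (simp add: coefs_in_def c_def)
    then obtain a b where "c F = f * a + b" "a \<in> polys V" "b \<in> J" by (auto simp: adjoin_def)
    then show ?thesis using True by (intro exI[of _ a]) auto
  next
    case False
    then show ?thesis using chains_eq_0[OF c False] pidealD(2)[OF J] by (intro exI[of _ 0]) auto
  qed
  then obtain y where y: "\<And>F. y F \<in> polys V" "\<And>F. c F - f * y F \<in> J"
    "\<And>F. \<not> (F \<subseteq> V \<and> card F = Suc q) \<Longrightarrow> y F = 0" by metis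
  have ych: "y \<in> koszul_chains V (Suc q)" using y by (intro chainsI) auto
  have "c - smul f y \<in> coefs_in J" using y(2) by (simp add: coefs_in_def smul_def)
  then have "koszul V (c - smul f y) \<in> coefs_in J" by (rule coefs_in_koszul[OF J])
  moreover have "koszul V (c - smul f y) = smul f z - h (koszul V z) - smul f (koszul V y)"
    unfolding c_def koszul_linear homotopy koszul_koszul[OF V] by simp
  ultimately have "(smul f z - h (koszul V z) - smul f (koszul V y)) + h (koszul V z) \<in> coefs_in J"
    using hk by (metis coefs_in_closed(2)[OF J])
  then have "\<And>F. f * (z F - koszul V y F) \<in> J"
    by (simp add: coefs_in_def smul_def algebra_simps)
  moreover have "z F - koszul V y F \<in> polys V" for F
    using chains_coef[OF z] chains_coef[OF chains_koszul[OF V ych]] by blast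
  ultimately have "z - koszul V y \<in> coefs_in J"
    using nzd by (simp add: nonzerodivisor_def coefs_in_def)
  then show "boundary V J q z" unfolding boundary_def using ych by blast
qed

lemma acyclic_at_of_weakly_regular:
  assumes "finite V"
  shows "pideal V J \<Longrightarrow> set fs \<subseteq> graded_max_ideal V \<Longrightarrow> weakly_regular V J fs \<Longrightarrow>
    card V < q + length fs \<Longrightarrow> acyclic_at V J q"
proof (induction fs arbitrary: J q)
  case Nil
  have "z = 0" if "z \<in> koszul_chains V q" for z :: "nat set \<Rightarrow> 'a mpoly"
    using chains_above[OF assms that] Nil by simp
  then show ?case
    using Nil by (auto simp: acyclic_at_def intro!: boundary_of_coefs_in coefs_in_closed)
next
  case (Cons f fs)
  have f: "f \<in> graded_max_ideal V" "f \<in> polys V" using Cons.prems by (auto simp: mem_graded_max_ideal)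
  show ?case
    by (rule acyclic_at_of_nonzerodivisor[OF assms Cons.prems(1) f(1)])
      (use Cons.prems f in \<open>auto intro!: Cons.IH pideal_adjoin\<close>)
qed

subsection \<open>Regularity along a filtration\<close>

lemma mem_colon: "g \<in> colon (poly_ring V) J x \<longleftrightarrow> g \<in> polys V \<and> x * g \<in> J"
  by (simp add: colon_def mult.commute)

lemma pideal_colon: "pideal V J \<Longrightarrow> x \<in> polys V \<Longrightarrow> pideal V (colon (poly_ring V) J x)"
  unfolding pideal_def[of V "colon _ _ _"] using pidealD[of V J]
  by (auto simp: mem_colon distrib_left mult.left_commute)

text \<open>
  This is regularity in the middle of
  \<open>0 \<rightarrow> K[V]/(J : x) \<rightarrow> K[V]/J \<rightarrow> K[V]/(J, x) \<rightarrow> 0\<close>. The induction goes through because a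
  nonzerodivisor \<open>f\<close> on the right-hand module commutes with the formation of the colon ideal.
\<close>

lemma weakly_regular_middle:
  assumes x: "x \<in> polys V"
  shows "pideal V J \<Longrightarrow> set fs \<subseteq> polys V \<Longrightarrow> weakly_regular V (colon (poly_ring V) J x) fs \<Longrightarrow>
    weakly_regular V (adjoin V J x) fs \<Longrightarrow> weakly_regular V J fs"
proof (induction fs arbitrary: J)
  case (Cons f fs)
  note J = pidealD[OF Cons.prems(1)]
  let ?C = "colon (poly_ring V) J x"
  have f: "f \<in> polys V" using Cons.prems by simp
  have nzd1: "f * g \<in> J \<Longrightarrow> g \<in> polys V \<Longrightarrow> g \<in> adjoin V J x" for g
    using Cons.prems(4) subset_adjoin[of J V x] by (auto simp: nonzerodivisor_def)
  have split: "\<exists>h \<in> polys V. \<exists>j \<in> J. g = x * h + j" if "g \<in> adjoin V J x" for g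
    using that by (auto simp: adjoin_def)
  have nzd: "nonzerodivisor V J f"
    unfolding nonzerodivisor_def
  proof (intro ballI impI)
    fix g assume g: "g \<in> polys V" "f * g \<in> J"
    then obtain h j where h: "h \<in> polys V" "j \<in> J" "g = x * h + j" using nzd1 split by blast
    have "x * (f * h) = f * g - f * j" using h by (simp add: algebra_simps)
    then have "f * h \<in> ?C" using g h f J by (simp add: mem_colon)
    then have "h \<in> ?C" using Cons.prems(3) h by (simp add: nonzerodivisor_def)
    then show "g \<in> J" using h J by (simp add: mem_colon)
  qed
  have colon_eq: "colon (poly_ring V) (adjoin V J f) x = adjoin V ?C f"
  proof
    show "colon (poly_ring V) (adjoin V J f) x \<subseteq> adjoin V ?C f"
    proof
      fix g assume "g \<in> colon (poly_ring V) (adjoin V J f) x"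
      then obtain a b where g: "g \<in> polys V" "x * g = f * a + b" "a \<in> polys V" "b \<in> J"
        by (auto simp: mem_colon adjoin_def)
      then have "f * a \<in> adjoin V J x" by (intro adjoinI[of g _ "- b"]) (auto intro: J)
      then have "a \<in> adjoin V J x" using Cons.prems(4) g by (simp add: nonzerodivisor_def)
      then obtain h j where h: "h \<in> polys V" "j \<in> J" "a = x * h + j" using split by blast
      have "x * (g - f * h) = f * j + b" using g h by (simp add: algebra_simps)
      then have "g - f * h \<in> ?C" using g h J f by (simp add: mem_colon)
      moreover have "g = f * h + (g - f * h)" by simp
      ultimately show "g \<in> adjoin V ?C f" unfolding adjoin_def using h by blast
    qed
    show "adjoin V ?C f \<subseteq> colon (poly_ring V) (adjoin V J f) x"
    proof
      fix g assume "g \<in> adjoin V ?C f"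
      then obtain a b where g: "g = f * a + b" "a \<in> polys V" "b \<in> polys V" "x * b \<in> J"
        by (auto simp: mem_colon adjoin_def)
      then have "x * g = f * (x * a) + x * b" by (simp add: algebra_simps)
      then show "g \<in> colon (poly_ring V) (adjoin V J f) x"
        unfolding mem_colon using g x f by (auto simp: adjoin_def)
    qed
  qed
  have "weakly_regular V (adjoin V J f) fs"
    by (rule Cons.IH)
      (use Cons.prems x f in \<open>simp_all add: pideal_adjoin colon_eq adjoin_commute[of V J f x]\<close>)
  then show ?case using nzd by simp
qed simp

text \<open>
  The ideal \<open>(J, x\<^sub>i)\<close> of \<open>K[V]\<close> for an ideal \<open>J\<close> of \<open>K[V - {i}]\<close>, written so that \<open>x\<^sub>i \<mapsto> 0\<close> visibly
  identifies the two residue class rings.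
\<close>

definition at0_preimage :: "nat set \<Rightarrow> nat \<Rightarrow> 'k::field mpoly set \<Rightarrow> 'k mpoly set" where
  "at0_preimage V i J = {p \<in> polys V. at0 i p \<in> J}"

lemma weakly_regular_at0_preimage:
  "pideal (V - {i}) J \<Longrightarrow> set fs \<subseteq> polys V \<Longrightarrow> weakly_regular (V - {i}) J (map (at0 i) fs) \<Longrightarrow>
    weakly_regular V (at0_preimage V i J) fs"
proof (induction fs arbitrary: J)
  case (Cons f fs)
  have f: "f \<in> polys V" using Cons.prems by simp
  have sub: "polys (V - {i}) \<subseteq> (polys V :: 'a mpoly set)" by (rule polys_mono) auto
  have eq: "adjoin V (at0_preimage V i J) f = at0_preimage V i (adjoin (V - {i}) J (at0 i f))"
  proof
    show "adjoin V (at0_preimage V i J) f \<subseteq> at0_preimage V i (adjoin (V - {i}) J (at0 i f))"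
      using f by (fastforce simp: adjoin_def at0_preimage_def)
    show "at0_preimage V i (adjoin (V - {i}) J (at0 i f)) \<subseteq> adjoin V (at0_preimage V i J) f"
    proof
      fix p assume "p \<in> at0_preimage V i (adjoin (V - {i}) J (at0 i f))"
      then obtain a b where p: "p \<in> polys V" "at0 i p = at0 i f * a + b" "a \<in> polys (V - {i})" "b \<in> J"
        by (auto simp: adjoin_def at0_preimage_def)
      have "at0 i (p - f * a) = b" using p by (simp add: at0_free[of a "V - {i}"])
      then have "p - f * a \<in> at0_preimage V i J"
        using p f sub by (auto simp: at0_preimage_def)
      moreover have "p = f * a + (p - f * a)" by simp
      ultimately show "p \<in> adjoin V (at0_preimage V i J) f"
        unfolding adjoin_def using p sub by blast
    qed
  qed
  have "nonzerodivisor V (at0_preimage V i J) f"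
    using Cons.prems f by (auto simp: nonzerodivisor_def at0_preimage_def)
  moreover have "weakly_regular V (adjoin V (at0_preimage V i J) f) fs"
    unfolding eq using Cons.prems f by (intro Cons.IH) (auto intro: pideal_adjoin)
  ultimately show ?case by simp
qed simp

lemma adjoin_zero_var:
  assumes "i \<in> V"
  shows "adjoin V {0 :: 'k::field mpoly} (var i) = at0_preimage V i {0}"
proof
  show "adjoin V {0 :: 'k mpoly} (var i) \<subseteq> at0_preimage V i {0}"
    using assms by (auto simp: adjoin_def at0_preimage_def)
  show "at0_preimage V i {0 :: 'k mpoly} \<subseteq> adjoin V {0} (var i)"
  proof
    fix p :: "'k mpoly" assume p: "p \<in> at0_preimage V i {0}"
    then have "p = var i * quo i p + 0" using at0_plus_quo[of i p] by (simp add: at0_preimage_def)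
    then show "p \<in> adjoin V {0} (var i)"
      unfolding adjoin_def using p quo_polys[of p V i] by (auto simp: at0_preimage_def)
  qed
qed

section \<open>Elementary symmetric polynomials\<close>

definition tdeg :: "(nat \<Rightarrow>\<^sub>0 nat) \<Rightarrow> nat" where
  "tdeg m = (\<Sum>i \<in> vars m. Poly_Mapping.lookup m i)"

definition homogeneous :: "nat \<Rightarrow> 'k::field mpoly \<Rightarrow> bool" where
  "homogeneous k p \<longleftrightarrow> (\<forall>m \<in> exps p. tdeg m = k)"

definition below :: "nat \<Rightarrow> 'k::field mpoly \<Rightarrow> 'k mpoly" where
  "below d p = restr {m. tdeg m < d} p"

definition graded :: "'k::field mpoly set \<Rightarrow> bool" where
  "graded J \<longleftrightarrow> (\<forall>p \<in> J. \<forall>d. below d p \<in> J)"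

lemma tdeg_superset: "finite A \<Longrightarrow> vars m \<subseteq> A \<Longrightarrow> tdeg m = (\<Sum>i\<in>A. Poly_Mapping.lookup m i)"
  unfolding tdeg_def by (rule sum.mono_neutral_left) (auto simp: in_keys_iff)

lemma tdeg_add: "tdeg (a + b) = tdeg a + tdeg b"
  by (subst (1 2 3) tdeg_superset[of "vars a \<union> vars b"]) (auto simp: vars_add lookup_add sum.distrib)

lemma tdeg_zero [simp]: "tdeg 0 = 0"
  by (simp add: tdeg_def)

lemma tdeg_single [simp]: "tdeg (Poly_Mapping.single i n) = n"
  by (cases "n = 0") (simp_all add: tdeg_def)

lemma homogeneous_mult: "homogeneous j p \<Longrightarrow> homogeneous k q \<Longrightarrow> homogeneous (j + k) (p * q)"
  unfolding homogeneous_def using keys_mult[of p q] by (fastforce simp: tdeg_add)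

lemma homogeneous_var: "homogeneous 1 (var i)"
  by (simp add: homogeneous_def var_def)

lemma homogeneous_one: "homogeneous 0 1"
  by (simp add: homogeneous_def)

lemma homogeneous_prod_var: "finite F \<Longrightarrow> homogeneous (card F) (\<Prod>j\<in>F. var j)"
proof (induction F rule: finite_induct)
  case (insert i F)
  then show ?case using homogeneous_mult[OF homogeneous_var insert.IH] by simp
qed (simp add: homogeneous_one)

lemma homogeneous_sum: "(\<And>a. a \<in> A \<Longrightarrow> homogeneous k (f a)) \<Longrightarrow> homogeneous k (sum f A)"
  unfolding homogeneous_def using keys_sum[of f A] by fastforce

lemma below_mult: "homogeneous k p \<Longrightarrow> below d (p * q) = p * restr {m. k + tdeg m < d} q"
  unfolding below_def homogeneous_def by (rule restr_mult_shift) (simp add: tdeg_add)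

lemma graded_adjoin:
  assumes "graded J" "homogeneous k f"
  shows "graded (adjoin V J f)"
  unfolding graded_def
proof (intro ballI allI)
  fix p d assume "p \<in> adjoin V J f"
  then obtain a b where p: "p = f * a + b" "a \<in> polys V" "b \<in> J" by (auto simp: adjoin_def)
  have "below d p = f * restr {m. k + tdeg m < d} a + below d b"
    using below_mult[OF assms(2)] by (simp add: p below_def restr_add)
  then show "below d p \<in> adjoin V J f"
    using p assms(1) by (intro adjoinI[of "restr {m. k + tdeg m < d} a" _ "below d b"]) (auto simp: graded_def)
qed

text \<open>
  In a graded ring, regularity lifts from the quotient by a variable that is regular itself:
  if \<open>f * g \<in> J\<close> then \<open>g \<in> (J, x)\<close>, and \<open>g\<close> can be replaced by a quotient by \<open>x\<close> of smaller
  degree.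
\<close>

lemma nonzerodivisor_lift:
  assumes J: "pideal V J" "graded J" and f: "f \<in> polys V" and i: "i \<in> V"
    and x: "nonzerodivisor V J (var i)" and f': "nonzerodivisor V (adjoin V J (var i)) f"
  shows "nonzerodivisor V J f"
proof -
  note * = pidealD[OF J(1)]
  have "g \<in> J" if "g \<in> polys V" "f * g \<in> J" "\<forall>m \<in> exps g. tdeg m < d" for g d
    using that
  proof (induction d arbitrary: g)
    case 0
    then have "g = 0" by (simp flip: keys_eq_empty)
    then show ?case using * by simp
  next
    case (Suc d)
    have "g \<in> adjoin V J (var i)"
      using f' Suc.prems subset_adjoin[of J V "var i"] by (auto simp: nonzerodivisor_def)
    then obtain h j where h: "g = var i * h + j" "h \<in> polys V" "j \<in> J" by (auto simp: adjoin_def)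
    define h' j' where "h' = restr {m. 1 + tdeg m < Suc d} h" and "j' = below (Suc d) j"
    have "below (Suc d) g = g" using Suc.prems(3) unfolding below_def by (intro restr_id) auto
    moreover have "below (Suc d) g = var i * h' + j'"
      unfolding h(1) h'_def j'_def using below_mult[OF homogeneous_var, of "Suc d"]
      by (simp add: below_def restr_add)
    ultimately have g: "g = var i * h' + j'" by simp
    have h': "h' \<in> polys V" "j' \<in> J" "\<forall>m \<in> exps h'. tdeg m < d"
      using h J(2) by (auto simp: h'_def j'_def graded_def)
    have "var i * (f * h') = f * g - f * j'" by (simp add: g algebra_simps)
    also have "\<dots> \<in> J" using Suc.prems(2) *(4)[OF f h'(2)] by (rule *(7))
    finally have "f * h' \<in> J" using x f h'(1) by (simp add: nonzerodivisor_def)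
    then have "h' \<in> J" using Suc.IH h' by blast
    then show ?case unfolding g using h' i by (intro *(3) *(4)) simp_all
  qed
  moreover have "\<exists>d. \<forall>m \<in> exps g. tdeg m < d" for g :: "'a mpoly"
    using finite_nat_set_iff_bounded[of "tdeg ` exps g"] by simp
  ultimately show ?thesis unfolding nonzerodivisor_def by blast
qed

text \<open>
  The variable stays regular modulo the sequence, which is needed for the last elementary
  symmetric polynomial, the product of all the variables.
\<close>

lemma weakly_regular_lift:
  assumes i: "i \<in> V"
  shows "pideal V J \<Longrightarrow> graded J \<Longrightarrow> nonzerodivisor V J (var i) \<Longrightarrow>
    (\<And>f. f \<in> set fs \<Longrightarrow> f \<in> polys V \<and> (\<exists>k. homogeneous k f)) \<Longrightarrow>
    weakly_regular V (adjoin V J (var i)) fs \<Longrightarrow>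
    weakly_regular V J fs \<and> nonzerodivisor V (adjoin_list V J fs) (var i)"
proof (induction fs arbitrary: J)
  case (Cons f fs)
  note J = pidealD[OF Cons.prems(1)]
  obtain k where f: "f \<in> polys V" "homogeneous k f" using Cons.prems(4)[of f] by auto
  have f': "nonzerodivisor V (adjoin V J (var i)) f" using Cons.prems(5) by simp
  have nzd: "nonzerodivisor V J f"
    using nonzerodivisor_lift[OF Cons.prems(1,2) f(1) i Cons.prems(3) f'] .
  have x: "nonzerodivisor V (adjoin V J f) (var i)"
    unfolding nonzerodivisor_def
  proof (intro ballI impI)
    fix g assume g: "g \<in> polys V" "var i * g \<in> adjoin V J f"
    then obtain a b where ab: "var i * g = f * a + b" "a \<in> polys V" "b \<in> J" by (auto simp: adjoin_def)
    then have "f * a = var i * g + (- b)" by simp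
    then have "f * a \<in> adjoin V J (var i)"
      using g ab J(6) by (intro adjoinI[of g _ "- b"]) auto
    then have "a \<in> adjoin V J (var i)" using f' ab by (simp add: nonzerodivisor_def)
    then obtain h j where h: "a = var i * h + j" "h \<in> polys V" "j \<in> J" by (auto simp: adjoin_def)
    have "var i * (g - f * h) = f * j + b" using ab h by (simp add: algebra_simps)
    also have "\<dots> \<in> J" using h ab f by (intro J(3) J(4))
    finally have "g - f * h \<in> J" using Cons.prems(3) g h f by (auto simp: nonzerodivisor_def)
    then show "g \<in> adjoin V J f" using h by (intro adjoinI[of h _ "g - f * h"]) auto
  qed
  have "weakly_regular V (adjoin V (adjoin V J f) (var i)) fs"
    using Cons.prems(5) adjoin_commute[OF Cons.prems(1) f(1), of "var i"] i by simp
  then have "weakly_regular V (adjoin V J f) fs \<and>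
      nonzerodivisor V (adjoin_list V (adjoin V J f) fs) (var i)"
    using Cons.prems f x by (intro Cons.IH) (auto intro: pideal_adjoin graded_adjoin)
  then show ?case using nzd by simp
qed simp

definition esym :: "nat set \<Rightarrow> nat \<Rightarrow> 'k::field mpoly" where
  "esym V k = (\<Sum>F | F \<subseteq> V \<and> card F = k. \<Prod>j\<in>F. var j)"

text \<open>
  One sequence that serves all ideals at once: setting a variable to zero turns it into the
  sequence for the remaining variables. Over a finite field there may be too few linear forms
  for this purpose.
\<close>

definition esyms :: "nat set \<Rightarrow> nat \<Rightarrow> 'k::field mpoly list" where
  "esyms V r = map (esym V) [1..<Suc r]"

lemma esym_in_polys [simp]: "esym V k \<in> polys V"
  unfolding esym_def by (intro polys_sum polys_prod) auto

lemma set_esyms [simp]: "set (esyms V r) \<subseteq> polys V"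
  by (auto simp: esyms_def)

lemma length_esyms [simp]: "length (esyms V r) = r"
  by (simp add: esyms_def)

lemma homogeneous_esym: "finite V \<Longrightarrow> homogeneous k (esym V k)"
  unfolding esym_def by (intro homogeneous_sum) (auto intro: homogeneous_prod_var finite_subset)

lemma esyms_in_graded_max_ideal: "finite V \<Longrightarrow> set (esyms V r) \<subseteq> graded_max_ideal V"
  using homogeneous_esym[of V] by (fastforce simp: esyms_def mem_graded_max_ideal homogeneous_def)

lemma at0_prod: "at0 i (prod f A) = (\<Prod>a\<in>A. at0 i (f a))"
  by (induction A rule: infinite_finite_induct) auto

lemma at0_esym:
  assumes "finite V"
  shows "at0 i (esym V k :: 'k::field mpoly) = esym (V - {i}) k"
proof -
  have *: "at0 i (\<Prod>j\<in>F. var j :: 'k mpoly) = (if i \<in> F then 0 else \<Prod>j\<in>F. var j)" if "finite F" for F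
    using that by (auto simp: at0_prod intro!: prod_zero prod.cong)
  have "at0 i (esym V k :: 'k mpoly) = (\<Sum>F | F \<subseteq> V \<and> card F = k. if i \<in> F then 0 else \<Prod>j\<in>F. var j)"
    unfolding esym_def at0_sum using * assms by (intro sum.cong refl) (auto dest: finite_subset)
  also have "\<dots> = esym (V - {i}) k"
    unfolding esym_def using assms by (intro sum.mono_neutral_cong_right) auto
  finally show ?thesis .
qed

lemma map_at0_esyms: "finite V \<Longrightarrow> map (at0 i) (esyms V r) = esyms (V - {i}) r"
  by (simp add: esyms_def at0_esym)

lemma esym_card:
  assumes "finite V"
  shows "esym V (card V) = (\<Prod>j\<in>V. var j)"
proof -
  have "{F. F \<subseteq> V \<and> card F = card V} = {V}" by (auto dest: card_subset_eq[OF assms])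
  then show ?thesis by (simp add: esym_def)
qed

lemma esyms_Suc: "esyms V (Suc r) = esyms V r @ [esym V (Suc r)]"
  by (simp add: esyms_def)

lemma weakly_regular_esyms_mono:
  "r \<le> s \<Longrightarrow> weakly_regular V J (esyms V s) \<Longrightarrow> weakly_regular V J (esyms V r)"
  by (induction s rule: dec_induct) (auto simp: esyms_Suc weakly_regular_append)

text \<open>
  Induction on the number of variables: modulo any variable, all but the last polynomial are
  regular by the induction hypothesis. This lifts to the whole ring, and then every variable is
  regular modulo all but the last polynomial, hence so is the product of the variables.
\<close>

lemma weakly_regular_esyms_zero:
  "finite V \<Longrightarrow> weakly_regular V {0 :: 'k::field mpoly} (esyms V (card V))"
proof (induction "card V" arbitrary: V)
  case 0
  then show ?case by (simp add: esyms_def)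
next
  case (Suc n)
  have lift: "weakly_regular V {0 :: 'k mpoly} (esyms V n) \<and>
      nonzerodivisor V (adjoin_list V {0 :: 'k mpoly} (esyms V n)) (var i)" if i: "i \<in> V" for i
  proof (rule weakly_regular_lift[OF i pideal_zero])
    show "graded {0 :: 'k mpoly}" by (simp add: graded_def below_def)
    show "nonzerodivisor V {0 :: 'k mpoly} (var i)"
      by (simp add: nonzerodivisor_def)
    show "f \<in> polys V \<and> (\<exists>k. homogeneous k f)" if "f \<in> set (esyms V n)" for f :: "'k mpoly"
      using that homogeneous_esym[OF Suc.prems] by (auto simp: esyms_def)
    have "card (V - {i}) = n" using Suc i by simp
    then have "weakly_regular (V - {i}) {0 :: 'k mpoly} (esyms (V - {i}) n)"
      using Suc.hyps(1)[of "V - {i}"] Suc.prems by simp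
    then show "weakly_regular V (adjoin V {0 :: 'k mpoly} (var i)) (esyms V n)"
      unfolding adjoin_zero_var[OF i] using Suc.prems
      by (intro weakly_regular_at0_preimage pideal_zero) (auto simp: map_at0_esyms)
  qed
  obtain i where "i \<in> V" using Suc.hyps(2) by fastforce
  have "nonzerodivisor V (adjoin_list V {0 :: 'k mpoly} (esyms V n)) (\<Prod>j\<in>V. var j)"
    using lift by (intro nonzerodivisor_prod) auto
  also have "(\<Prod>j\<in>V. var j :: 'k mpoly) = esym V (Suc n)"
    unfolding Suc.hyps(2) by (rule esym_card[OF Suc.prems, symmetric])
  finally show ?case
    using lift[OF \<open>i \<in> V\<close>] Suc.hyps(2)[symmetric]
    by (simp add: esyms_Suc weakly_regular_append)
qed

text \<open>
  The factors of the filtration of \<open>K[V]/(u)\<close> given by the variables that divide the monomial \<open>u\<close>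
  are polynomial rings in one variable less.
\<close>

lemma weakly_regular_esyms_principal:
  fixes V :: "nat set"
  assumes V: "finite V" and r: "r < card V"
  shows "vars m \<subseteq> V \<Longrightarrow> weakly_regular V (adjoin V {0} (monom_poly m :: 'k::field mpoly)) (esyms V r)"
proof (induction "tdeg m" arbitrary: m)
  case 0
  have "m = 0"
  proof (rule ccontr)
    assume "m \<noteq> 0"
    then obtain i where "i \<in> vars m" by (metis keys_eq_empty ex_in_conv)
    with 0 show False by (auto simp: tdeg_def in_keys_iff)
  qed
  then have "adjoin V {0} (monom_poly m) = (polys V :: 'k mpoly set)" by (auto simp: adjoin_def)
  then show ?case by (simp add: weakly_regular_polys)
next
  case (Suc d)
  have "m \<noteq> 0" using Suc.hyps(2) by auto
  then obtain i where "i \<in> vars m" by (metis keys_eq_empty ex_in_conv)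
  then obtain m' where m: "m = Poly_Mapping.single i 1 + m'" using exp_divisible by blast
  have i: "i \<in> V" and m': "vars m' \<subseteq> V" "tdeg m' = d"
    using Suc.prems Suc.hyps(2) unfolding m by (auto simp: vars_add tdeg_add)
  have mon: "monom_poly m = (var i * monom_poly m' :: 'k mpoly)"
    by (simp add: m monom_poly_add var_def)
  let ?J = "adjoin V {0} (monom_poly m :: 'k mpoly)"
  have J: "pideal V ?J" using Suc.prems by (intro pideal_adjoin pideal_zero) simp
  have "colon (poly_ring V) ?J (var i) = adjoin V {0} (monom_poly m' :: 'k mpoly)"
    using m' by (auto simp: mem_colon adjoin_def mon mult.assoc)
  moreover have "adjoin V ?J (var i) = adjoin V {0} (var i)"
  proof
    have K: "pideal V (adjoin V {0} (var i :: 'k mpoly))" using i by (intro pideal_adjoin pideal_zero) simp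
    show "adjoin V ?J (var i) \<subseteq> adjoin V {0} (var i)"
    proof (intro adjoin_minimal K)
      show "monom_poly m \<in> adjoin V {0} (var i :: 'k mpoly)"
        unfolding mon using m' by (intro mult_in_adjoin) simp_all
    qed (use pidealD(2)[OF K] self_in_adjoin[of "{0}" "var i"] in auto)
    show "adjoin V {0} (var i) \<subseteq> adjoin V ?J (var i)"
      using pidealD(2)[OF J] by (intro adjoin_mono) simp
  qed
  moreover have "weakly_regular V (adjoin V {0} (var i :: 'k mpoly)) (esyms V r)"
    unfolding adjoin_zero_var[OF i]
  proof (intro weakly_regular_at0_preimage pideal_zero set_esyms)
    have "r \<le> card (V - {i})" using r i V by simp
    then show "weakly_regular (V - {i}) {0 :: 'k mpoly} (map (at0 i) (esyms V r))"
      unfolding map_at0_esyms[OF V]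
      by (rule weakly_regular_esyms_mono) (rule weakly_regular_esyms_zero, simp add: V)
  qed
  moreover have "weakly_regular V (adjoin V {0} (monom_poly m' :: 'k mpoly)) (esyms V r)"
    using Suc.hyps(1) m' by simp
  ultimately show ?case
    using i by (intro weakly_regular_middle[of "var i", OF _ J]) simp_all
qed

section \<open>Splitting off a variable\<close>

text \<open>
  The ideal \<open>x\<^sub>i I\<^sub>1 + I\<^sub>2\<close>, for \<open>I\<^sub>2 \<subseteq> I\<^sub>1\<close>, described by a membership test that separates the
  two summands.
\<close>

definition split_ideal :: "nat set \<Rightarrow> nat \<Rightarrow> 'k::field mpoly set \<Rightarrow> 'k mpoly set \<Rightarrow> 'k mpoly set" where
  "split_ideal V i I1 I2 = {p \<in> polys V. at0 i p \<in> I2 \<and> quo i p \<in> I1}"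

text \<open>
  The contractions on Koszul homology are dual to the linear part of the minimal free resolution
  of \<open>J\<close>; the property below holds when that linear part is acyclic, that is, for componentwise
  linear ideals.
\<close>

definition contractions_detect :: "nat set \<Rightarrow> 'k::field mpoly set \<Rightarrow> bool" where
  "contractions_detect V J \<longleftrightarrow> (\<forall>q. \<forall>z \<in> koszul_chains V (Suc (Suc q)). koszul V z \<in> coefs_in J \<longrightarrow>
     (\<forall>j \<in> V. boundary V J (Suc q) (contract j z)) \<longrightarrow> boundary V J (Suc (Suc q)) z)"

locale splitting =
  fixes V :: "nat set" and i :: nat and I1 I2 :: "'k::field mpoly set"
  assumes finite_V: "finite V" and i_in_V: "i \<in> V"
    and I1: "pideal V I1" and I2: "pideal (V - {i}) I2" and I2_subset_I1: "I2 \<subseteq> I1"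
begin

abbreviation I :: "'k mpoly set" where "I \<equiv> split_ideal V i I1 I2"
abbreviation W :: "nat set" where "W \<equiv> V - {i}"

lemma finite_W: "finite W" using finite_V by simp

lemma polys_W: "p \<in> polys W \<Longrightarrow> p \<in> polys V"
  using polys_mono[of W V] by blast

lemma at0_W: "p \<in> polys W \<Longrightarrow> at0 i p = p"
  by (rule at0_free) auto

lemma pideal_I: "pideal V I"
proof -
  have "at0 i x * quo i y + quo i x * at0 i y + var i * quo i x * quo i y \<in> I1"
    if "x \<in> polys V" "y \<in> I" for x y
  proof -
    have "at0 i y \<in> I1" "quo i y \<in> I1" using that I2_subset_I1 by (auto simp: split_ideal_def)
    then show ?thesis
      using that i_in_V by (intro pidealD(3)[OF I1] pidealD(4)[OF I1]) auto
  qed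
  then show ?thesis
    unfolding pideal_def[of V I] using pidealD[OF I2] pidealD[OF I1]
    by (auto simp: split_ideal_def quo_mult)
qed

lemma I2_subset_I: "I2 \<subseteq> I"
proof
  fix p assume p: "p \<in> I2"
  then have "p \<in> polys W" using pidealD(1)[OF I2] by blast
  then show "p \<in> I" using p at0_W[of p] quo_free[of i p] pidealD(2)[OF I1]
    by (simp add: split_ideal_def polys_W)
qed

lemma var_mult_in_I: "p \<in> polys V \<Longrightarrow> var i * p \<in> I \<longleftrightarrow> p \<in> I1"
  using i_in_V pidealD(2)[OF I2] by (auto simp: split_ideal_def)

lemma colon_I: "colon (poly_ring V) I (var i) = I1"
  using pidealD(1)[OF I1] by (auto simp: mem_colon var_mult_in_I)

lemma adjoin_I: "adjoin V I (var i) = at0_preimage V i I2"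
proof
  show "adjoin V I (var i) \<subseteq> at0_preimage V i I2"
    using i_in_V by (auto simp: adjoin_def at0_preimage_def split_ideal_def)
  show "at0_preimage V i I2 \<subseteq> adjoin V I (var i)"
  proof
    fix p assume p: "p \<in> at0_preimage V i I2"
    then have "at0 i p \<in> I" using I2_subset_I by (auto simp: at0_preimage_def)
    then show "p \<in> adjoin V I (var i)"
      using p at0_plus_quo[of i p]
      by (intro adjoinI[of "quo i p" _ "at0 i p"]) (auto simp: at0_preimage_def add.commute)
  qed
qed

subsection \<open>Chains at \<open>x\<^sub>i = 0\<close>\<close>

text \<open>
  The slice is the component without \<open>e\<^sub>i\<close> at \<open>x\<^sub>i = 0\<close>. It is a chain map to the Koszul complex of
  the smaller ring.
\<close>

definition slice :: "(nat set \<Rightarrow> 'k mpoly) \<Rightarrow> nat set \<Rightarrow> 'k mpoly" where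
  "slice z = (\<lambda>F. if i \<in> F then 0 else at0 i (z F))"

definition divided :: "(nat set \<Rightarrow> 'k mpoly) \<Rightarrow> nat set \<Rightarrow> 'k mpoly" where
  "divided z = (\<lambda>F. quo i (z F))"

lemma chains_W: "z \<in> koszul_chains W q \<Longrightarrow> z \<in> koszul_chains V q"
  by (rule chainsI) (auto intro: polys_W chains_eq_0)

lemma chains_slice:
  assumes "z \<in> koszul_chains V q"
  shows "slice z \<in> koszul_chains W q"
proof (rule chainsI)
  fix F
  show "slice z F \<in> polys W" using assms by (simp add: slice_def)
  have "z F = 0" if "i \<notin> F" "\<not> (F \<subseteq> W \<and> card F = q)"
    using that by (intro chains_eq_0[OF assms]) auto
  then show "\<not> F \<subseteq> W \<Longrightarrow> slice z F = 0" "card F \<noteq> q \<Longrightarrow> slice z F = 0"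
    by (auto simp: slice_def)
qed

lemma chains_divided: "z \<in> koszul_chains V q \<Longrightarrow> divided z \<in> koszul_chains V q"
  by (rule chainsI) (auto simp: divided_def chains_eq_0)

lemma slice_id:
  assumes "z \<in> koszul_chains W q"
  shows "slice z = z"
proof
  fix F
  have "i \<in> F \<Longrightarrow> z F = 0" by (rule chains_eq_0[OF assms]) auto
  then show "slice z F = z F" using assms at0_W[OF chains_coef[OF assms]] by (simp add: slice_def)
qed

lemma slice_linear [simp]:
  "slice (a + b) = slice a + slice b" "slice (a - b) = slice a - slice b"
  "slice (- a) = - slice a" "slice (smul (var i) a) = 0"
  by (auto simp: slice_def fun_eq_iff smul_def)

lemma at0_sign: "at0 i (sign j G) = (sign j G :: 'k mpoly)"
  by (rule at0_free[of _ "{}"]) auto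

lemma slice_contract:
  assumes "j \<noteq> i"
  shows "slice (contract j z) = contract j (slice z)"
  using assms by (auto simp: slice_def contract_def fun_eq_iff at0_sign)

lemma koszul_W:
  assumes "z \<in> koszul_chains W q"
  shows "koszul V z = koszul W z" and "contract i z = 0"
proof -
  show c: "contract i z = 0"
    using chains_eq_0[OF assms] by (auto simp: contract_def fun_eq_iff)
  show "koszul V z = koszul W z"
    unfolding koszul_def using finite_V i_in_V c by (simp add: sum.remove[of V i])
qed

lemma koszul_split: "koszul V z = smul (var i) (contract i z) + koszul W z"
  unfolding koszul_def using finite_V i_in_V by (simp add: sum.remove[of V i])

lemma slice_koszul: "slice (koszul V z) = koszul W (slice z)"
proof -
  have "slice (koszul W z) = koszul W (slice z)"
  proof
    fix G
    show "slice (koszul W z) G = koszul W (slice z) G"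
    proof (cases "i \<in> G")
      case True
      then show ?thesis by (simp add: slice_def koszul_apply contract_def cong: if_cong)
    next
      case False
      have "slice (koszul W z) G = (\<Sum>j\<in>W. at0 i (var j) * slice (contract j z) G)"
        using False by (simp add: slice_def koszul_apply at0_sum)
      also have "\<dots> = (\<Sum>j\<in>W. var j * contract j (slice z) G)"
        by (rule sum.cong) (auto simp: slice_contract)
      finally show ?thesis by (simp add: koszul_apply)
    qed
  qed
  then show ?thesis by (simp add: koszul_split)
qed

lemma coefs_in_slice: "z \<in> coefs_in I \<Longrightarrow> slice z \<in> coefs_in I2"
  using pidealD(2)[OF I2] by (auto simp: coefs_in_def slice_def split_ideal_def)

lemma coefs_in_divided: "z \<in> coefs_in I \<Longrightarrow> divided z \<in> coefs_in I1"
  by (auto simp: coefs_in_def divided_def split_ideal_def)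

lemma coefs_in_I2_I: "z \<in> coefs_in I2 \<Longrightarrow> z \<in> coefs_in I"
  using coefs_in_mono[OF I2_subset_I] by blast

lemma coefs_in_I2_I1: "z \<in> coefs_in I2 \<Longrightarrow> z \<in> coefs_in I1"
  using coefs_in_mono[OF I2_subset_I1] by blast

lemma smul_var_in_I: "z \<in> coefs_in I1 \<Longrightarrow> smul (var i) z \<in> coefs_in I"
  using var_mult_in_I pidealD(1)[OF I1] by (auto simp: coefs_in_def smul_def)

lemma boundary_slice: "boundary V I q z \<Longrightarrow> boundary W I2 q (slice z)"
proof -
  assume "boundary V I q z"
  then obtain w where w: "w \<in> koszul_chains V (Suc q)" "z - koszul V w \<in> coefs_in I"
    by (auto simp: boundary_def)
  have "slice (z - koszul V w) \<in> coefs_in I2" by (rule coefs_in_slice[OF w(2)])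
  then have "slice z - koszul W (slice w) \<in> coefs_in I2" by (simp only: slice_linear slice_koszul)
  then show ?thesis unfolding boundary_def using chains_slice[OF w(1)] by blast
qed

lemma boundary_smul_var: "boundary V I1 q z \<Longrightarrow> boundary V I q (smul (var i) z)"
proof -
  assume "boundary V I1 q z"
  then obtain w where w: "w \<in> koszul_chains V (Suc q)" "z - koszul V w \<in> coefs_in I1"
    by (auto simp: boundary_def)
  have "smul (var i) (z - koszul V w) \<in> coefs_in I" by (rule smul_var_in_I[OF w(2)])
  then have "smul (var i) z - koszul V (smul (var i) w) \<in> coefs_in I" by simp
  then show ?thesis unfolding boundary_def using w(1) i_in_V
    by (intro bexI[of _ "smul (var i) w"]) auto
qed

lemma at0_plus_divided: "z = (\<lambda>F. at0 i (z F)) + smul (var i) (divided z)"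
  by (rule ext) (simp add: smul_def divided_def at0_plus_quo)

lemma quo_var: "j \<noteq> i \<Longrightarrow> quo i (var j * p) = var j * quo i (p :: 'k mpoly)"
  using quo_free[of i "var j :: 'k mpoly"] by (simp add: quo_mult)

lemma quo_sign: "quo i (sign j G * p) = sign j G * quo i (p :: 'k mpoly)"
  using quo_free[OF at0_sign[of j G]] by (simp add: quo_mult at0_sign)

lemma divided_contract: "divided (contract j z) = contract j (divided z)"
  by (auto simp: divided_def contract_def fun_eq_iff quo_sign)

lemma quo_sum: "quo i (sum f A) = (\<Sum>a\<in>A. quo i (f a))"
  by (induction A rule: infinite_finite_induct) auto

text \<open>
  Division by \<open>x\<^sub>i\<close> is not a chain map: in \<open>x\<^sub>i \<iota>\<^sub>i z\<close> it also releases the part of \<open>\<iota>\<^sub>i z\<close> that is not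
  divisible by \<open>x\<^sub>i\<close>, which is the slice.
\<close>

lemma divided_koszul: "divided (koszul V z) = koszul V (divided z) + slice (contract i z)"
proof
  fix G
  have "quo i (contract j z G) = contract j (divided z) G" for j
    using fun_cong[OF divided_contract[of j z], of G] by (simp only: divided_def[of "contract j z"])
  then have "quo i (koszul W z G) = koszul W (divided z) G"
    unfolding koszul_apply quo_sum by (intro sum.cong) (simp_all add: quo_var)
  then have "divided (koszul V z) G = contract i z G + koszul W (divided z) G"
    by (simp add: koszul_split divided_def smul_def)
  moreover have "contract i z G = slice (contract i z) G + var i * contract i (divided z) G"
  proof (cases "i \<in> G")
    case False
    then show ?thesis
      using at0_plus_quo[of i "contract i z G"] fun_cong[OF divided_contract, of i z G]
      by (simp add: slice_def divided_def)
  qed (simp add: slice_def contract_def)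
  ultimately show "divided (koszul V z) G = (koszul V (divided z) + slice (contract i z)) G"
    by (simp add: koszul_split[of "divided z"] smul_def)
qed

end

subsection \<open>The long exact homology sequence falls apart\<close>

text \<open>
  Besides the minimality condition, the locale assumes of \<open>I\<^sub>1\<close> the property that is passed on to
  \<open>I\<close> in the induction over vertex splittings. Exactness of the Koszul complex of \<open>K[V]\<close> in degree
  \<open>1\<close> starts the comparison.
\<close>

locale minimal_splitting = splitting V i I1 I2
  for V i and I1 I2 :: "'k::field mpoly set" +
  assumes I2_times_max: "I2 \<subseteq> times_max V I1"
    and acyclic_1: "acyclic_at V {0 :: 'k mpoly} 1"
    and detect_I1: "contractions_detect V I1"
begin

text \<open>
  The map from the homology of \<open>K[W]/I\<^sub>2\<close> to that of \<open>K[V]/I\<^sub>1\<close> is zero in positive degrees. In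
  degree \<open>1\<close> this is where \<open>I\<^sub>2 \<subseteq> \<mm> I\<^sub>1\<close> enters; contractions reduce higher degrees to it.
\<close>

lemma comparison_zero:
  "z \<in> koszul_chains W (Suc q) \<Longrightarrow> koszul W z \<in> coefs_in I2 \<Longrightarrow> boundary V I1 (Suc q) z"
proof (induction q arbitrary: z)
  case 0
  then have z: "z \<in> koszul_chains V (Suc 0)" by (intro chains_W)
  have "koszul V z {} \<in> times_max V I1"
    unfolding koszul_W(1)[OF 0(1)] using 0 I2_times_max by (auto simp: coefs_in_def)
  then obtain y where y: "koszul V z {} = (\<Sum>j\<in>V. var j * y j)" "\<And>j. j \<in> V \<Longrightarrow> y j \<in> I1"
    by (auto simp: times_max_def)
  \<comment> \<open>a chain over \<open>I\<^sub>1\<close> with the same boundary as \<open>z\<close>\<close>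
  define c where "c F = (\<Sum>j\<in>V. if F = {j} then y j else 0)" for F
  have c_single: "c {j} = y j" if "j \<in> V" for j
    using that finite_V by (simp add: c_def)
  have cI: "c \<in> coefs_in I1"
    unfolding coefs_in_def c_def using y(2) pidealD(2)[OF I1]
    by (auto intro!: pideal_sum[OF I1])
  have c: "c \<in> koszul_chains V (Suc 0)"
  proof (rule chainsI)
    show "c F \<in> polys V" for F using cI pidealD(1)[OF I1] by (auto simp: coefs_in_def)
    show "c F = 0" if "\<not> F \<subseteq> V" for F
      unfolding c_def using that by (intro sum.neutral) auto
    show "c F = 0" if "card F \<noteq> Suc 0" for F
      unfolding c_def using that by (intro sum.neutral) auto
  qed
  have "koszul V (z - c) = 0"
  proof
    fix G
    show "koszul V (z - c) G = 0 G"
    proof (cases "G = {}")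
      case True
      have "koszul V c {} = koszul V z {}"
        unfolding y(1) koszul_apply[of V c]
        by (rule sum.cong) (auto simp: contract_def sign_def c_single)
      then show ?thesis using True by simp
    next
      case False
      have ch: "koszul V (z - c) \<in> koszul_chains V 0" using z c finite_V by (intro chains_koszul) auto
      have "koszul V (z - c) G = 0"
        by (rule chains_eq_0[OF ch]) (use False finite_subset[OF _ finite_V, of G] in auto)
      then show ?thesis by simp
    qed
  qed
  then have "koszul V (z - c) \<in> coefs_in {0}" by (simp only:) (simp add: coefs_in_def)
  then have "boundary V {0} (Suc 0) (z - c)"
    using acyclic_1 chains_closed(3)[OF z c] unfolding acyclic_at_def One_nat_def by blast
  then have "boundary V I1 (Suc 0) (z - c)"
    using pidealD(2)[OF I1] by (intro boundary_mono[of "{0}" I1]) simp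
  then show ?case by (rule boundary_cong[OF I1, rotated]) (use cI in simp)
next
  case (Suc q)
  have "boundary V I1 (Suc q) (contract j z)" for j
  proof (cases "j = i")
    case True
    then show ?thesis
      using koszul_W(2)[OF Suc.prems(1)] coefs_in_closed(1)[OF I1]
      by (intro boundary_of_coefs_in[OF I1]) simp
  next
    case False
    have "koszul W (contract j z) = - contract j (koszul W z)" by (simp add: contract_koszul)
    then have "koszul W (contract j z) \<in> coefs_in I2"
      using Suc.prems(2) by (simp add: coefs_in_closed[OF I2])
    moreover have "contract j z \<in> koszul_chains W (Suc q)"
      using Suc.prems(1) finite_W by (rule_tac chains_contract)
    ultimately show ?thesis by (intro Suc.IH)
  qed
  moreover have "koszul V z \<in> coefs_in I1"
    using Suc.prems koszul_W(1) coefs_in_I2_I1 by metis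
  ultimately show ?case
    using detect_I1 chains_W[OF Suc.prems(1)] by (simp add: contractions_detect_def)
qed

text \<open>
  Consequently multiplication by \<open>x\<^sub>i\<close> embeds the homology of \<open>K[V]/I\<^sub>1\<close> into that of \<open>K[V]/I\<close>: if
  \<open>x\<^sub>i z\<close> is the boundary of \<open>w\<close> modulo \<open>I\<close>, then division by \<open>x\<^sub>i\<close> shows that \<open>z\<close> is homologous to
  the slice of \<open>\<iota>\<^sub>i w\<close>, to which the comparison applies.
\<close>

lemma boundary_var_cancel:
  assumes z: "z \<in> koszul_chains V (Suc q)" and b: "boundary V I (Suc q) (smul (var i) z)"
  shows "boundary V I1 (Suc q) z"
proof -
  obtain w where w: "w \<in> koszul_chains V (Suc (Suc q))" "smul (var i) z - koszul V w \<in> coefs_in I"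
    using b by (auto simp: boundary_def)
  define t where "t = smul (var i) z - koszul V w"
  have t: "t \<in> coefs_in I" using w(2) by (simp add: t_def)
  define b0 where "b0 = slice (contract i w)"
  have b0: "b0 \<in> koszul_chains W (Suc q)"
    unfolding b0_def using w(1) finite_V by (intro chains_slice chains_contract)
  have "koszul W b0 = slice (contract i t)"
    unfolding b0_def t_def slice_koszul[symmetric] by (simp add: contract_koszul)
  then have "koszul W b0 \<in> coefs_in I2"
    using coefs_in_slice coefs_in_closed(6)[OF pideal_I t] by metis
  then have "boundary V I1 (Suc q) b0" by (rule comparison_zero[OF b0])
  then have "boundary V I1 (Suc q) (koszul V (divided w) + b0)"
    using w(1) by (intro boundary_add[OF I1] boundary_koszul[OF I1] chains_divided)
  moreover have "z - (koszul V (divided w) + b0) = divided t"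
  proof -
    have "divided t = divided (smul (var i) z) - divided (koszul V w)"
      by (simp add: t_def divided_def fun_eq_iff)
    also have "divided (smul (var i) z) = z" by (simp add: divided_def smul_def)
    finally show ?thesis by (simp only: divided_koszul b0_def)
  qed
  ultimately show ?thesis
    using boundary_cong[OF I1] coefs_in_divided[OF t] by metis
qed

lemma acyclic_I1:
  assumes "acyclic_at V I (Suc q)"
  shows "acyclic_at V I1 (Suc q)"
  unfolding acyclic_at_def
proof (intro ballI impI)
  fix z assume z: "z \<in> koszul_chains V (Suc q)" "koszul V z \<in> coefs_in I1"
  have "koszul V (smul (var i) z) \<in> coefs_in I" using smul_var_in_I[OF z(2)] by simp
  then have "boundary V I (Suc q) (smul (var i) z)"
    using assms z(1) i_in_V by (auto simp: acyclic_at_def)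
  then show "boundary V I1 (Suc q) z" by (rule boundary_var_cancel[OF z(1)])
qed

text \<open>
  A cycle \<open>z\<close> over the smaller ring becomes a boundary \<open>\<partial>w\<close> modulo \<open>I\<^sub>1\<close>, so that
  \<open>e\<^sub>i \<and> z - x\<^sub>i w\<close> is a cycle modulo \<open>I\<close> whose contraction at \<open>x\<^sub>i = 0\<close> gives \<open>z\<close> back.
\<close>

lemma acyclic_I2:
  assumes "acyclic_at V I (Suc (Suc q))"
  shows "acyclic_at W I2 (Suc q)"
  unfolding acyclic_at_def
proof (intro ballI impI)
  fix z assume z: "z \<in> koszul_chains W (Suc q)" "koszul W z \<in> coefs_in I2"
  have zV: "z \<in> koszul_chains V (Suc q)" by (rule chains_W[OF z(1)])
  obtain w where w: "w \<in> koszul_chains V (Suc (Suc q))" "z - koszul V w \<in> coefs_in I1"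
    using comparison_zero[OF z] by (auto simp: boundary_def)
  define c where "c = wedge i z - smul (var i) w"
  have c: "c \<in> koszul_chains V (Suc (Suc q))" unfolding c_def using w(1) zV finite_V i_in_V by auto
  have "koszul V c = smul (var i) (z - koszul V w) - wedge i (koszul W z)"
    unfolding c_def using koszul_wedge[OF finite_V i_in_V, of z] koszul_W(1)[OF z(1)]
    by (simp add: algebra_simps)
  also have "\<dots> \<in> coefs_in I"
    by (rule coefs_in_closed(3)[OF pideal_I smul_var_in_I[OF w(2)]])
      (rule coefs_in_closed(7)[OF pideal_I coefs_in_I2_I[OF z(2)]])
  finally obtain v where v: "v \<in> koszul_chains V (Suc (Suc (Suc q)))" "c - koszul V v \<in> coefs_in I"
    using assms c by (auto simp: acyclic_at_def boundary_def)
  have "contract i (wedge i z) = z"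
    using contract_wedge[of i i z] koszul_W(2)[OF z(1)] by simp
  then have "slice (contract i (c - koszul V v)) = z + slice (koszul V (contract i v))"
    unfolding c_def by (simp add: slice_id[OF z(1)] contract_koszul)
  also have "\<dots> = z - koszul W (- slice (contract i v))" by (simp add: slice_koszul)
  finally have "z - koszul W (- slice (contract i v)) \<in> coefs_in I2"
    using coefs_in_slice coefs_in_closed(6)[OF pideal_I v(2)] by metis
  moreover have "- slice (contract i v) \<in> koszul_chains W (Suc (Suc q))"
    using v(1) finite_V by (intro chains_closed chains_slice chains_contract)
  ultimately show "boundary W I2 (Suc q) z" unfolding boundary_def by blast
qed

text \<open>
  The homology of \<open>K[V]/(I\<^sub>2, x\<^sub>i)\<close> consists of the slice of a class and of the slice of its
  contraction at \<open>i\<close>. If all contractions of \<open>z\<close> are boundaries, then both can be removed by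
  changing \<open>z\<close> by boundaries, and what remains is \<open>x\<^sub>i\<close> times a class over \<open>I\<^sub>1\<close>.
\<close>

lemma contractions_detect_I:
  assumes detect_I2: "contractions_detect W I2"
  shows "contractions_detect V I"
  unfolding contractions_detect_def
proof (intro allI ballI impI)
  fix q z
  assume z: "z \<in> koszul_chains V (Suc (Suc q))" and cycle: "koszul V z \<in> coefs_in I"
    and contr: "\<forall>j\<in>V. boundary V I (Suc q) (contract j z)"
  have modify: "boundary V I (Suc q) (contract j (z' + koszul V u))"
    if "boundary V I (Suc q) (contract j z')" "u \<in> koszul_chains V (Suc (Suc (Suc q)))" for j z' u
  proof -
    have "contract j (z' + koszul V u) = contract j z' + koszul V (contract j (- u))"
      by (simp add: contract_koszul)
    moreover have "contract j (- u) \<in> koszul_chains V (Suc (Suc q))"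
      using that(2) finite_V by (intro chains_contract) auto
    ultimately show ?thesis
      using that(1) by (simp only: boundary_add[OF pideal_I] boundary_koszul[OF pideal_I])
  qed
  obtain w where w: "w \<in> koszul_chains V (Suc (Suc q))" "contract i z - koszul V w \<in> coefs_in I"
    using contr i_in_V by (auto simp: boundary_def)
  \<comment> \<open>first the contraction at \<open>i\<close> is moved into \<open>I\<^sub>2\<close> on the slice\<close>
  define \<beta> where "\<beta> = slice w"
  have \<beta>: "\<beta> \<in> koszul_chains W (Suc (Suc q))" unfolding \<beta>_def using w(1) by (rule chains_slice)
  define u where "u = wedge i \<beta>"
  have u: "u \<in> koszul_chains V (Suc (Suc (Suc q)))"
    unfolding u_def using finite_V i_in_V chains_W[OF \<beta>] by (rule chains_wedge)
  define z1 where "z1 = z + koszul V u"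
  have z1: "z1 \<in> koszul_chains V (Suc (Suc q))" unfolding z1_def using z u finite_V by auto
  have contr1: "boundary V I (Suc q) (contract j z1)" if "j \<in> V" for j
    unfolding z1_def using contr that u by (intro modify) auto
  have k1: "koszul V z1 = koszul V z" using finite_V by (simp add: z1_def)
  have slice1: "slice (contract i z1) \<in> coefs_in I2"
  proof -
    have "contract i u = \<beta>"
      using contract_wedge[of i i \<beta>] koszul_W(2)[OF \<beta>] by (simp add: u_def)
    then have "slice (contract i z1) = slice (contract i z) - koszul W (slice \<beta>)"
      by (simp add: z1_def contract_koszul slice_koszul)
    also have "\<dots> = slice (contract i z - koszul V w)"
      by (simp add: slice_koszul slice_id[OF \<beta>]) (simp add: \<beta>_def)
    finally show ?thesis using coefs_in_slice[OF w(2)] by simp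
  qed
  \<comment> \<open>then the slice itself, without disturbing the contraction at \<open>i\<close>\<close>
  define a where "a = slice z1"
  have a: "a \<in> koszul_chains W (Suc (Suc q))" unfolding a_def using z1 by (rule chains_slice)
  have "koszul W a \<in> coefs_in I2"
    unfolding a_def slice_koszul[symmetric] k1 by (rule coefs_in_slice[OF cycle])
  moreover have "boundary W I2 (Suc q) (contract j a)" if "j \<in> W" for j
    unfolding a_def using that boundary_slice[OF contr1[of j]] by (simp add: slice_contract)
  ultimately have "boundary W I2 (Suc (Suc q)) a"
    using detect_I2 a by (auto simp: contractions_detect_def)
  then obtain \<alpha> where \<alpha>: "\<alpha> \<in> koszul_chains W (Suc (Suc (Suc q)))" "a - koszul W \<alpha> \<in> coefs_in I2"
    by (auto simp: boundary_def)
  define z2 where "z2 = z1 + koszul V (- \<alpha>)"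
  have \<alpha>V: "- \<alpha> \<in> koszul_chains V (Suc (Suc (Suc q)))" using chains_W[OF \<alpha>(1)] by simp
  have z2: "z2 \<in> koszul_chains V (Suc (Suc q))"
    unfolding z2_def by (rule chains_closed(2)[OF z1 chains_koszul[OF finite_V \<alpha>V]])
  have contr2: "boundary V I (Suc q) (contract j z2)" if "j \<in> V" for j
    unfolding z2_def using contr1[OF that] \<alpha>V by (rule modify)
  have k2: "koszul V z2 = koszul V z"
    unfolding z2_def koszul_linear(1) koszul_koszul[OF finite_V] k1 by simp
  have s2: "slice z2 \<in> coefs_in I2"
    using \<alpha>(2) by (simp add: z2_def slice_koszul slice_id[OF \<alpha>(1)] a_def)
  have "contract i (koszul V (- \<alpha>)) = 0"
    using koszul_W(2)[OF \<alpha>(1)] by (simp add: contract_koszul)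
  then have sc2: "slice (contract i z2) \<in> coefs_in I2"
    unfolding z2_def contract_linear(1) using slice1 by simp
  have "at0 i (z2 F) \<in> I2" for F
  proof (cases "i \<in> F")
    case True
    then have "slice (contract i z2) (F - {i}) = sign i (F - {i}) * at0 i (z2 F)"
      by (simp add: slice_def contract_def at0_sign insert_absorb)
    then have "sign i (F - {i}) * slice (contract i z2) (F - {i}) = at0 i (z2 F)" by simp
    moreover have "slice (contract i z2) (F - {i}) \<in> I2" using sc2 by (simp add: coefs_in_def)
    ultimately show ?thesis using pidealD(4)[OF I2 sign_in_polys] by metis
  next
    case False
    then show ?thesis using s2 by (auto simp: coefs_in_def slice_def dest!: spec[of _ F])
  qed
  then have at0: "(\<lambda>F. at0 i (z2 F)) \<in> coefs_in I" by (intro coefs_in_I2_I) (simp add: coefs_in_def)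
  \<comment> \<open>modulo \<open>I\<close> only \<open>x\<^sub>i y\<close> is left\<close>
  define y where "y = divided z2"
  have y: "y \<in> koszul_chains V (Suc (Suc q))" unfolding y_def using z2 by (rule chains_divided)
  have z2y: "z2 - smul (var i) y \<in> coefs_in I"
    using at0 at0_plus_divided[of z2] unfolding y_def by (metis add_diff_cancel_right')
  have "koszul V z2 - koszul V (z2 - smul (var i) y) \<in> coefs_in I"
    using cycle coefs_in_koszul[OF pideal_I z2y] unfolding k2 by (rule coefs_in_closed(3)[OF pideal_I])
  then have "smul (var i) (koszul V y) \<in> coefs_in I" by simp
  then have ky: "koszul V y \<in> coefs_in I1"
    using var_mult_in_I chains_coef[OF chains_koszul[OF finite_V y]]
    by (simp add: coefs_in_def smul_def)
  have "boundary V I1 (Suc q) (contract j y)" if "j \<in> V" for j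
  proof (rule boundary_var_cancel)
    show "contract j y \<in> koszul_chains V (Suc q)" using finite_V y by (rule chains_contract)
    have "contract j (z2 - smul (var i) y) \<in> coefs_in I" by (rule coefs_in_closed(6)[OF pideal_I z2y])
    then have "- contract j (z2 - smul (var i) y) \<in> coefs_in I" by (rule coefs_in_closed(4)[OF pideal_I])
    then have "smul (var i) (contract j y) - contract j z2 \<in> coefs_in I" by simp
    then show "boundary V I (Suc q) (smul (var i) (contract j y))"
      using contr2[OF that] by (rule boundary_cong[OF pideal_I])
  qed
  then have "boundary V I1 (Suc (Suc q)) y"
    using detect_I1 y ky by (simp add: contractions_detect_def)
  then have "boundary V I (Suc (Suc q)) z2"
    by (intro boundary_cong[OF pideal_I z2y] boundary_smul_var)
  then have "boundary V I (Suc (Suc q)) (z2 + koszul V (\<alpha> - u))"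
    using u chains_W[OF \<alpha>(1)] by (intro boundary_add[OF pideal_I] boundary_koszul[OF pideal_I]) auto
  moreover have "z2 + koszul V (\<alpha> - u) = z" by (simp add: z2_def z1_def)
  ultimately show "boundary V I (Suc (Suc q)) z" by simp
qed

end

section \<open>Monomial ideals\<close>

definition monomial_closed :: "'k::field mpoly set \<Rightarrow> bool" where
  "monomial_closed J \<longleftrightarrow> (\<forall>p \<in> J. \<forall>m \<in> exps p. monom_poly m \<in> J)"

lemma tdeg_eq_0_iff [simp]: "tdeg m = 0 \<longleftrightarrow> m = 0"
proof
  assume "tdeg m = 0"
  then have "\<forall>i \<in> vars m. Poly_Mapping.lookup m i = 0" by (simp add: tdeg_def)
  then show "m = 0" by (metis in_keys_iff keys_eq_empty ex_in_conv)
qed simp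

lemma monomial_in_Idl:
  fixes A :: "'k::field mpoly set"
  assumes "A \<subseteq> monomials V" "p \<in> Idl\<^bsub>poly_ring V\<^esub> A" "m \<in> exps p"
  shows "\<exists>a b. monom_poly a \<in> A \<and> m = a + b"
proof -
  let ?K = "{p \<in> polys V. \<forall>m \<in> exps p. \<exists>a b. monom_poly a \<in> A \<and> m = a + b}"
  have "pideal V ?K"
    unfolding pideal_def
  proof (intro conjI ballI)
    show "x + y \<in> ?K" if "x \<in> ?K" "y \<in> ?K" for x y
      using that Poly_Mapping.keys_add[of x y] by blast
    show "x * y \<in> ?K" if xy: "x \<in> polys V" "y \<in> ?K" for x y
    proof -
      have "\<exists>a b. monom_poly a \<in> A \<and> m = a + b" if m: "m \<in> exps (x * y)" for m
      proof -
        obtain c d where cd: "m = c + d" "d \<in> exps y" using m keys_mult[of x y] by blast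
        then obtain a b where "monom_poly a \<in> A" "d = a + b" using xy by blast
        then show ?thesis using cd by (intro exI[of _ a] exI[of _ "b + c"]) (simp add: ac_simps)
      qed
      then show ?thesis using xy by auto
    qed
  qed auto
  moreover have "A \<subseteq> ?K"
  proof
    fix p assume p: "p \<in> A"
    then obtain a where "p = monom_poly a" "vars a \<subseteq> V" using assms(1) by (auto simp: monomials_def)
    moreover have "a = a + 0" by simp
    ultimately show "p \<in> ?K" using p by fastforce
  qed
  ultimately have "Idl\<^bsub>poly_ring V\<^esub> A \<subseteq> ?K" by (rule Idl_subset)
  then show ?thesis using assms(2,3) by blast
qed

lemma monomials_subset: "monomials V \<subseteq> polys V"
  by (auto simp: monomials_def)

definition minimal_exps :: "'k::field mpoly set \<Rightarrow> (nat \<Rightarrow>\<^sub>0 nat) set" where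
  "minimal_exps J = {m. monom_poly m \<in> J \<and> (\<forall>a b. m = a + b \<longrightarrow> monom_poly a \<in> J \<longrightarrow> b = 0)}"

lemma minimal_exp_divides:
  "monom_poly m \<in> J \<Longrightarrow> \<exists>a \<in> minimal_exps J. \<exists>b. m = a + b"
proof (induction "tdeg m" arbitrary: m rule: less_induct)
  case less
  show ?case
  proof (cases "m \<in> minimal_exps J")
    case True
    then show ?thesis by (intro bexI[of _ m] exI[of _ 0]) auto
  next
    case False
    then obtain a b where ab: "m = a + b" "monom_poly a \<in> J" "b \<noteq> 0"
      using less.prems by (auto simp: minimal_exps_def)
    then have "tdeg a < tdeg m" by (simp add: tdeg_add) (metis gr0I tdeg_eq_0_iff)
    then obtain a' b' where "a' \<in> minimal_exps J" "a = a' + b'" using less.hyps ab by blast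
    then show ?thesis using ab by (intro bexI[of _ a'] exI[of _ "b' + b"]) (auto simp: ac_simps)
  qed
qed

lemma pideal_monom_polyI:
  assumes J: "pideal V J" and "p \<in> polys V" "\<And>m. m \<in> exps p \<Longrightarrow> monom_poly m \<in> J"
  shows "p \<in> J"
  by (subst poly_as_sum) (intro pideal_sum[OF J] pidealD(4)[OF J] assms constant_in_polys)

text \<open>
  A monomial of the ideal generated by a set of monomials is divisible by one of these. So every
  generating set of monomials contains the minimal monomials of \<open>J\<close>, and these generate \<open>J\<close>.
\<close>

lemma min_gens_eq:
  fixes J :: "'k::field mpoly set"
  assumes J: "pideal V J" and mon: "monomial_closed J"
  shows "min_gens V J = monom_poly ` minimal_exps J"
proof -
  let ?M = "monom_poly ` minimal_exps J :: 'k mpoly set"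
  have MJ: "?M \<subseteq> J" by (auto simp: minimal_exps_def)
  have MV: "?M \<subseteq> monomials V"
    using MJ pidealD(1)[OF J] by (fastforce simp: monomials_def)
  have gen: "Idl\<^bsub>poly_ring V\<^esub> ?M = J"
  proof
    show "Idl\<^bsub>poly_ring V\<^esub> ?M \<subseteq> J" by (rule Idl_subset[OF J MJ])
    have M: "?M \<subseteq> polys V" using MJ pidealD(1)[OF J] by blast
    note I = pideal_Idl[OF M]
    show "J \<subseteq> Idl\<^bsub>poly_ring V\<^esub> ?M"
    proof
      fix p assume p: "p \<in> J"
      show "p \<in> Idl\<^bsub>poly_ring V\<^esub> ?M"
      proof (rule pideal_monom_polyI[OF I])
        show "p \<in> polys V" using p pidealD(1)[OF J] by blast
        fix m assume "m \<in> exps p"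
        then have m: "monom_poly m \<in> J" using p mon by (auto simp: monomial_closed_def)
        then obtain a b where ab: "a \<in> minimal_exps J" "m = a + b" using minimal_exp_divides by blast
        have "(monom_poly m :: 'k mpoly) \<in> polys V" using m pidealD(1)[OF J] by blast
        then have "(monom_poly b :: 'k mpoly) \<in> polys V" using ab by (simp add: vars_add)
        moreover have "monom_poly a \<in> Idl\<^bsub>poly_ring V\<^esub> ?M" using subset_Idl[OF M] ab by blast
        ultimately show "monom_poly m \<in> Idl\<^bsub>poly_ring V\<^esub> ?M"
          unfolding ab(2) monom_poly_add by (rule pidealD(5)[OF I])
      qed
    qed
  qed
  have below: "?M \<subseteq> G" if G: "G \<subseteq> monomials V" "Idl\<^bsub>poly_ring V\<^esub> G = J" for G
  proof
    fix u assume "u \<in> ?M"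
    then obtain m where m: "u = monom_poly m" "m \<in> minimal_exps J" by blast
    then have "u \<in> Idl\<^bsub>poly_ring V\<^esub> G" using G MJ by blast
    then obtain a b where ab: "monom_poly a \<in> G" "m = a + b"
      using monomial_in_Idl[OF G(1), of u m] m by auto
    have "monom_poly a \<in> J"
      using subset_Idl[of G V] G monomials_subset[of V] ab by blast
    then have "b = 0" using m ab by (auto simp: minimal_exps_def)
    then show "u \<in> G" using m ab by simp
  qed
  show ?thesis
    unfolding min_gens_def
  proof (rule the_equality)
    show "?M \<subseteq> monomials V \<and> Idl\<^bsub>poly_ring V\<^esub> ?M = J \<and>
        (\<forall>H. H \<subset> ?M \<longrightarrow> Idl\<^bsub>poly_ring V\<^esub> H \<noteq> J)"
      using MV gen below by blast
    show "G = ?M" if "G \<subseteq> monomials V \<and> Idl\<^bsub>poly_ring V\<^esub> G = J \<and>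
        (\<forall>H. H \<subset> G \<longrightarrow> Idl\<^bsub>poly_ring V\<^esub> H \<noteq> J)" for G
      using that below[of G] gen by blast
  qed
qed

subsection \<open>Koszul homology in degrees \<open>0\<close> and \<open>1\<close>\<close>

lemma pideal_graded_max_ideal: "pideal V (graded_max_ideal V)"
  unfolding graded_max_ideal_def by (rule pideal_Idl) auto

lemma var_in_graded_max_ideal: "j \<in> V \<Longrightarrow> var j \<in> graded_max_ideal V"
  unfolding graded_max_ideal_def using subset_Idl[of "var ` V" V] by fastforce

text \<open>The class of \<open>1\<close> in \<open>K[V]/(J + \<mm>)\<close> is not zero.\<close>

lemma not_acyclic_0:
  fixes J :: "'k::field mpoly set"
  assumes V: "finite V" and J: "pideal V J" "J \<subseteq> graded_max_ideal V"
  shows "\<not> acyclic_at V J 0"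
proof
  assume acyc: "acyclic_at V J 0"
  define z :: "nat set \<Rightarrow> 'k mpoly" where "z F = (if F = {} then 1 else 0)" for F
  have z: "z \<in> koszul_chains V 0"
    using V by (intro chainsI) (auto simp: z_def dest: finite_subset)
  have "koszul V z = 0"
    unfolding koszul_def using contract_chain_0[OF V z] by simp
  then have "koszul V z \<in> coefs_in J" using coefs_in_closed(1)[OF J(1)] by simp
  then obtain w where w: "w \<in> koszul_chains V (Suc 0)" "z - koszul V w \<in> coefs_in J"
    using acyc z by (auto simp: acyclic_at_def boundary_def)
  note m = pideal_graded_max_ideal[of V]
  have "koszul V w {} \<in> graded_max_ideal V"
    unfolding koszul_apply using w(1)
    by (intro pideal_sum[OF m] pidealD(5)[OF m]) (auto simp: contract_def var_in_graded_max_ideal)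
  moreover have "z {} - koszul V w {} \<in> graded_max_ideal V"
    using w(2) J(2) by (auto simp: coefs_in_def)
  ultimately have "(z {} - koszul V w {}) + koszul V w {} \<in> graded_max_ideal V"
    by (intro pidealD(3)[OF m])
  then show False by (simp add: z_def mem_graded_max_ideal)
qed

text \<open>A monomial of least degree in \<open>J\<close> is not in \<open>\<mm> J\<close> and so gives a class in degree \<open>1\<close>.\<close>

lemma not_acyclic_1:
  fixes J :: "'k::field mpoly set"
  assumes V: "finite V" and J: "pideal V J" "monomial_closed J" "J \<subseteq> graded_max_ideal V" "J \<noteq> {0}"
  shows "\<not> acyclic_at V J 1"
proof
  assume acyc: "acyclic_at V J 1"
  obtain p where "p \<in> J" "p \<noteq> 0" using J(4) pidealD(2)[OF J(1)] by blast
  then obtain m0 where "m0 \<in> exps p" by (metis keys_eq_empty ex_in_conv)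
  then have "monom_poly m0 \<in> J" using J(2) \<open>p \<in> J\<close> by (auto simp: monomial_closed_def)
  then obtain m where m: "monom_poly m \<in> J" "\<And>m'. monom_poly m' \<in> J \<Longrightarrow> tdeg m \<le> tdeg m'"
    using exists_least_iff[of "\<lambda>d. \<exists>m. monom_poly m \<in> J \<and> tdeg m = d"] by (metis not_le)
  have "m \<noteq> 0" using m(1) J(3) by (auto simp: mem_graded_max_ideal)
  then obtain i where "i \<in> vars m" by (metis keys_eq_empty ex_in_conv)
  then obtain m' where m': "m = Poly_Mapping.single i 1 + m'" using exp_divisible by blast
  have "(monom_poly m :: 'k mpoly) \<in> polys V" using m(1) pidealD(1)[OF J(1)] by blast
  then have "vars m \<subseteq> V" by simp
  then have i: "i \<in> V" "vars m' \<subseteq> V" unfolding m' by (auto simp: vars_add)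
  define z :: "nat set \<Rightarrow> 'k mpoly" where "z F = (if F = {i} then monom_poly m' else 0)" for F
  have z: "z \<in> koszul_chains V (Suc 0)"
    using i by (intro chainsI) (auto simp: z_def)
  have kz: "koszul V z \<in> koszul_chains V 0" using V z by (rule chains_koszul)
  have "koszul V z {} = (\<Sum>j\<in>V. if j = i then var i * monom_poly m' else 0)"
    unfolding koszul_apply by (rule sum.cong) (auto simp: contract_def z_def sign_def)
  then have top: "koszul V z {} = monom_poly m"
    using V i by (simp add: m' monom_poly_add var_def)
  have "koszul V z F \<in> J" for F
  proof (cases "F \<subseteq> V \<and> card F = 0")
    case True
    then have "F = {}" using V finite_subset by fastforce
    then show ?thesis using top m(1) by simp
  next
    case False
    then show ?thesis using chains_eq_0[OF kz] pidealD(2)[OF J(1)] by simp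
  qed
  then obtain w where w: "w \<in> koszul_chains V (Suc (Suc 0))" "z - koszul V w \<in> coefs_in J"
    using acyc z unfolding acyclic_at_def boundary_def coefs_in_def One_nat_def by blast
  have c: "contract j (z - koszul V w) {} \<in> J" for j
    using coefs_in_closed(6)[OF J(1) w(2), of j] by (simp add: coefs_in_def)
  have "koszul V (z - koszul V w) {} = monom_poly m"
    unfolding koszul_linear(2) koszul_koszul[OF V] using top by simp
  then have eq: "monom_poly m = (\<Sum>j\<in>V. var j * contract j (z - koszul V w) {})"
    by (simp only: koszul_apply)
  have "m \<in> exps (\<Sum>j\<in>V. var j * contract j (z - koszul V w) {})"
    unfolding eq[symmetric] by simp
  then obtain j where "j \<in> V" "m \<in> exps (var j * contract j (z - koszul V w) {})"
    using keys_sum[of "\<lambda>j. var j * contract j (z - koszul V w) {}" V] by blast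
  then obtain b where b: "m = Poly_Mapping.single j 1 + b" "b \<in> exps (contract j (z - koszul V w) {})"
    using keys_mult[of "var j"] by (auto simp: var_def)
  then have "monom_poly b \<in> J" using c J(2) unfolding monomial_closed_def by blast
  then have "tdeg m \<le> tdeg b" by (rule m(2))
  then show False unfolding b(1) by (simp add: tdeg_add)
qed

section \<open>Vertex splittable ideals\<close>

text \<open>
  The converse to the vanishing of Koszul homology caused by a regular sequence, with one and
  the same sequence for all ideals.
\<close>

definition esyms_optimal :: "nat set \<Rightarrow> 'k::field mpoly set \<Rightarrow> bool" where
  "esyms_optimal V J \<longleftrightarrow>
     (\<forall>r. (\<forall>q. card V < q + r \<longrightarrow> acyclic_at V J q) \<longrightarrow> weakly_regular V J (esyms V r))"

text \<open>
  The properties that are proved together by induction over the vertex splittings: the third one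
  makes the exact homology sequence fall apart, and the second and the third one serve the fourth.
\<close>

definition tame :: "nat set \<Rightarrow> 'k::field mpoly set \<Rightarrow> bool" where
  "tame V J \<longleftrightarrow> pideal V J \<and> monomial_closed J \<and> contractions_detect V J \<and> esyms_optimal V J"

lemma tame_zero:
  assumes V: "finite V"
  shows "acyclic_at V {0 :: 'k::field mpoly} (Suc q)" and "tame V {0 :: 'k mpoly}"
proof -
  show acyc: "acyclic_at V {0 :: 'k mpoly} (Suc q)" for q
    using V weakly_regular_esyms_zero[OF V, where ?'k = 'k] esyms_in_graded_max_ideal[OF V]
    by (intro acyclic_at_of_weakly_regular[OF V pideal_zero]) auto
  have "contractions_detect V {0 :: 'k mpoly}"
    using acyc by (auto simp: contractions_detect_def acyclic_at_def)
  moreover have "esyms_optimal V {0 :: 'k mpoly}"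
    unfolding esyms_optimal_def
  proof (intro allI impI)
    fix r assume *: "\<forall>q. card V < q + r \<longrightarrow> acyclic_at V {0 :: 'k mpoly} q"
    have "\<not> acyclic_at V {0 :: 'k mpoly} 0"
      using V pideal_zero pidealD(2)[OF pideal_graded_max_ideal] by (intro not_acyclic_0) auto
    then have "r \<le> card V" using *[rule_format, of 0] by (metis add_0 not_le)
    then show "weakly_regular V {0 :: 'k mpoly} (esyms V r)"
      by (rule weakly_regular_esyms_mono) (rule weakly_regular_esyms_zero[OF V])
  qed
  ultimately show "tame V {0 :: 'k mpoly}"
    by (simp add: tame_def pideal_zero monomial_closed_def)
qed

lemma tame_polys: "tame V (polys V :: 'k::field mpoly set)"
proof -
  have "contractions_detect V (polys V :: 'k mpoly set)"
    unfolding contractions_detect_def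
    by (intro allI ballI impI boundary_of_coefs_in[OF pideal_polys] chains_coefs_in)
  moreover have "monomial_closed (polys V :: 'k mpoly set)"
    by (auto simp: monomial_closed_def mem_polys[of _ V])
  ultimately show ?thesis
    by (simp add: tame_def pideal_polys esyms_optimal_def weakly_regular_polys)
qed

text \<open>
  For a monomial \<open>u \<noteq> 1\<close> and \<open>n = |V|\<close>, the sequence \<open>e\<^sub>1, \<dots>, e\<^sub>n\<^sub>-\<^sub>1\<close> is regular on \<open>K[V]/(u)\<close>, so homology is
  concentrated in degrees \<open>0\<close> and \<open>1\<close>; as it is not zero in degree \<open>1\<close>, no longer sequence
  has to be considered.
\<close>

lemma tame_principal:
  assumes V: "finite V" and m: "vars m \<subseteq> V"
  shows "tame V (Idl\<^bsub>poly_ring V\<^esub> {monom_poly m :: 'k::field mpoly})"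
proof -
  let ?J = "adjoin V {0} (monom_poly m :: 'k mpoly)"
  have J: "pideal V ?J" using m by (intro pideal_adjoin pideal_zero) simp
  have Idl: "Idl\<^bsub>poly_ring V\<^esub> {monom_poly m :: 'k mpoly} = ?J"
  proof
    have K: "pideal V (Idl\<^bsub>poly_ring V\<^esub> {monom_poly m :: 'k mpoly})"
      using m by (intro pideal_Idl) simp
    show "Idl\<^bsub>poly_ring V\<^esub> {monom_poly m :: 'k mpoly} \<subseteq> ?J"
      by (intro Idl_subset[OF J]) (simp add: self_in_adjoin)
    show "?J \<subseteq> Idl\<^bsub>poly_ring V\<^esub> {monom_poly m :: 'k mpoly}"
      using subset_Idl[of "{monom_poly m}" V] m pidealD(2)[OF K] by (intro adjoin_minimal[OF K]) auto
  qed
  show ?thesis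
  proof (cases "m = 0")
    case True
    then have "?J = polys V" by (auto simp: adjoin_def)
    then show ?thesis using tame_polys Idl by metis
  next
    case False
    have div: "\<exists>b. k = m + b \<and> vars b \<subseteq> V" if pk: "p \<in> ?J" "k \<in> exps p" for p k
    proof -
      obtain x where x: "p = monom_poly m * x" "x \<in> polys V" using pk(1) by (auto simp: adjoin_def)
      then obtain b where "k = m + b" "b \<in> exps x" using keys_mult[of "monom_poly m" x] pk(2) by auto
      then show ?thesis using x(2) by (auto simp: mem_polys)
    qed
    have mon: "monomial_closed ?J"
      unfolding monomial_closed_def
    proof (intro ballI)
      fix p k assume "p \<in> ?J" "k \<in> exps p"
      then obtain b where "k = m + b" "vars b \<subseteq> V" using div by blast
      then show "monom_poly k \<in> ?J" by (simp add: monom_poly_add mult_in_adjoin)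
    qed
    have max: "?J \<subseteq> graded_max_ideal V"
    proof
      fix p assume p: "p \<in> ?J"
      have "0 \<notin> exps p"
      proof
        assume "0 \<in> exps p"
        then obtain b where "0 = m + b" using div p by blast
        then have "tdeg m + tdeg b = 0" by (metis tdeg_add tdeg_zero)
        then show False using False by simp
      qed
      then show "p \<in> graded_max_ideal V" using p pidealD(1)[OF J] by (auto simp: mem_graded_max_ideal)
    qed
    have nonzero: "?J \<noteq> {0}" using self_in_adjoin[of "{0}" "monom_poly m :: 'k mpoly" V] by auto
    have "vars m \<noteq> {}" using False by simp
    then have card: "0 < card V" using m V card_gt_0_iff by blast
    have "weakly_regular V ?J (esyms V (card V - 1))"
      using card m by (intro weakly_regular_esyms_principal[OF V]) auto
    then have "acyclic_at V ?J (Suc (Suc q))" for q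
      by (rule acyclic_at_of_weakly_regular[OF V J esyms_in_graded_max_ideal[OF V]]) (use card in simp)
    then have "contractions_detect V ?J" by (auto simp: contractions_detect_def acyclic_at_def)
    moreover have "esyms_optimal V ?J"
      unfolding esyms_optimal_def
    proof (intro allI impI)
      fix r assume *: "\<forall>q. card V < q + r \<longrightarrow> acyclic_at V ?J q"
      have "r < card V"
        using not_acyclic_1[OF V J mon max nonzero] not_acyclic_0[OF V J max]
          *[rule_format, of 1] *[rule_format, of 0] by linarith
      then show "weakly_regular V ?J (esyms V r)" by (rule weakly_regular_esyms_principal[OF V _ m])
    qed
    ultimately show ?thesis unfolding Idl using J mon by (simp add: tame_def)
  qed
qed

context splitting
begin

lemma monomial_closed_I:
  assumes "monomial_closed I1" "monomial_closed I2"
  shows "monomial_closed I"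
  unfolding monomial_closed_def
proof (intro ballI)
  fix p m assume p: "p \<in> I" and m: "m \<in> exps p"
  show "monom_poly m \<in> I"
  proof (cases "i \<in> vars m")
    case True
    then obtain m' where m': "m = Poly_Mapping.single i 1 + m'" using exp_divisible by blast
    have "m' \<in> exps (quo i p)" using m unfolding m' by (simp add: in_keys_iff coef_quo)
    then have "monom_poly m' \<in> I1" using p assms(1) by (auto simp: monomial_closed_def split_ideal_def)
    then show ?thesis
      unfolding m' monom_poly_add using var_mult_in_I pidealD(1)[OF I1] by (auto simp: var_def)
  next
    case False
    then have "m \<in> exps (at0 i p)" using m by (simp add: in_keys_iff coef_at0)
    then have "monom_poly m \<in> I2" using p assms(2) by (auto simp: monomial_closed_def split_ideal_def)
    then show ?thesis using I2_subset_I by blast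
  qed
qed

end

context minimal_splitting
begin

text \<open>
  Vanishing for \<open>I\<close> passes to \<open>I\<^sub>1\<close> in the same degrees and to \<open>I\<^sub>2\<close> with a shift by one, which
  is made up for by the smaller number of variables. Degrees below \<open>2\<close> are excluded by
  \<open>r < card V\<close>.
\<close>

lemma weakly_regular_parts:
  assumes "\<And>q. card V < q + r \<Longrightarrow> acyclic_at V I q" "r < card V"
    and "esyms_optimal V I1" "esyms_optimal W I2"
  shows "weakly_regular V I1 (esyms V r)" and "weakly_regular V (adjoin V I (var i)) (esyms V r)"
proof -
  have "acyclic_at V I1 q" if q: "card V < q + r" for q
  proof -
    obtain p where "q = Suc p" using assms(2) q by (cases q) auto
    then show ?thesis using assms(1)[OF q] acyclic_I1 by simp
  qed
  then show "weakly_regular V I1 (esyms V r)" using assms(3) by (simp add: esyms_optimal_def)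
  have "acyclic_at W I2 q" if "card W < q + r" for q
  proof -
    have *: "card V < Suc q + r" using that finite_V i_in_V by (simp add: card_Diff_singleton)
    then obtain p where "q = Suc p" using assms(2) by (cases q) auto
    then show ?thesis using assms(1)[OF *] acyclic_I2 by simp
  qed
  then have "weakly_regular W I2 (esyms W r)" using assms(4) by (simp add: esyms_optimal_def)
  then show "weakly_regular V (adjoin V I (var i)) (esyms V r)"
    unfolding adjoin_I using finite_V
    by (intro weakly_regular_at0_preimage[OF I2]) (simp_all add: map_at0_esyms)
qed

lemma weakly_regular_I:
  "weakly_regular V I1 fs \<Longrightarrow> weakly_regular V (adjoin V I (var i)) fs \<Longrightarrow> set fs \<subseteq> polys V \<Longrightarrow>
    weakly_regular V I fs"
  using i_in_V by (intro weakly_regular_middle[of "var i", OF _ pideal_I]) (simp_all add: colon_I)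

text \<open>
  If \<open>I\<close> is neither \<open>0\<close> nor the whole ring, then homology in degrees \<open>0\<close> and \<open>1\<close> does not vanish,
  which forces \<open>r < |V|\<close>. The zero ideal is separate because \<open>e\<^sub>1, \<dots>, e\<^sub>n\<close> is regular on \<open>K[V]\<close> itself.
\<close>

lemma tame_I:
  assumes "tame V I1" "tame W I2"
  shows "tame V I"
proof (cases "I = {0}")
  case True
  then show ?thesis using tame_zero(2)[OF finite_V] by simp
next
  case nonzero: False
  note t = assms[unfolded tame_def]
  have mon: "monomial_closed I" using t by (intro monomial_closed_I) auto
  have "esyms_optimal V I"
  proof (cases "1 \<in> I")
    case True
    then have "I = polys V" using pideal_eq_polys[OF pideal_I] by simp
    then show ?thesis by (simp add: esyms_optimal_def weakly_regular_polys)
  next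
    case False
    have max: "I \<subseteq> graded_max_ideal V"
    proof
      fix p assume p: "p \<in> I"
      then have "0 \<notin> exps p" using mon False unfolding monomial_closed_def by (metis monom_poly_zero)
      then show "p \<in> graded_max_ideal V"
        using p pidealD(1)[OF pideal_I] by (auto simp: mem_graded_max_ideal)
    qed
    show ?thesis
      unfolding esyms_optimal_def
    proof (intro allI impI)
      fix r assume *: "\<forall>q. card V < q + r \<longrightarrow> acyclic_at V I q"
      have "r < card V"
        using not_acyclic_1[OF finite_V pideal_I mon max nonzero] not_acyclic_0[OF finite_V pideal_I max]
          *[rule_format, of 1] *[rule_format, of 0] by linarith
      then show "weakly_regular V I (esyms V r)"
        using weakly_regular_parts[of r] * t by (intro weakly_regular_I) auto
    qed
  qed
  then show ?thesis
    using t mon pideal_I contractions_detect_I by (simp add: tame_def)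
qed

end

lemma vertex_decomp_eq_split_ideal:
  fixes I1 I2 :: "'k::field mpoly set"
  assumes "finite V" and I1: "pideal V I1" and I2: "pideal (V - {i}) I2"
    and decomp: "vertex_decomp V i I I1 I2"
  shows "splitting V i I1 I2" and "I = split_ideal V i I1 I2"
proof -
  have i: "i \<in> V" and I: "I = (*) (var i) ` I1 <+>\<^bsub>poly_ring V\<^esub> Idl\<^bsub>poly_ring V\<^esub> I2"
    and sub: "Idl\<^bsub>poly_ring V\<^esub> I2 \<subseteq> I1"
    using decomp by (auto simp: vertex_decomp_def)
  have I2V: "I2 \<subseteq> polys V" using pidealD(1)[OF I2] polys_mono[of "V - {i}" V] by blast
  have I2_Idl: "I2 \<subseteq> Idl\<^bsub>poly_ring V\<^esub> I2" by (rule subset_Idl[OF I2V])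
  show s: "splitting V i I1 I2"
    by (rule splitting.intro) (use assms i sub I2_Idl in auto)
  interpret splitting V i I1 I2 by (rule s)
  have mem: "p \<in> I \<longleftrightarrow> (\<exists>a \<in> I1. \<exists>b \<in> Idl\<^bsub>poly_ring V\<^esub> I2. p = var i * a + b)" for p
    unfolding I set_add_def' by auto
  show "I = split_ideal V i I1 I2"
  proof (intro equalityI subsetI)
    fix p assume "p \<in> I"
    then obtain a b where p: "a \<in> I1" "b \<in> Idl\<^bsub>poly_ring V\<^esub> I2" "p = var i * a + b"
      using mem by blast
    have "b \<in> split_ideal V i I1 I2" using Idl_subset[OF pideal_I I2_subset_I] p by blast
    moreover have "var i * a \<in> split_ideal V i I1 I2" using var_mult_in_I p pidealD(8)[OF I1] by blast
    ultimately show "p \<in> split_ideal V i I1 I2" unfolding p by (intro pidealD(3)[OF pideal_I])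
  next
    fix p assume "p \<in> split_ideal V i I1 I2"
    then have "quo i p \<in> I1" "at0 i p \<in> Idl\<^bsub>poly_ring V\<^esub> I2"
      using I2_Idl by (auto simp: split_ideal_def)
    then show "p \<in> I" unfolding mem using at0_plus_quo[of i p]
      by (intro bexI[of _ "quo i p"] bexI[of _ "at0 i p"]) (auto simp: add.commute)
  qed
qed

text \<open>
  The condition on the minimal generators says exactly that no minimal generator of \<open>I\<^sub>2\<close> is
  one of \<open>I\<^sub>1\<close>: a common one \<open>u\<close> would make both \<open>u\<close> and \<open>x\<^sub>i u\<close> minimal generators of \<open>I\<close>.
\<close>

lemma vertex_decomp_subset_times_max:
  fixes I1 I2 :: "'k::field mpoly set"
  assumes V: "finite V" and I1: "pideal V I1" "monomial_closed I1"
    and I2: "pideal (V - {i}) I2" "monomial_closed I2"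
    and decomp: "vertex_decomp V i I I1 I2"
  shows "I2 \<subseteq> times_max V I1"
proof
  interpret S: splitting V i I1 I2
    by (rule vertex_decomp_eq_split_ideal(1)[OF V I1(1) I2(1) decomp])
  have I: "I = split_ideal V i I1 I2"
    by (rule vertex_decomp_eq_split_ideal(2)[OF V I1(1) I2(1) decomp])
  define xI1 where "xI1 = (*) (var i) ` I1"
  have div_xI1: "\<exists>e. m = Poly_Mapping.single i 1 + e \<and> monom_poly e \<in> I1"
    if pm: "p \<in> xI1" "m \<in> exps p" for m p
  proof -
    obtain q where q: "q \<in> I1" "p = var i * q" using pm(1) by (auto simp: xI1_def)
    then obtain e where "m = Poly_Mapping.single i 1 + e" "e \<in> exps q"
      using pm(2) keys_mult[of "var i" q] by (auto simp: var_def)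
    then show ?thesis using q I1(2) by (auto simp: monomial_closed_def)
  qed
  have x_pideal: "pideal V xI1"
    unfolding pideal_def xI1_def
  proof (intro conjI ballI)
    show "(*) (var i) ` I1 \<subseteq> polys V" using S.i_in_V pidealD(8)[OF I1(1)] by auto
    show "0 \<in> (*) (var i) ` I1" using pidealD(2)[OF I1(1)] by (intro image_eqI[of _ _ 0]) auto
    fix x y :: "'k mpoly" assume y: "y \<in> (*) (var i) ` I1"
    show "x + y \<in> (*) (var i) ` I1" if "x \<in> (*) (var i) ` I1"
      using y that pidealD(3)[OF I1(1)] by (auto simp flip: distrib_left)
    show "x * y \<in> (*) (var i) ` I1" if "x \<in> polys V"
      using y that pidealD(4)[OF I1(1)] by (auto simp: mult.left_commute)
  qed
  have x_closed: "monomial_closed xI1"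
    unfolding monomial_closed_def
  proof (intro ballI)
    fix p m assume "p \<in> xI1" "m \<in> exps p"
    then obtain e where "m = Poly_Mapping.single i 1 + e" "monom_poly e \<in> I1" using div_xI1 by blast
    then show "monom_poly m \<in> xI1" by (auto simp: xI1_def monom_poly_add var_def)
  qed
  have "min_gens V I = min_gens V xI1 \<union> min_gens (V - {i}) I2"
    using decomp unfolding vertex_decomp_def xI1_def by blast
  moreover have "min_gens V I = monom_poly ` minimal_exps I"
    unfolding I by (rule min_gens_eq[OF S.pideal_I S.monomial_closed_I[OF I1(2) I2(2)]])
  ultimately have "monom_poly ` minimal_exps I =
      (monom_poly ` minimal_exps xI1 \<union> monom_poly ` minimal_exps I2 :: 'k mpoly set)"
    by (simp only: min_gens_eq[OF x_pideal x_closed] min_gens_eq[OF I2])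
  then have "(monom_poly ` minimal_exps xI1 :: 'k mpoly set) \<subseteq> monom_poly ` minimal_exps I"
    by (simp only: Un_upper1)
  moreover have "inj (monom_poly :: _ \<Rightarrow> 'k mpoly)" by (rule injI) simp
  ultimately have gens: "minimal_exps xI1 \<subseteq> minimal_exps I"
    by (simp only: inj_image_subset_iff)
  note T = pideal_times_max[OF I1(1)]
  fix p assume p: "p \<in> I2"
  show "p \<in> times_max V I1"
  proof (rule pideal_monom_polyI[OF T])
    show "p \<in> polys V" using p pidealD(8)[OF I2(1)] S.polys_W by blast
    fix m assume "m \<in> exps p"
    then have "monom_poly m \<in> I2" using p I2(2) by (auto simp: monomial_closed_def)
    moreover have "monom_poly m \<in> (polys V :: 'k mpoly set)"
      using pidealD(8)[OF I2(1) calculation] S.polys_W by blast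
    ultimately obtain a b where a: "a \<in> minimal_exps I2" and m: "m = a + b" "vars m \<subseteq> V"
      using minimal_exp_divides by (metis monom_poly_in_polys)
    have a2: "monom_poly a \<in> I2" using a by (simp add: minimal_exps_def)
    then have aI: "monom_poly a \<in> I" "monom_poly a \<in> I1" using S.I2_subset_I S.I2_subset_I1 I by auto
    have "a \<notin> minimal_exps I1"
      \<comment> \<open>otherwise \<open>x\<^sub>i\<close> times this monomial of \<open>I\<close> would be a minimal generator of \<open>I\<close>\<close>
    proof
      assume min: "a \<in> minimal_exps I1"
      have "Poly_Mapping.single i 1 + a \<in> minimal_exps xI1"
        unfolding minimal_exps_def
      proof (intro CollectI conjI allI impI)
        show "monom_poly (Poly_Mapping.single i 1 + a) \<in> xI1"
          using aI(2) by (auto simp: xI1_def monom_poly_add var_def)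
        fix c d assume cd: "Poly_Mapping.single i 1 + a = c + d" "monom_poly c \<in> xI1"
        obtain e where e: "c = Poly_Mapping.single i 1 + e" "monom_poly e \<in> I1"
          using div_xI1[OF cd(2), of c] by auto
        then have "a = e + d" using cd(1) by (simp add: add.assoc)
        then show "d = 0" using min e(2) by (auto simp: minimal_exps_def)
      qed
      then have "Poly_Mapping.single i 1 + a \<in> minimal_exps I" using gens by blast
      then have "\<And>c d. Poly_Mapping.single i 1 + a = c + d \<Longrightarrow> monom_poly c \<in> I \<Longrightarrow> d = 0"
        by (simp add: minimal_exps_def)
      from this[OF add.commute aI(1)] have "Poly_Mapping.single i (1 :: nat) = 0" .
      then have "tdeg (Poly_Mapping.single i 1) = 0" by simp
      then show False unfolding tdeg_single by simp
    qed
    then obtain c d where cd: "a = c + d" "monom_poly c \<in> I1" "d \<noteq> 0"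
      using aI(2) by (auto simp: minimal_exps_def)
    then obtain j where "j \<in> vars d" by (metis keys_eq_empty ex_in_conv)
    then obtain d' where d': "d = Poly_Mapping.single j 1 + d'" using exp_divisible by blast
    have vs: "j \<in> V" "vars d' \<subseteq> V" "vars b \<subseteq> V"
      using m(2) unfolding m(1) cd(1) d' by (auto simp: vars_add)
    have "(monom_poly m :: 'k mpoly) = var j * (monom_poly (d' + b) * monom_poly c)"
      unfolding m(1) cd(1) d' monom_poly_add var_def by (simp add: ac_simps)
    moreover have "monom_poly (d' + b) * monom_poly c \<in> I1"
      using cd(2) vs by (intro pidealD(4)[OF I1(1)]) (auto simp: vars_add)
    ultimately show "monom_poly m \<in> times_max V I1"
      using var_mult_in_times_max[OF V vs(1)] pidealD(2)[OF I1(1)] by metis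
  qed
qed

lemma minimal_splitting_of_vertex_decomp:
  assumes V: "finite V" and "tame V I1" "tame (V - {i}) I2" and decomp: "vertex_decomp V i I I1 I2"
  shows "minimal_splitting V i I1 I2"
proof -
  have I1: "pideal V I1" "monomial_closed I1" "contractions_detect V I1"
    and I2: "pideal (V - {i}) I2" "monomial_closed I2"
    using assms by (auto simp: tame_def)
  show ?thesis
    using vertex_decomp_eq_split_ideal(1)[OF V I1(1) I2(1) decomp]
      vertex_decomp_subset_times_max[OF V I1(1,2) I2 decomp] tame_zero(1)[OF V, of 0] I1(3)
    by (auto simp: minimal_splitting_def minimal_splitting_axioms_def)
qed

lemma tame_of_vertex_splittable:
  "vertex_splittable V I \<Longrightarrow> finite V \<Longrightarrow> tame V I"
proof (induction rule: vertex_splittable.induct)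
  case (principal u V)
  then show ?case using tame_principal by (auto simp: monomials_def)
next
  case (zero V)
  then show ?case by (intro tame_zero)
next
  case (whole V)
  then show ?case by (intro tame_polys)
next
  case (split V I1 i I2 I)
  then have t: "tame V I1" "tame (V - {i}) I2" by auto
  interpret S: minimal_splitting V i I1 I2
    by (rule minimal_splitting_of_vertex_decomp[OF split.prems t split.hyps(3)])
  have "I = split_ideal V i I1 I2"
    using t split by (intro vertex_decomp_eq_split_ideal(2)) (auto simp: tame_def)
  then show ?case using S.tame_I[OF t] by simp
qed

section \<open>Depth\<close>

lemma adjoin_list_Cons:
  "pideal V J \<Longrightarrow> f \<in> polys V \<Longrightarrow> set fs \<subseteq> polys V \<Longrightarrow>
    adjoin_list V (adjoin V J f) fs = adjoin V (adjoin_list V J fs) f"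
proof (induction fs arbitrary: J)
  case (Cons g fs)
  then show ?case
    using Cons.IH[of "adjoin V J g"] by (simp add: adjoin_commute[of V J f g] pideal_adjoin)
qed simp

lemma weakly_regular_iff_nth:
  "weakly_regular V J fs \<longleftrightarrow> (\<forall>k < length fs. nonzerodivisor V (adjoin_list V J (take k fs)) (fs ! k))"
  by (induction fs arbitrary: J) (simp_all add: All_less_Suc2)

text \<open>
  The translation of the module \<open>K[V]/J\<close>, whose elements are cosets, to conditions modulo \<open>J\<close>.
\<close>

locale residue_module =
  fixes V :: "nat set" and J :: "'k::field mpoly set"
  assumes J: "pideal V J"
begin

abbreviation R :: "'k mpoly ring" where "R \<equiv> poly_ring V"
abbreviation coset :: "'k mpoly \<Rightarrow> 'k mpoly set" where "coset a \<equiv> J +>\<^bsub>R\<^esub> a"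
abbreviation M :: "('k mpoly, 'k mpoly set) module" where "M \<equiv> quot_module R J"

lemma J_ideal: "ideal J R"
  using J by (simp add: pideal_iff_ideal)

lemma coset_hom: "coset \<in> ring_hom R (R Quot J)"
  using J_ideal by (rule ideal.rcos_ring_hom)

lemma coset_simps:
  assumes "a \<in> polys V" "b \<in> polys V"
  shows "a \<odot>\<^bsub>M\<^esub> coset b = coset (a * b)" "coset a \<oplus>\<^bsub>M\<^esub> coset b = coset (a + b)"
  using ring_hom_mult[OF coset_hom, of a b] ring_hom_add[OF coset_hom, of a b] assms
  by (simp_all add: quot_module_def)

lemma coset_zero: "\<zero>\<^bsub>M\<^esub> = coset 0"
proof -
  interpret ring R using poly_ring_cring by (rule cring.axioms)
  interpret Q: ring "R Quot J" using J_ideal by (rule ideal.quotient_is_ring)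
  have "coset \<zero>\<^bsub>R\<^esub> = \<zero>\<^bsub>R Quot J\<^esub>"
    using ring_hom_zero[OF coset_hom ring_axioms Q.ring_axioms] .
  then show ?thesis by (simp add: quot_module_def)
qed

lemma carrier_M: "carrier M = coset ` polys V"
  by (auto simp: quot_module_def FactRing_def A_RCOSETS_def')

lemma coset_mem: "x \<in> coset a \<longleftrightarrow> (\<exists>j \<in> J. x = j + a)"
  by (auto simp: a_r_coset_def')

lemma coset_in_image:
  assumes K: "pideal V K" "J \<subseteq> K" and a: "a \<in> polys V"
  shows "coset a \<in> coset ` K \<longleftrightarrow> a \<in> K"
proof
  assume "coset a \<in> coset ` K"
  then obtain b where b: "b \<in> K" "coset a = coset b" by blast
  have "a \<in> coset a" using pidealD(2)[OF J] by (auto simp: coset_mem)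
  then obtain j where "j \<in> J" "a = j + b" using b(2) coset_mem by auto
  then show "a \<in> K" using b(1) K by (auto intro: pidealD(3))
qed auto

lemma seq_submodule_eq:
  "set fs \<subseteq> polys V \<Longrightarrow> seq_submodule R M fs = coset ` adjoin_list V J fs"
proof (induction fs)
  case Nil
  have "coset j = coset 0" if "j \<in> J" for j
  proof -
    have "x \<in> coset j \<longleftrightarrow> x \<in> coset 0" for x
    proof
      assume "x \<in> coset j"
      then obtain k where "k \<in> J" "x = k + j" by (auto simp: coset_mem)
      then show "x \<in> coset 0" using that pidealD(3)[OF J] by (auto simp: coset_mem)
    next
      assume "x \<in> coset 0"
      then have "x - j \<in> J" using that pidealD(7)[OF J] by (auto simp: coset_mem)
      then show "x \<in> coset j" by (auto simp: coset_mem intro!: bexI[of _ "x - j"])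
    qed
    then show ?thesis by blast
  qed
  then have "coset ` J = {coset 0}" using pidealD(2)[OF J] by blast
  then show ?case by (simp add: coset_zero)
next
  case (Cons f fs)
  then have f: "f \<in> polys V" and fs: "set fs \<subseteq> polys V" by auto
  have K: "adjoin_list V J fs \<subseteq> polys V" using pidealD(1)[OF pideal_adjoin_list[OF J fs]] .
  have "seq_submodule R M (f # fs) =
      {f \<odot>\<^bsub>M\<^esub> coset a \<oplus>\<^bsub>M\<^esub> coset b | a b. a \<in> polys V \<and> b \<in> adjoin_list V J fs}"
    using Cons.IH[OF fs] by (auto simp: carrier_M)
  also have "\<dots> = {coset (f * a + b) | a b. a \<in> polys V \<and> b \<in> adjoin_list V J fs}"
  proof -
    have "f \<odot>\<^bsub>M\<^esub> coset a \<oplus>\<^bsub>M\<^esub> coset b = coset (f * a + b)"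
      if "a \<in> polys V" "b \<in> adjoin_list V J fs" for a b
      using that f K by (simp add: coset_simps subset_iff)
    then show ?thesis by (intro Collect_cong) metis
  qed
  also have "\<dots> = coset ` adjoin V (adjoin_list V J fs) f"
    unfolding adjoin_def by blast
  finally show ?case by (simp add: adjoin_list_Cons[OF J f fs])
qed

lemma regular_seq_iff:
  "regular_seq R M fs \<longleftrightarrow> set fs \<subseteq> polys V \<and> weakly_regular V J fs \<and> 1 \<notin> adjoin_list V J fs"
proof (cases "set fs \<subseteq> polys V")
  case fs: True
  have sub: "set (take k fs) \<subseteq> polys V" for k using fs set_take_subset by fast
  have "(\<forall>x \<in> carrier M. (fs ! k) \<odot>\<^bsub>M\<^esub> x \<in> seq_submodule R M (take k fs) \<longrightarrow>
      x \<in> seq_submodule R M (take k fs)) \<longleftrightarrow>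
    nonzerodivisor V (adjoin_list V J (take k fs)) (fs ! k)" if k: "k < length fs" for k
  proof -
    have "fs ! k \<in> polys V" using fs k nth_mem by blast
    then show ?thesis
      using coset_in_image[OF pideal_adjoin_list[OF J sub[of k]] subset_adjoin_list]
      by (simp add: nonzerodivisor_def carrier_M seq_submodule_eq[OF sub] coset_simps)
  qed
  moreover have "seq_submodule R M fs = carrier M \<longleftrightarrow> 1 \<in> adjoin_list V J fs"
  proof -
    note K = pideal_adjoin_list[OF J fs]
    have "coset ` adjoin_list V J fs = coset ` polys V \<longleftrightarrow> 1 \<in> adjoin_list V J fs"
    proof
      assume "coset ` adjoin_list V J fs = coset ` polys V"
      then have "coset 1 \<in> coset ` adjoin_list V J fs" by auto
      then show "1 \<in> adjoin_list V J fs"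
        using coset_in_image[OF K subset_adjoin_list, of 1] by simp
    next
      assume "1 \<in> adjoin_list V J fs"
      then have "adjoin_list V J fs = polys V" using pideal_eq_polys[OF K] by simp
      then show "coset ` adjoin_list V J fs = coset ` polys V" by simp
    qed
    then show ?thesis by (simp add: seq_submodule_eq[OF fs] carrier_M)
  qed
  ultimately show ?thesis
    unfolding regular_seq_def weakly_regular_iff_nth using fs by auto
qed (auto simp: regular_seq_def)

lemma annihilator_M: "annihilator R M = J"
proof -
  have iff: "coset a = coset 0 \<longleftrightarrow> a \<in> J" if "a \<in> polys V" for a
  proof -
    have "coset ` J = {coset 0}" using seq_submodule_eq[of "[]"] coset_zero by simp
    then show ?thesis using coset_in_image[OF J order_refl that] by simp
  qed
  show ?thesis
  proof
    show "annihilator R M \<subseteq> J"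
    proof
      fix f assume f: "f \<in> annihilator R M"
      then have "f \<odot>\<^bsub>M\<^esub> coset 1 = \<zero>\<^bsub>M\<^esub>" "f \<in> polys V" by (auto simp: annihilator_def carrier_M)
      then show "f \<in> J" using iff[of f] by (simp add: coset_simps coset_zero)
    qed
    show "J \<subseteq> annihilator R M"
    proof
      fix f assume f: "f \<in> J"
      then have fV: "f \<in> polys V" using pidealD(8)[OF J] by blast
      have "f \<odot>\<^bsub>M\<^esub> coset a = \<zero>\<^bsub>M\<^esub>" if "a \<in> polys V" for a
        using that fV f pidealD(5)[OF J that f] iff[of "f * a"] by (simp add: coset_simps coset_zero)
      then show "f \<in> annihilator R M" using fV by (auto simp: annihilator_def carrier_M)
    qed
  qed
qed

end

lemma enat_le_Sup_iff:
  assumes "A \<noteq> {}"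
  shows "enat r \<le> Sup (enat ` A) \<longleftrightarrow> (\<exists>a \<in> A. r \<le> a)"
proof
  assume le: "enat r \<le> Sup (enat ` A)"
  show "\<exists>a \<in> A. r \<le> a"
  proof (cases r)
    case 0
    then show ?thesis using assms by auto
  next
    case (Suc k)
    show ?thesis
    proof (rule ccontr)
      assume "\<not> ?thesis"
      then have "\<And>a. a \<in> A \<Longrightarrow> a \<le> k" using Suc by (metis not_less_eq_eq)
      then have "Sup (enat ` A) \<le> enat k" by (intro Sup_least) auto
      with le Suc show False by (metis enat_ord_simps(1) not_less_eq_eq order_refl order_trans)
    qed
  qed
next
  assume "\<exists>a \<in> A. r \<le> a"
  then obtain a where "a \<in> A" "r \<le> a" by blast
  then show "enat r \<le> Sup (enat ` A)"
    by (intro order_trans[OF _ Sup_upper[of "enat a"]]) auto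
qed

lemma enat_eqI: "(\<And>r. enat r \<le> x \<longleftrightarrow> enat r \<le> y) \<Longrightarrow> x = y"
  by (cases x; cases y) (auto, metis enat_ord_simps(1) order_refl order_antisym, metis Suc_n_not_le_n, metis Suc_n_not_le_n)

text \<open>
  A regular sequence of length \<open>r\<close> kills Koszul homology, which in turn makes the elementary
  symmetric polynomials \<open>e\<^sub>1, \<dots>, e\<^sub>r\<close> regular.
\<close>

lemma depth_quot_ge_iff:
  assumes V: "finite V" and J: "tame V J" "J \<subseteq> graded_max_ideal V"
  shows "enat r \<le> depth_quot V J \<longleftrightarrow> weakly_regular V J (esyms V r)"
proof -
  have P: "pideal V J" and opt: "esyms_optimal V J" using J(1) by (auto simp: tame_def)
  let ?L = "length ` {fs. set fs \<subseteq> graded_max_ideal V \<and>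
    regular_seq (poly_ring V) (quot_module (poly_ring V) J) fs}"
  have reg: "regular_seq (poly_ring V) (quot_module (poly_ring V) J) fs \<longleftrightarrow> weakly_regular V J fs"
    if fs: "set fs \<subseteq> graded_max_ideal V" for fs
  proof -
    have "adjoin_list V J fs \<subseteq> graded_max_ideal V"
      using fs J(2) by (intro adjoin_list_minimal[OF pideal_graded_max_ideal])
    then have "1 \<notin> adjoin_list V J fs" by (auto simp: mem_graded_max_ideal)
    then show ?thesis
      using fs pidealD(1)[OF pideal_graded_max_ideal[of V]]
      by (auto simp: residue_module.regular_seq_iff[OF residue_module.intro[OF P]])
  qed
  have eq: "depth_quot V J = Sup (enat ` ?L)"
    unfolding module_depth_def by (rule arg_cong[of _ _ Sup]) auto
  have "[] \<in> {fs. set fs \<subseteq> graded_max_ideal V \<and>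
      regular_seq (poly_ring V) (quot_module (poly_ring V) J) fs}" using reg[of "[]"] by simp
  then have "?L \<noteq> {}" by blast
  then have "enat r \<le> depth_quot V J \<longleftrightarrow>
      (\<exists>fs. set fs \<subseteq> graded_max_ideal V \<and> weakly_regular V J fs \<and> r \<le> length fs)"
    unfolding eq by (subst enat_le_Sup_iff) (use reg in auto)
  also have "\<dots> \<longleftrightarrow> weakly_regular V J (esyms V r)"
  proof
    assume "\<exists>fs. set fs \<subseteq> graded_max_ideal V \<and> weakly_regular V J fs \<and> r \<le> length fs"
    then obtain fs where fs: "set fs \<subseteq> graded_max_ideal V" "weakly_regular V J fs" "r \<le> length fs"
      by blast
    have "acyclic_at V J q" if "card V < q + r" for q
      using fs that by (intro acyclic_at_of_weakly_regular[OF V P fs(1,2)]) simp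
    then show "weakly_regular V J (esyms V r)" using opt by (simp add: esyms_optimal_def)
  next
    assume "weakly_regular V J (esyms V r)"
    then show "\<exists>fs. set fs \<subseteq> graded_max_ideal V \<and> weakly_regular V J fs \<and> r \<le> length fs"
      using esyms_in_graded_max_ideal[OF V, of r] by (intro exI[of _ "esyms V r"]) simp
  qed
  finally show ?thesis .
qed

section \<open>Dimension\<close>

definition prime_chain_above :: "('a, 'c) ring_scheme \<Rightarrow> 'a set \<Rightarrow> nat \<Rightarrow> bool" where
  "prime_chain_above R J r \<longleftrightarrow> (\<exists>P :: nat \<Rightarrow> 'a set.
     (\<forall>k \<le> r. primeideal (P k) R \<and> J \<subseteq> P k) \<and> (\<forall>k < r. P k \<subset> P (Suc k)))"

lemma carrier_Quot: "carrier (R Quot J) = (+>\<^bsub>R\<^esub>) J ` carrier R"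
  by (auto simp: FactRing_def A_RCOSETS_def')

text \<open>Prime ideals of \<open>R/J\<close> and prime ideals of \<open>R\<close> over \<open>J\<close> correspond to each other.\<close>

lemma krull_dim_Quot:
  assumes R: "cring R" and J: "ideal J R"
  shows "krull_dim (R Quot J) = Sup (enat ` {r. prime_chain_above R J r})"
proof -
  interpret cring R by fact
  interpret J: ideal J R by fact
  interpret h: ring_hom_ring R "R Quot J" "(+>\<^bsub>R\<^esub>) J" by (rule J.rcos_ring_hom_ring)
  interpret Q: cring "R Quot J" by (rule J.quotient_is_cring[OF R])
  note carrier = carrier_Quot[of R J]
  have mem: "J +>\<^bsub>R\<^esub> a \<in> (+>\<^bsub>R\<^esub>) J ` K \<longleftrightarrow> a \<in> K"
    if K: "ideal K R" "J \<subseteq> K" and a: "a \<in> carrier R" for K a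
  proof
    assume "J +>\<^bsub>R\<^esub> a \<in> (+>\<^bsub>R\<^esub>) J ` K"
    then obtain b where b: "b \<in> K" "J +>\<^bsub>R\<^esub> a = J +>\<^bsub>R\<^esub> b" by blast
    have "a \<in> J +>\<^bsub>R\<^esub> a" using a by (rule J.a_rcos_self)
    then obtain j where "j \<in> J" "a = j \<oplus>\<^bsub>R\<^esub> b" using b(2) by (auto simp: a_r_coset_def')
    then show "a \<in> K"
      using b(1) K additive_subgroup.a_closed[OF ideal.axioms(1)[OF K(1)]] by auto
  qed auto
  have "(\<exists>P. (\<forall>k \<le> r. primeideal (P k) (R Quot J)) \<and> (\<forall>k < r. P k \<subset> P (Suc k))) \<longleftrightarrow>
    prime_chain_above R J r" for r
  proof
    assume "\<exists>P. (\<forall>k \<le> r. primeideal (P k) (R Quot J)) \<and> (\<forall>k < r. P k \<subset> P (Suc k))"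
    then obtain P where P: "\<And>k. k \<le> r \<Longrightarrow> primeideal (P k) (R Quot J)" "\<And>k. k < r \<Longrightarrow> P k \<subset> P (Suc k)"
      by blast
    define P' where "P' k = {a \<in> carrier R. J +>\<^bsub>R\<^esub> a \<in> P k}" for k
    have "primeideal (P' k) R" if "k \<le> r" for k
      unfolding P'_def by (rule h.primeideal_vimage[OF R P(1)[OF that]])
    moreover have "J \<subseteq> P' k" if "k \<le> r" for k
    proof
      interpret P: primeideal "P k" "R Quot J" by (rule P(1)[OF that])
      fix a assume a: "a \<in> J"
      have "\<zero>\<^bsub>R Quot J\<^esub> = J" by (simp only: FactRing_def ring.simps)
      then have "J +>\<^bsub>R\<^esub> a = \<zero>\<^bsub>R Quot J\<^esub>" using J.a_rcos_const[OF a] by (simp only:)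
      then show "a \<in> P' k" unfolding P'_def using J.Icarr[OF a] P.zero_closed by (metis mem_Collect_eq)
    qed
    moreover have "P' k \<subset> P' (Suc k)" if k: "k < r" for k
    proof -
      obtain X where X: "X \<in> P (Suc k)" "X \<notin> P k" using P(2)[OF k] by blast
      have "X \<in> carrier (R Quot J)"
        using X(1) ideal.Icarr[OF primeideal.axioms(1)[OF P(1)[of "Suc k"]]] k by simp
      then obtain a where "a \<in> carrier R" "X = J +>\<^bsub>R\<^esub> a" unfolding carrier by (elim imageE)
      then have "a \<in> P' (Suc k)" "a \<notin> P' k" using X by (auto simp: P'_def)
      moreover have "P' k \<subseteq> P' (Suc k)" using P(2)[OF k] by (auto simp: P'_def)
      ultimately show ?thesis by blast
    qed
    ultimately show "prime_chain_above R J r" unfolding prime_chain_above_def by blast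
  next
    assume "prime_chain_above R J r"
    then obtain P where P: "\<And>k. k \<le> r \<Longrightarrow> primeideal (P k) R" "\<And>k. k \<le> r \<Longrightarrow> J \<subseteq> P k"
        "\<And>k. k < r \<Longrightarrow> P k \<subset> P (Suc k)"
      unfolding prime_chain_above_def by blast
    have "primeideal ((+>\<^bsub>R\<^esub>) J ` P k) (R Quot J)" if k: "k \<le> r" for k
    proof -
      interpret P: primeideal "P k" R by (rule P(1)[OF k])
      note m = mem[OF P.is_ideal P(2)[OF k]]
      show ?thesis
      proof (rule primeidealI)
        show "ideal ((+>\<^bsub>R\<^esub>) J ` P k) (R Quot J)"
          by (rule ring_ideal_imp_quot_ideal[OF J P.is_ideal])
        show "cring (R Quot J)" by (rule Q.cring_axioms)
        show "carrier (R Quot J) \<noteq> (+>\<^bsub>R\<^esub>) J ` P k"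
        proof
          assume "carrier (R Quot J) = (+>\<^bsub>R\<^esub>) J ` P k"
          moreover have "J +>\<^bsub>R\<^esub> \<one>\<^bsub>R\<^esub> \<in> carrier (R Quot J)"
            unfolding carrier by (rule imageI) (rule one_closed)
          ultimately have "\<one>\<^bsub>R\<^esub> \<in> P k" using m[OF one_closed] by (simp only:)
          then show False using P.one_imp_carrier P.I_notcarr by blast
        qed
        fix X Y
        assume XY: "X \<in> carrier (R Quot J)" "Y \<in> carrier (R Quot J)"
          "X \<otimes>\<^bsub>R Quot J\<^esub> Y \<in> (+>\<^bsub>R\<^esub>) J ` P k"
        obtain a b where ab: "a \<in> carrier R" "b \<in> carrier R" "X = J +>\<^bsub>R\<^esub> a" "Y = J +>\<^bsub>R\<^esub> b"
          using XY(1,2) unfolding carrier by (elim imageE)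
        then have "J +>\<^bsub>R\<^esub> (a \<otimes>\<^bsub>R\<^esub> b) \<in> (+>\<^bsub>R\<^esub>) J ` P k"
          using XY(3) h.hom_mult[of a b] by simp
        then have "a \<otimes>\<^bsub>R\<^esub> b \<in> P k" using m[of "a \<otimes>\<^bsub>R\<^esub> b"] ab by simp
        then show "X \<in> (+>\<^bsub>R\<^esub>) J ` P k \<or> Y \<in> (+>\<^bsub>R\<^esub>) J ` P k" using P.I_prime ab by blast
      qed
    qed
    moreover have "(+>\<^bsub>R\<^esub>) J ` P k \<subset> (+>\<^bsub>R\<^esub>) J ` P (Suc k)" if k: "k < r" for k
    proof -
      obtain a where a: "a \<in> P (Suc k)" "a \<notin> P k" using P(3)[OF k] by blast
      have "a \<in> carrier R"
        using a(1) ideal.Icarr[OF primeideal.axioms(1)[OF P(1)[of "Suc k"]]] k by simp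
      then have "J +>\<^bsub>R\<^esub> a \<notin> (+>\<^bsub>R\<^esub>) J ` P k"
        using a(2) mem[OF primeideal.axioms(1)[OF P(1)] P(2)] less_imp_le[OF k] by blast
      then show ?thesis using a(1) P(3)[OF k] by blast
    qed
    ultimately show "\<exists>P. (\<forall>k \<le> r. primeideal (P k) (R Quot J)) \<and> (\<forall>k < r. P k \<subset> P (Suc k))"
      by (intro exI[of _ "\<lambda>k. (+>\<^bsub>R\<^esub>) J ` P k"]) simp
  qed
  then show ?thesis unfolding krull_dim_def by (intro arg_cong[of _ _ Sup]) auto
qed

abbreviation dim_quot :: "nat set \<Rightarrow> 'k::field mpoly set \<Rightarrow> enat" where
  "dim_quot V J \<equiv> module_dim (poly_ring V) (quot_module (poly_ring V) J)"

lemma dim_quot_eq: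
  "pideal V J \<Longrightarrow> dim_quot V J = Sup (enat ` {r. prime_chain_above (poly_ring V) J r})"
  unfolding module_dim_def
  by (simp only: residue_module.annihilator_M[OF residue_module.intro])
    (rule krull_dim_Quot[OF poly_ring_cring], simp add: pideal_iff_ideal)

text \<open>A prime ideal over \<open>J\<close> contains \<open>(J, x)\<close> or \<open>(J : x)\<close>, depending on whether it contains \<open>x\<close>.\<close>

lemma dim_quot_split:
  assumes J: "pideal V J" and x: "x \<in> polys V"
  shows "dim_quot V J = max (dim_quot V (colon (poly_ring V) J x)) (dim_quot V (adjoin V J x))"
proof -
  let ?C = "colon (poly_ring V) J x" and ?A = "adjoin V J x"
  have "prime_chain_above (poly_ring V) J r \<longleftrightarrow>
      prime_chain_above (poly_ring V) ?C r \<or> prime_chain_above (poly_ring V) ?A r" for r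
  proof
    assume "prime_chain_above (poly_ring V) J r"
    then obtain P where P: "\<And>k. k \<le> r \<Longrightarrow> primeideal (P k) (poly_ring V) \<and> J \<subseteq> P k"
        "\<And>k. k < r \<Longrightarrow> P k \<subset> P (Suc k)"
      unfolding prime_chain_above_def by blast
    interpret P0: primeideal "P 0" "poly_ring V" using P(1)[of 0] by simp
    have "?C \<subseteq> P 0 \<or> ?A \<subseteq> P 0"
    proof (cases "x \<in> P 0")
      case True
      have "pideal V (P 0)" using P0.is_ideal by (simp add: pideal_iff_ideal)
      then show ?thesis using True P(1)[of 0] by (simp add: adjoin_minimal)
    next
      case False
      have "g \<in> P 0" if g: "g \<in> ?C" for g
      proof -
        have "x * g \<in> P 0" "g \<in> polys V" using g P(1)[of 0] by (auto simp: mem_colon)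
        then show ?thesis using P0.I_prime[of x g] x False by simp
      qed
      then show ?thesis by blast
    qed
    moreover have "P 0 \<subseteq> P k" if "k \<le> r" for k
      using that
    proof (induction k)
      case (Suc k)
      then show ?case using P(2)[of k] by (meson Suc_le_lessD less_imp_le psubsetE subset_trans)
    qed simp
    ultimately show "prime_chain_above (poly_ring V) ?C r \<or> prime_chain_above (poly_ring V) ?A r"
      unfolding prime_chain_above_def using P by (meson subset_trans)
  next
    have "J \<subseteq> ?C" using pidealD[OF J] x by (auto simp: mem_colon)
    moreover have "J \<subseteq> ?A" by (rule subset_adjoin)
    ultimately show "prime_chain_above (poly_ring V) ?C r \<or> prime_chain_above (poly_ring V) ?A r \<Longrightarrow>
        prime_chain_above (poly_ring V) J r"
      unfolding prime_chain_above_def by (meson subset_trans)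
  qed
  then have "{r. prime_chain_above (poly_ring V) J r} =
      {r. prime_chain_above (poly_ring V) ?C r} \<union> {r. prime_chain_above (poly_ring V) ?A r}" by auto
  then show ?thesis
    using J x by (simp add: dim_quot_eq pideal_colon pideal_adjoin image_Un Sup_union_distrib sup_max)
qed

subsection \<open>Depth is at most dimension\<close>

text \<open>The ideal generated by the variables in \<open>V \<inter> G\<close>.\<close>

definition face_ideal :: "nat set \<Rightarrow> nat set \<Rightarrow> 'k::field mpoly set" where
  "face_ideal V G = {p \<in> polys V. \<forall>m \<in> exps p. vars m \<inter> G \<noteq> {}}"

text \<open>It is the kernel of the ring homomorphism that sets the variables in \<open>G\<close> to zero.\<close>

lemma primeideal_face_ideal: "primeideal (face_ideal V G :: 'k::field mpoly set) (poly_ring V)"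
proof -
  define A where "A = {m :: nat \<Rightarrow>\<^sub>0 nat. vars m \<inter> G = {}}"
  have mem: "p \<in> face_ideal V G \<longleftrightarrow> p \<in> polys V \<and> restr A p = 0" for p :: "'k mpoly"
    by (auto simp: face_ideal_def A_def simp flip: keys_eq_empty)
  have mult: "restr A (p * q) = restr A p * restr A q" for p q :: "'k mpoly"
    by (rule restr_mult_face) (auto simp: A_def vars_add)
  have "pideal V (face_ideal V G :: 'k mpoly set)"
    unfolding pideal_def by (auto simp: mem restr_add mult)
  moreover have "1 \<notin> (face_ideal V G :: 'k mpoly set)" by (simp add: face_ideal_def)
  moreover have "(1 :: 'k mpoly) \<in> polys V" by simp
  ultimately show ?thesis
    by (intro primeidealI poly_ring_cring) (auto simp: pideal_iff_ideal mem mult)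
qed

lemma of_nat_in_polys [simp]: "of_nat n \<in> polys V"
  by (induction n) auto

lemma power_sum_in_ideal:
  assumes J: "pideal V J" and "finite A" "\<And>a. a \<in> A \<Longrightarrow> f a \<in> polys V"
    and "\<And>a. a \<in> A \<Longrightarrow> \<exists>N. f a ^ N \<in> J"
  shows "\<exists>N. sum f A ^ N \<in> J"
  using assms(2-)
proof (induction A)
  case empty
  then show ?case using pidealD(2)[OF J] by (intro exI[of _ 1]) simp
next
  case (insert a A)
  obtain M N where MN: "f a ^ M \<in> J" "sum f A ^ N \<in> J" using insert by (metis insertCI)
  have p: "f a \<in> polys V" "sum f A \<in> polys V" using insert.prems by (auto intro: polys_sum)
  have "(f a + sum f A) ^ (M + N) \<in> J"
    unfolding binomial_ring
  proof (rule pideal_sum[OF J])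
    fix k
    show "of_nat (M + N choose k) * f a ^ k * sum f A ^ (M + N - k) \<in> J"
    proof (cases "M \<le> k")
      case True
      then have "f a ^ k = f a ^ (k - M) * f a ^ M" by (simp flip: power_add)
      then have "f a ^ k \<in> J" using MN p by (simp add: pidealD(4)[OF J])
      then show ?thesis using p by (intro pidealD(4,5)[OF J]) auto
    next
      case False
      then have "sum f A ^ (M + N - k) = sum f A ^ (M - k) * sum f A ^ N" by (simp flip: power_add)
      then have "sum f A ^ (M + N - k) \<in> J" using MN p by (simp add: pidealD(4)[OF J])
      then show ?thesis using p by (intro pidealD(4)[OF J]) auto
    qed
  qed
  then show ?case using insert.hyps by auto
qed

lemma power_of_prod_divisible:
  assumes "finite F"
  shows "vars m \<subseteq> F \<Longrightarrow>
    \<exists>q \<in> polys F. (\<Prod>j\<in>F. var j) ^ tdeg m = (monom_poly m * q :: 'k::field mpoly)"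
proof (induction "tdeg m" arbitrary: m)
  case 0
  then have "m = 0" by simp
  then show ?case by (intro bexI[of _ 1]) auto
next
  case (Suc d)
  have "m \<noteq> 0" using Suc.hyps(2) by auto
  then obtain i where "i \<in> vars m" by (metis keys_eq_empty ex_in_conv)
  then obtain m' where m: "m = Poly_Mapping.single i 1 + m'" using exp_divisible by blast
  have m': "tdeg m' = d" "vars m' \<subseteq> F" "i \<in> F"
    using Suc.prems Suc.hyps(2) unfolding m by (auto simp: tdeg_add vars_add)
  then obtain q :: "'k mpoly" where q: "q \<in> polys F" "(\<Prod>j\<in>F. var j) ^ d = monom_poly m' * q"
    using Suc.hyps(1)[of m'] by auto
  have "(\<Prod>j\<in>F. var j :: 'k mpoly) = var i * (\<Prod>j\<in>F - {i}. var j)"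
    using assms m'(3) by (rule prod.remove)
  then have "(\<Prod>j\<in>F. var j :: 'k mpoly) ^ Suc d =
      (var i * (\<Prod>j\<in>F - {i}. var j)) * (monom_poly m' * q)"
    by (simp only: power_Suc q(2)[symmetric])
  also have "\<dots> = monom_poly m * ((\<Prod>j\<in>F - {i}. var j) * q)"
    by (simp add: m monom_poly_add var_def ac_simps)
  finally show ?case
    using q(1) unfolding Suc.hyps(2)[symmetric]
    by (intro bexI[of _ "(\<Prod>j\<in>F - {i}. var j) * q"]) (auto intro!: polys_prod)
qed

text \<open>
  If every set of \<open>r\<close> variables supported a monomial of \<open>J\<close>, then \<open>e\<^sub>r\<close> would be nilpotent modulo
  \<open>J\<close> and could not be regular. A set that supports none gives a chain of prime ideals generated
  by variables.
\<close>

lemma prime_chain_of_weakly_regular_esyms: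
  fixes J :: "'k::field mpoly set"
  assumes V: "finite V" and J: "pideal V J" "monomial_closed J" "J \<subseteq> graded_max_ideal V"
    and reg: "weakly_regular V J (esyms V r)"
  shows "prime_chain_above (poly_ring V) J r"
proof -
  have "\<exists>F \<subseteq> V. card F = r \<and> (\<forall>m. monom_poly m \<in> J \<longrightarrow> \<not> vars m \<subseteq> F)"
  proof (rule ccontr)
    assume contra: "\<not> ?thesis"
    have r: "r \<noteq> 0"
    proof
      assume "r = 0"
      then obtain m where "monom_poly m \<in> J" "vars m \<subseteq> {}" using contra by auto
      then have "(monom_poly m :: 'k mpoly) \<in> graded_max_ideal V" "m = 0" using J(3) by (blast, simp)
      then show False by (simp add: mem_graded_max_ideal)
    qed
    have "\<exists>N. (\<Prod>j\<in>F. var j) ^ N \<in> J" if F: "F \<subseteq> V" "card F = r" for F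
    proof -
      obtain m where m: "monom_poly m \<in> J" "vars m \<subseteq> F" using contra F by blast
      obtain q :: "'k mpoly" where q: "q \<in> polys F" "(\<Prod>j\<in>F. var j) ^ tdeg m = monom_poly m * q"
        using power_of_prod_divisible[OF finite_subset[OF F(1) V] m(2)] by (rule bexE)
      then have "q \<in> polys V" using polys_mono[OF F(1)] by blast
      then have "monom_poly m * q \<in> J" by (rule pidealD(5)[OF J(1) _ m(1)])
      then show ?thesis unfolding q(2)[symmetric] by (rule exI)
    qed
    then have "\<exists>N. esym V r ^ N \<in> J"
      unfolding esym_def using V by (intro power_sum_in_ideal[OF J(1)]) (auto intro!: polys_prod)
    then obtain N where N: "esym V r ^ N \<in> J" by blast
    define L where "L = adjoin_list V J (esyms V (r - 1))"
    have L: "pideal V L" unfolding L_def by (rule pideal_adjoin_list[OF J(1) set_esyms])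
    have snoc: "(esyms V r :: 'k mpoly list) = esyms V (r - 1) @ [esym V r]" using r esyms_Suc[of V "r - 1"] by simp
    have nzd: "nonzerodivisor V L (esym V r)"
      using reg unfolding snoc weakly_regular_append L_def by simp
    have "esym V r ^ N \<in> L" using N subset_adjoin_list by (auto simp: L_def)
    then have "1 \<in> L"
    proof (induction N)
      case (Suc N)
      have "esym V r * esym V r ^ N \<in> L" using Suc.prems by simp
      then have "esym V r ^ N \<in> L"
        using nzd[unfolded nonzerodivisor_def, rule_format, of "esym V r ^ N"] by simp
      then show ?case by (rule Suc.IH)
    qed simp
    moreover have "L \<subseteq> graded_max_ideal V"
      unfolding L_def
      by (rule adjoin_list_minimal[OF pideal_graded_max_ideal J(3) esyms_in_graded_max_ideal[OF V]])
    ultimately show False by (auto simp: mem_graded_max_ideal)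
  qed
  then obtain F where F: "F \<subseteq> V" "card F = r" "\<And>m. monom_poly m \<in> J \<Longrightarrow> \<not> vars m \<subseteq> F" by blast
  obtain h where h: "bij_betw h {0..<r} F"
    using ex_bij_betw_nat_finite[of F] F finite_subset[OF F(1) V] by auto
  define P where "P k = (face_ideal V (V - h ` {k..<r}) :: 'k mpoly set)" for k
  have "J \<subseteq> P k" for k
  proof
    fix p assume p: "p \<in> J"
    have pV: "p \<in> polys V" using p pidealD(1)[OF J(1)] by blast
    have "vars m \<inter> (V - h ` {k..<r}) \<noteq> {}" if m: "m \<in> exps p" for m
    proof -
      have "\<not> vars m \<subseteq> F" using p m J(2) F(3) by (auto simp: monomial_closed_def)
      moreover have "vars m \<subseteq> V" using pV m by (auto simp: mem_polys)
      moreover have "h ` {k..<r} \<subseteq> F" using h by (auto simp: bij_betw_def)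
      ultimately show ?thesis by blast
    qed
    then show "p \<in> P k" using pV by (simp add: P_def face_ideal_def)
  qed
  moreover have "P k \<subset> P (Suc k)" if k: "k < r" for k
  proof
    have "h ` {Suc k..<r} \<subseteq> h ` {k..<r}" by auto
    then show "P k \<subseteq> P (Suc k)" unfolding P_def face_ideal_def by blast
    have "h k \<noteq> h l" if "l \<in> {Suc k..<r}" for l
      using inj_onD[OF bij_betw_imp_inj_on[OF h], of k l] k that by auto
    then have "h k \<notin> h ` {Suc k..<r}" by blast
    moreover have "h k \<in> V" using h k F(1) by (auto simp: bij_betw_def)
    moreover have "h k \<in> h ` {k..<r}" using k by auto
    ultimately have "var (h k) \<in> P (Suc k)" "var (h k) \<notin> P k"
      by (simp_all add: P_def face_ideal_def) (simp_all add: var_def)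
    then show "P k \<noteq> P (Suc k)" by blast
  qed
  ultimately show ?thesis
    unfolding prime_chain_above_def using primeideal_face_ideal by (intro exI[of _ P]) (auto simp: P_def)
qed

lemma depth_quot_le_dim_quot:
  assumes V: "finite V" and J: "tame V J" "J \<subseteq> graded_max_ideal V"
  shows "depth_quot V J \<le> dim_quot V J"
proof (rule ccontr)
  have P: "pideal V J" "monomial_closed J" using J(1) by (auto simp: tame_def)
  assume "\<not> ?thesis"
  then obtain r where r: "dim_quot V J < enat r" "enat r \<le> depth_quot V J"
    by (cases "dim_quot V J"; cases "depth_quot V J") (auto simp: not_le)
  then have "prime_chain_above (poly_ring V) J r"
    using depth_quot_ge_iff[OF V J] prime_chain_of_weakly_regular_esyms[OF V P J(2)] by blast
  then have "enat r \<le> dim_quot V J" unfolding dim_quot_eq[OF P(1)] by (intro Sup_upper) auto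
  then show False using r(1) by simp
qed

section \<open>The criterion\<close>

lemma tame_proper:
  assumes J: "tame V J" "1 \<notin> J"
  shows "J \<subseteq> graded_max_ideal V"
proof
  fix p assume p: "p \<in> J"
  then have "0 \<notin> exps p"
    using J unfolding tame_def monomial_closed_def by (metis monom_poly_zero)
  then show "p \<in> graded_max_ideal V"
    using p J pidealD(1)[of V J] by (auto simp: mem_graded_max_ideal tame_def)
qed

lemma tdeg_of_square:
  assumes "p \<in> graded_max_ideal V \<cdot>\<^bsub>poly_ring V\<^esub> graded_max_ideal V" "m \<in> exps p"
  shows "2 \<le> tdeg m"
  using assms
proof (induction arbitrary: m rule: ideal_prod.induct)
  case (prod a b)
  then obtain c d where cd: "m = c + d" "c \<in> exps a" "d \<in> exps b" using keys_mult[of a b] by auto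
  then have "c \<noteq> 0" "d \<noteq> 0" using prod by (auto simp: mem_graded_max_ideal)
  then have "tdeg c \<noteq> 0" "tdeg d \<noteq> 0" by simp_all
  then show ?case unfolding cd(1) tdeg_add by linarith
next
  case (sum a b)
  then show ?case using Poly_Mapping.keys_add[of a b] by auto
qed

theorem theorem2:
  fixes n i :: nat and I :: "'k::field mpoly set"
  assumes "monomial_ideal {1..n} I"
    and "vertex_splittable {1..n} I"
    and "I \<noteq> {0}"
    and "I \<subseteq> graded_max_ideal {1..n} \<cdot>\<^bsub>poly_ring {1..n}\<^esub> graded_max_ideal {1..n}"
    and "splitting_vertex {1..n} I i"
  shows "cohen_macaulay_ideal {1..n} I \<longleftrightarrow>
    cohen_macaulay_ideal {1..n} (colon (poly_ring {1..n}) I (var i)) \<and>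
    cohen_macaulay_ideal {1..n} (Idl\<^bsub>poly_ring {1..n}\<^esub> (I \<union> {var i})) \<and>
    depth_quot {1..n} (colon (poly_ring {1..n}) I (var i)) =
      depth_quot {1..n} (Idl\<^bsub>poly_ring {1..n}\<^esub> (I \<union> {var i}))"
proof -
  define V where "V = {1..n}"
  have V: "finite V" by (simp add: V_def)
  have tI: "tame V I" using assms(2) V by (simp add: V_def tame_of_vertex_splittable)
  then have I: "pideal V I" "monomial_closed I" by (auto simp: tame_def)
  obtain I1 I2 where vs: "vertex_splittable V I1" "vertex_splittable (V - {i}) I2"
      "vertex_decomp V i I I1 I2"
    using assms(5) by (auto simp: splitting_vertex_def V_def)
  have t: "tame V I1" "tame (V - {i}) I2" using vs V by (auto intro: tame_of_vertex_splittable)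
  interpret S: minimal_splitting V i I1 I2 by (rule minimal_splitting_of_vertex_decomp[OF V t vs(3)])
  have I_eq: "I = split_ideal V i I1 I2"
    using t vs(3) V by (intro vertex_decomp_eq_split_ideal(2)) (auto simp: tame_def)
  have deg: "2 \<le> tdeg m" if "p \<in> I" "m \<in> exps p" for p m
    using tdeg_of_square assms(4) that by blast
  have colon: "colon (poly_ring V) I (var i) = I1" using S.colon_I by (simp add: I_eq)
  let ?A = "adjoin V I (var i)"
  have A: "pideal V ?A" using I(1) S.i_in_V by (intro pideal_adjoin) auto
  have Idl: "Idl\<^bsub>poly_ring V\<^esub> (I \<union> {var i}) = ?A"
  proof
    have gen: "I \<union> {var i} \<subseteq> polys V" using pidealD(1)[OF I(1)] S.i_in_V by auto
    show "Idl\<^bsub>poly_ring V\<^esub> (I \<union> {var i}) \<subseteq> ?A"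
      using subset_adjoin self_in_adjoin[OF pidealD(2)[OF I(1)]] by (intro Idl_subset[OF A]) auto
    show "?A \<subseteq> Idl\<^bsub>poly_ring V\<^esub> (I \<union> {var i})"
      using subset_Idl[OF gen] by (intro adjoin_minimal pideal_Idl[OF gen]) auto
  qed
  have max: "I \<subseteq> graded_max_ideal V"
  proof (rule tame_proper[OF tI])
    show "1 \<notin> I" using deg[of 1 0] by auto
  qed
  \<comment> \<open>the elements of \<open>\<mm>\<^sup>2\<close> have no linear terms, so that \<open>x\<close> is not in \<open>I\<close> and \<open>(I : x)\<close> is proper\<close>
  have max1: "I1 \<subseteq> graded_max_ideal V"
  proof (rule tame_proper[OF t(1)])
    have "var i \<notin> I" using deg[of "var i"] by (auto simp: var_def)
    then show "1 \<notin> I1" using S.var_mult_in_I[of 1] by (simp add: I_eq)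
  qed
  have maxA: "?A \<subseteq> graded_max_ideal V"
    using max S.i_in_V by (intro adjoin_minimal pideal_graded_max_ideal var_in_graded_max_ideal)
  \<comment> \<open>\<open>(I, x)\<close> has the splitting with first part \<open>K[V]\<close>\<close>
  have tA: "tame V ?A"
  proof -
    interpret T: minimal_splitting V i "polys V" I2
    proof
      show "I2 \<subseteq> polys V" using pidealD(1)[OF S.I2] S.polys_W by blast
      show "I2 \<subseteq> times_max V (polys V)"
        using S.I2_times_max times_max_mono[OF pidealD(1)[OF S.I1]] by blast
      show "contractions_detect V (polys V :: 'k mpoly set)" using tame_polys by (auto simp: tame_def)
    qed (use V S.i_in_V pideal_polys S.I2 S.acyclic_1 in auto)
    have "split_ideal V i (polys V) I2 = ?A"
      unfolding I_eq S.adjoin_I by (auto simp: split_ideal_def at0_preimage_def)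
    then show ?thesis using T.tame_I[OF tame_polys t(2)] by simp
  qed
  have reg: "weakly_regular V I (esyms V r) \<longleftrightarrow>
      weakly_regular V I1 (esyms V r) \<and> weakly_regular V ?A (esyms V r)" for r
  proof
    assume reg: "weakly_regular V I (esyms V r)"
    have acyc: "acyclic_at V I q" if "card V < q + r" for q
      using that
      by (intro acyclic_at_of_weakly_regular[OF V I(1) esyms_in_graded_max_ideal[OF V] reg]) simp
    have "r < card V"
      using not_acyclic_1[OF V I max assms(3)] acyc[of 1] not_acyclic_0[OF V I(1) max] acyc[of 0]
      by linarith
    then show "weakly_regular V I1 (esyms V r) \<and> weakly_regular V ?A (esyms V r)"
      using S.weakly_regular_parts[of r] acyc t by (auto simp: tame_def I_eq)
  next
    assume "weakly_regular V I1 (esyms V r) \<and> weakly_regular V ?A (esyms V r)"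
    then show "weakly_regular V I (esyms V r)" using S.weakly_regular_I[of "esyms V r"] by (simp add: I_eq)
  qed
  have depth: "depth_quot V I = min (depth_quot V I1) (depth_quot V ?A)"
    by (rule enat_eqI)
      (simp add: depth_quot_ge_iff[OF V tI max] depth_quot_ge_iff[OF V t(1) max1]
        depth_quot_ge_iff[OF V tA maxA] reg)
  have dim: "dim_quot V I = max (dim_quot V I1) (dim_quot V ?A)"
    using dim_quot_split[OF I(1), of "var i"] S.i_in_V by (simp add: colon)
  have le: "depth_quot V I1 \<le> dim_quot V I1" "depth_quot V ?A \<le> dim_quot V ?A"
    using depth_quot_le_dim_quot[OF V t(1) max1] depth_quot_le_dim_quot[OF V tA maxA] by auto
  have "depth_quot V I = dim_quot V I \<longleftrightarrow> depth_quot V I1 = dim_quot V I1 \<and>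
      depth_quot V ?A = dim_quot V ?A \<and> depth_quot V I1 = depth_quot V ?A"
    unfolding depth dim using le
    by (auto simp: min_def max_def split: if_splits)
  then show ?thesis
    unfolding V_def[symmetric] cohen_macaulay_ideal_def cohen_macaulay_module_def colon Idl .
qed

end
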